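(* Let $t>0$, let $\Gamma$ be a closed curve in $\mathbb C$ and $\overline\Delta$ the closure of the scalar Laplacian on $(M^3_{A\Gamma},h_t)$, where $A\in U(2)$. Then, for arbitrary $\delta>0$, $$\inf\sigma_{\mathrm{ess}}(\overline\Delta)<\delta.$$
   Context: Eguchi--Hanson space: $T^*\mathbb P^1(\mathbb C)$ is realized as $H^2=\{(\alpha,\beta,\gamma)\in(\mathbb C^2\setminus\{0\})\times\mathbb C\}/\sim$, where $(\alpha,\beta,\gamma)\sim(A\alpha,A\beta,\gamma/A^2)$ for $A\in\mathbb C^*$; the projection is $p([\alpha,\beta,\gamma])=\alpha/\beta\in\mathbb C\cup\{\infty\}=\mathbb P^1(\mathbb C)$. The complement of the zero section $\{\gamma=0\}$ is identified with $(\mathbb C^2\setminus\{0\})/\{\pm1\}$ by $[\alpha,\beta,\gamma]\mapsto \pm(z_1,z_2)=\pm(\alpha\sqrt\gamma,\beta\sqrt\gamma)$. Put $u_1=|z_1|^2+|z_2|^2$ and $f_t=\sqrt{u_1^2+t^4}+t^2\log\frac{u_1}{\sqrt{u_1^2+t^4}+t^2}$. The form $\omega_t=i\partial\bar\partial f_t$ extends to a Kähler form on $H^2$, and $g_t(X,Y)=\omega_t(X,JY)$ is the Eguchi--Hanson metric ($J$ the complex structure). For a smooth curve $\Gamma$, $M^3_\Gamma=p^{-1}(\Gamma)\subset H^2$ with the metric $h_t$ induced by $g_t$; for closed $\Gamma$ and $t\ne0$ it is complete. $U(2)$ acts on $\mathbb C\cup\{\infty\}$ by Möbius transforms $z\mapsto\frac{az+b}{cz+d}$.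 $\Delta=-\mathrm{div}\,\mathrm{grad}$ acts in $L^2$ with domain the compactly supported smooth functions (essentially self-adjoint). $\sigma_{\mathrm{ess}}$ is the essential spectrum. *)

theory Defs
  imports "HOL-Analysis.Analysis"
begin

text \<open>A vector \<open>v :: complex^3\<close> stands for the triple \<open>(\<alpha>, \<beta>, \<gamma>) = (v$1, v$2, v$3)\<close>.\<close>

definition total_space :: "(complex^3) set" where
  "total_space = {v. v$1 \<noteq> 0 \<or> v$2 \<noteq> 0}"

definition EH_rel :: "complex^3 \<Rightarrow> complex^3 \<Rightarrow> bool" where
  "EH_rel v w \<longleftrightarrow> v \<in> total_space \<and> w \<in> total_space \<and>
     (\<exists>a. a \<noteq> 0 \<and> w$1 = a * v$1 \<and> w$2 = a * v$2 \<and> w$3 = v$3 / a\<^sup>2)"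

lemma part_equivp_EH_rel: "part_equivp EH_rel"
proof (rule part_equivpI)
  have "EH_rel (vector [1, 1, 1]) (vector [1, 1, 1])"
    unfolding EH_rel_def total_space_def by (auto intro!: exI[of _ 1])
  then show "\<exists>v. EH_rel v v" by blast
  show "symp EH_rel"
  proof (rule sympI)
    fix v w assume "EH_rel v w"
    then obtain a where "v \<in> total_space" "w \<in> total_space" "a \<noteq> 0"
      "w$1 = a * v$1" "w$2 = a * v$2" "w$3 = v$3 / a\<^sup>2"
      unfolding EH_rel_def by blast
    then show "EH_rel w v"
      unfolding EH_rel_def by (auto intro!: exI[of _ "1/a"] simp: power_divide)
  qed
  show "transp EH_rel"
  proof (rule transpI)
    fix u v w assume "EH_rel u v" "EH_rel v w"
    then obtain a b where "u \<in> total_space" "w \<in> total_space" "a \<noteq> 0" "b \<noteq> 0"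
      "v$1 = a * u$1" "v$2 = a * u$2" "v$3 = u$3 / a\<^sup>2"
      "w$1 = b * v$1" "w$2 = b * v$2" "w$3 = v$3 / b\<^sup>2"
      unfolding EH_rel_def by blast
    then show "EH_rel u w"
      unfolding EH_rel_def by (auto intro!: exI[of _ "b * a"] simp: power_mult_distrib mult_ac)
  qed
qed

quotient_type EH = "complex^3" / partial: EH_rel
  by (rule part_equivp_EH_rel)

lemma abs_EH_eq_iff:
  assumes "v \<in> total_space" "w \<in> total_space"
  shows "abs_EH v = abs_EH w \<longleftrightarrow> EH_rel v w"
proof -
  have refl: "EH_rel u u" if "u \<in> total_space" for u
    using that unfolding EH_rel_def by (auto intro!: exI[of _ 1])
  show ?thesis
    using Quotient3_rel[OF Quotient3_EH, of v w] refl assms by blast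
qed

lemma open_total_space: "open total_space"
proof -
  have "open {v :: complex^3. v$1 \<noteq> 0}" "open {v :: complex^3. v$2 \<noteq> 0}"
    by (intro open_Collect_neq continuous_intros)+
  then have "open ({v :: complex^3. v$1 \<noteq> 0} \<union> {v. v$2 \<noteq> 0})" by (rule open_Un)
  moreover have "{v :: complex^3. v$1 \<noteq> 0} \<union> {v. v$2 \<noteq> 0} = total_space"
    unfolding total_space_def by blast
  ultimately show ?thesis by simp
qed

text \<open>The quotient topology.\<close>

instantiation EH :: topological_space
begin

definition open_EH :: "EH set \<Rightarrow> bool" where
  "open_EH U \<longleftrightarrow> open {v \<in> total_space. abs_EH v \<in> U}"

instance
proof
  show "open (UNIV :: EH set)"
    using open_total_space by (simp add: open_EH_def)
next
  fix S T :: "EH set" assume "open S" "open T"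
  then have "open ({v \<in> total_space. abs_EH v \<in> S} \<inter> {v \<in> total_space. abs_EH v \<in> T})"
    unfolding open_EH_def by (rule open_Int)
  moreover have "{v \<in> total_space. abs_EH v \<in> S} \<inter> {v \<in> total_space. abs_EH v \<in> T}
      = {v \<in> total_space. abs_EH v \<in> S \<inter> T}" by blast
  ultimately show "open (S \<inter> T)" unfolding open_EH_def by simp
next
  fix K :: "EH set set" assume "\<forall>S\<in>K. open S"
  then have "open (\<Union>S\<in>K. {v \<in> total_space. abs_EH v \<in> S})"
    unfolding open_EH_def by blast
  moreover have "(\<Union>S\<in>K. {v \<in> total_space. abs_EH v \<in> S}) = {v \<in> total_space. abs_EH v \<in> \<Union>K}"
    by blast
  ultimately show "open (\<Union>K)" unfolding open_EH_def by simp
qed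

end

datatype riemann_sphere = Fin complex | Infinity

lift_definition EH_proj :: "EH \<Rightarrow> riemann_sphere" is
  "\<lambda>v. if v$2 = 0 then Infinity else Fin (v$1 / v$2)"
  unfolding EH_rel_def by auto

text \<open>\<open>u\<^sub>1 = \<bar>z\<^sub>1\<bar>\<^sup>2 + \<bar>z\<^sub>2\<bar>\<^sup>2\<close> with \<open>(z\<^sub>1, z\<^sub>2) = (\<alpha> \<surd>\<gamma>, \<beta> \<surd>\<gamma>)\<close>; the choice of the
  square root does not matter.\<close>

lift_definition EH_u1 :: "EH \<Rightarrow> real" is
  "\<lambda>v. (cmod (v$1 * csqrt (v$3)))\<^sup>2 + (cmod (v$2 * csqrt (v$3)))\<^sup>2"
  unfolding EH_rel_def
  by (auto simp: norm_mult power_mult_distrib norm_csqrt norm_divide norm_power)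

definition EH_potential :: "real \<Rightarrow> EH \<Rightarrow> real" where
  "EH_potential t q =
     sqrt ((EH_u1 q)\<^sup>2 + t^4) + t\<^sup>2 * ln (EH_u1 q / (sqrt ((EH_u1 q)\<^sup>2 + t^4) + t\<^sup>2))"

definition wirt :: "'n \<Rightarrow> (complex^'n::finite \<Rightarrow> complex) \<Rightarrow> complex^'n \<Rightarrow> complex" where
  "wirt j f p = (frechet_derivative f (at p) (axis j 1)
      - \<i> * frechet_derivative f (at p) (axis j \<i>)) / 2"

definition wirt_bar :: "'n \<Rightarrow> (complex^'n::finite \<Rightarrow> complex) \<Rightarrow> complex^'n \<Rightarrow> complex" where
  "wirt_bar j f p = (frechet_derivative f (at p) (axis j 1)
      + \<i> * frechet_derivative f (at p) (axis j \<i>)) / 2"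

text \<open>The two-form \<open>i \<partial>\<partial>\<^sup>- f = i \<Sum>\<^sub>j\<^sub>k (\<partial>\<^sup>2f / \<partial>z\<^sub>j\<partial>z\<^sub>k\<^sup>-) dz\<^sub>j \<and> dz\<^sub>k\<^sup>-\<close>.\<close>

definition i_ddbar ::
  "(complex^'n::finite \<Rightarrow> real) \<Rightarrow> complex^'n \<Rightarrow> complex^'n \<Rightarrow> complex^'n \<Rightarrow> real" where
  "i_ddbar f p X Y = Re (\<i> * (\<Sum>j\<in>UNIV. \<Sum>k\<in>UNIV.
      wirt j (wirt_bar k (\<lambda>z. complex_of_real (f z))) p * (X$j * cnj (Y$k) - Y$j * cnj (X$k))))"

text \<open>
  Tensors on \<open>H\<^sup>2\<close> are represented by their pull-backs along the holomorphic submersion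
  \<open>abs_EH\<close> from \<open>total_space\<close>, an open subset of \<open>complex^3\<close>, onto \<open>H\<^sup>2\<close>. A tangent vector of \<open>H\<^sup>2\<close>
  at \<open>abs_EH p\<close> is the image of some \<open>X :: complex^3\<close>, and \<open>EH_omega t p X Y\<close> is \<open>\<omega>\<^sub>t\<close> evaluated
  on the images of \<open>X\<close> and \<open>Y\<close>; since \<open>abs_EH\<close> is holomorphic, \<open>i \<partial>\<partial>\<^sup>-\<close> and the complex
  structure \<open>J\<close> commute with the pull-back. Along the zero section \<open>\<gamma> = 0\<close>, where \<open>f\<^sub>t\<close> is
  singular, the form is the continuous extension.
\<close>

definition EH_omega :: "real \<Rightarrow> complex^3 \<Rightarrow> complex^3 \<Rightarrow> complex^3 \<Rightarrow> real" where
  "EH_omega t p X Y =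
     (if p$3 \<noteq> 0 then i_ddbar (\<lambda>v. EH_potential t (abs_EH v)) p X Y
      else Lim (at p within {q. q$3 \<noteq> 0})
             (\<lambda>q. i_ddbar (\<lambda>v. EH_potential t (abs_EH v)) q X Y))"

definition EH_metric :: "real \<Rightarrow> complex^3 \<Rightarrow> complex^3 \<Rightarrow> complex^3 \<Rightarrow> real" where
  "EH_metric t p X Y = EH_omega t p X (\<chi> j. \<i> * Y$j)"

fun Ck :: "nat \<Rightarrow> ('a::real_normed_vector \<Rightarrow> 'b::real_normed_vector) \<Rightarrow> bool" where
  "Ck 0 f \<longleftrightarrow> continuous_on UNIV f"
| "Ck (Suc k) f \<longleftrightarrow> (\<forall>x. f differentiable (at x)) \<and>
     (\<forall>v. Ck k (\<lambda>x. frechet_derivative f (at x) v))"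

definition smooth :: "('a::real_normed_vector \<Rightarrow> 'b::real_normed_vector) \<Rightarrow> bool" where
  "smooth f \<longleftrightarrow> (\<forall>k. Ck k f)"

text \<open>A closed curve is an embedded circle, so that its preimage in \<open>H\<^sup>2\<close> is a submanifold. It is
  given by a regular parametrization \<open>c\<close> of period \<open>L\<close>.\<close>

definition smooth_closed_curve :: "(real \<Rightarrow> complex) \<Rightarrow> real \<Rightarrow> bool" where
  "smooth_closed_curve c L \<longleftrightarrow> L > 0 \<and> smooth c \<and> (\<forall>s. c (s + L) = c s) \<and>
     (\<forall>s. vector_derivative c (at s) \<noteq> 0) \<and> inj_on c {0..<L}"

definition unitary2 :: "complex^2^2 \<Rightarrow> bool" where
  "unitary2 A \<longleftrightarrow> A ** (\<chi> i j. cnj (A$j$i)) = mat 1"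

fun moebius_transform :: "complex^2^2 \<Rightarrow> riemann_sphere \<Rightarrow> riemann_sphere" where
  "moebius_transform A (Fin z) =
     (if A$2$1 * z + A$2$2 = 0 then Infinity
      else Fin ((A$1$1 * z + A$1$2) / (A$2$1 * z + A$2$2)))"
| "moebius_transform A Infinity = (if A$2$1 = 0 then Infinity else Fin (A$1$1 / A$2$1))"

definition M3 :: "riemann_sphere set \<Rightarrow> EH set" where
  "M3 \<Gamma> = EH_proj -` \<Gamma>"

definition M3_curve :: "complex^2^2 \<Rightarrow> (real \<Rightarrow> complex) \<Rightarrow> EH set" where
  "M3_curve A c = M3 (moebius_transform A ` Fin ` range c)"

text \<open>
  Since \<open>(A\<^sub>1\<^sub>1 z + A\<^sub>1\<^sub>2, A\<^sub>2\<^sub>1 z + A\<^sub>2\<^sub>2)\<close> are homogeneous coordinates of the Moebius transform of \<open>z\<close>,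
  the point \<open>(s, x, y)\<close> is mapped to the vector \<open>x + \<i>y\<close> in the fibre over the transform of \<open>c s\<close>.
  The composition \<open>param\<close> with the quotient map is a smooth covering of \<open>M3_curve A c\<close> by \<open>real^3\<close>,
  with \<open>param_box L\<close> as a fundamental domain. Its local inverses are the charts of the submanifold.
\<close>

definition param_lift :: "complex^2^2 \<Rightarrow> (real \<Rightarrow> complex) \<Rightarrow> real^3 \<Rightarrow> complex^3" where
  "param_lift A c x = vector [A$1$1 * c (x$1) + A$1$2, A$2$1 * c (x$1) + A$2$2, Complex (x$2) (x$3)]"

definition param :: "complex^2^2 \<Rightarrow> (real \<Rightarrow> complex) \<Rightarrow> real^3 \<Rightarrow> EH" where
  "param A c x = abs_EH (param_lift A c x)"

definition param_box :: "real \<Rightarrow> (real^3) set" where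
  "param_box L = {x. 0 \<le> x$1 \<and> x$1 < L}"

definition pd :: "'n \<Rightarrow> (real^'n::finite \<Rightarrow> 'b::real_normed_vector) \<Rightarrow> real^'n \<Rightarrow> 'b" where
  "pd i f x = frechet_derivative f (at x) (axis i 1)"

definition induced_metric ::
  "real \<Rightarrow> complex^2^2 \<Rightarrow> (real \<Rightarrow> complex) \<Rightarrow> real^3 \<Rightarrow> real^3^3" where
  "induced_metric t A c x =
     (\<chi> i j. EH_metric t (param_lift A c x) (pd i (param_lift A c) x) (pd j (param_lift A c) x))"

text \<open>Gradient and divergence with respect to a metric given by its Gram matrix \<open>h\<close> in coordinates.\<close>

definition grad_coord ::
  "(real^'n::finite \<Rightarrow> real^'n^'n) \<Rightarrow> (real^'n \<Rightarrow> complex) \<Rightarrow> real^'n \<Rightarrow> complex^'n" where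
  "grad_coord h f x = (\<chi> i. \<Sum>j\<in>UNIV. of_real (matrix_inv (h x) $ i $ j) * pd j f x)"

definition div_coord ::
  "(real^'n::finite \<Rightarrow> real^'n^'n) \<Rightarrow> (real^'n \<Rightarrow> complex^'n) \<Rightarrow> real^'n \<Rightarrow> complex" where
  "div_coord h V x =
     (\<Sum>i\<in>UNIV. pd i (\<lambda>y. of_real (sqrt (det (h y))) * V y $ i) x) / of_real (sqrt (det (h x)))"

definition laplacian ::
  "real \<Rightarrow> complex^2^2 \<Rightarrow> (real \<Rightarrow> complex) \<Rightarrow> real \<Rightarrow> (EH \<Rightarrow> complex) \<Rightarrow> EH \<Rightarrow> complex" where
  "laplacian t A c L \<phi> q =
     (let h = induced_metric t A c in
      - div_coord h (grad_coord h (\<phi> \<circ> param A c)) (inv_into (param_box L) (param A c) q))"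

definition volume_measure ::
  "real \<Rightarrow> complex^2^2 \<Rightarrow> (real \<Rightarrow> complex) \<Rightarrow> real \<Rightarrow> EH measure" where
  "volume_measure t A c L =
     distr (density (lebesgue_on (param_box L)) (\<lambda>x. ennreal (sqrt (det (induced_metric t A c x)))))
       (restrict_space borel (M3_curve A c)) (param A c)"

definition test_functions :: "complex^2^2 \<Rightarrow> (real \<Rightarrow> complex) \<Rightarrow> (EH \<Rightarrow> complex) set" where
  "test_functions A c = {\<phi>. smooth (\<phi> \<circ> param A c) \<and>
     compact (closure {q \<in> M3_curve A c. \<phi> q \<noteq> 0})}"

lemma unitary2_det:
  assumes "unitary2 A"
  shows "A$1$1 * A$2$2 - A$1$2 * A$2$1 \<noteq> 0"
proof -
  have "det A * det (\<chi> i j. cnj (A$j$i)) = 1"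
    using assms unfolding unitary2_def by (metis det_mul det_I)
  then show ?thesis by (auto simp: det_2)
qed

lemma homogeneous_eq:
  fixes a b c d k z w :: complex
  assumes "a * d - b * c \<noteq> 0" "a * w + b = k * (a * z + b)" "c * w + d = k * (c * z + d)"
  shows "w = z \<and> k = 1"
proof -
  have "(a * d - b * c) * (1 - k)
      = a * ((c * w + d) - k * (c * z + d)) - c * ((a * w + b) - k * (a * z + b))"
    by (simp add: algebra_simps)
  moreover have "(a * d - b * c) * (w - k * z)
      = d * ((a * w + b) - k * (a * z + b)) - b * ((c * w + d) - k * (c * z + d))"
    by (simp add: algebra_simps)
  ultimately have "k = 1" "w = k * z" using assms by auto
  then show ?thesis by simp
qed

lemma homogeneous_nonzero:
  fixes a b c d z :: complex
  assumes "a * d - b * c \<noteq> 0"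
  shows "a * z + b \<noteq> 0 \<or> c * z + d \<noteq> 0"
  using homogeneous_eq[OF assms, of z 0 z] homogeneous_eq[OF assms, of z 0 "z + 1"] by auto

lemma param_lift_nth [simp]:
  "param_lift A c x $ 1 = A$1$1 * c (x$1) + A$1$2"
  "param_lift A c x $ 2 = A$2$1 * c (x$1) + A$2$2"
  "param_lift A c x $ 3 = Complex (x$2) (x$3)"
  by (simp_all add: param_lift_def)

lemma param_lift_total_space:
  assumes "unitary2 A"
  shows "param_lift A c x \<in> total_space"
  using homogeneous_nonzero[OF unitary2_det[OF assms]] by (simp add: total_space_def)

lemma EH_proj_abs:
  assumes "v \<in> total_space"
  shows "EH_proj (abs_EH v) = (if v$2 = 0 then Infinity else Fin (v$1 / v$2))"
proof -
  have "EH_rel v v" using assms unfolding EH_rel_def by (auto intro!: exI[of _ 1])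
  then show ?thesis by (simp add: EH_proj.abs_eq)
qed

lemma EH_proj_param:
  assumes "unitary2 A"
  shows "EH_proj (param A c x) = moebius_transform A (Fin (c (x$1)))"
  using assms by (simp add: param_def EH_proj_abs param_lift_total_space)

lemma EH_cases:
  obtains v where "v \<in> total_space" "q = abs_EH v"
proof -
  have "EH_rel (rep_EH q) (rep_EH q)" by (rule Quotient3_rep_reflp[OF Quotient3_EH])
  then show ?thesis
    using that[of "rep_EH q"] Quotient3_abs_rep[OF Quotient3_EH, of q] unfolding EH_rel_def by simp
qed

lemma param_bij:
  assumes c: "smooth_closed_curve c L" and A: "unitary2 A"
  shows "bij_betw (param A c) (param_box L) (M3_curve A c)"
proof (rule bij_betw_imageI)
  note D = unitary2_det[OF A]
  have L: "L > 0" and per: "\<And>s. c (s + L) = c s" and inj: "inj_on c {0..<L}"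
    using c unfolding smooth_closed_curve_def by auto
  show "inj_on (param A c) (param_box L)"
  proof (rule inj_onI)
    fix x y assume x: "x \<in> param_box L" and y: "y \<in> param_box L" and eq: "param A c x = param A c y"
    have "EH_rel (param_lift A c x) (param_lift A c y)"
      using eq by (simp add: param_def abs_EH_eq_iff param_lift_total_space A)
    then obtain k where k: "A$1$1 * c (y$1) + A$1$2 = k * (A$1$1 * c (x$1) + A$1$2)"
      "A$2$1 * c (y$1) + A$2$2 = k * (A$2$1 * c (x$1) + A$2$2)"
      "Complex (y$2) (y$3) = Complex (x$2) (x$3) / k\<^sup>2"
      unfolding EH_rel_def by auto
    have "c (y$1) = c (x$1) \<and> k = 1" using homogeneous_eq[OF D k(1,2)] .
    moreover from this have "x$1 = y$1"
      using inj x y unfolding param_box_def inj_on_def by auto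
    ultimately show "x = y" using k(3) by (simp add: vec_eq_iff forall_3)
  qed
  have pern: "c (s + real n * L) = c s" for s n
  proof (induction n)
    case (Suc n)
    then show ?case using per[of "s + real n * L"] by (simp add: algebra_simps)
  qed simp
  have peri: "c (s + of_int n * L) = c s" for s n
  proof (cases "n \<ge> 0")
    case True
    then show ?thesis using pern[of s "nat n"] by simp
  next
    case False
    then show ?thesis using pern[of "s + of_int n * L" "nat (- n)"] by simp
  qed
  show "param A c ` param_box L = M3_curve A c"
  proof (intro subset_antisym subsetI)
    fix q assume "q \<in> param A c ` param_box L"
    then obtain x where "q = param A c x" by blast
    then show "q \<in> M3_curve A c"
      using EH_proj_param[OF A, of c x] unfolding M3_curve_def M3_def by blast
  next
    fix q assume "q \<in> M3_curve A c"
    then obtain s where s: "EH_proj q = moebius_transform A (Fin (c s))"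
      unfolding M3_curve_def M3_def by auto
    define s' where "s' = s + of_int (- \<lfloor>s / L\<rfloor>) * L"
    have s': "c s' = c s" "0 \<le> s'" "s' < L"
      unfolding s'_def using peri[of s "- \<lfloor>s / L\<rfloor>"] L
        floor_divide_lower[OF L, of s] floor_divide_upper[OF L, of s]
      by (auto simp: algebra_simps)
    obtain v where v: "v \<in> total_space" "q = abs_EH v" by (rule EH_cases)
    define p1 p2 where "p1 = A$1$1 * c s + A$1$2" and "p2 = A$2$1 * c s + A$2$2"
    have nz: "p1 \<noteq> 0 \<or> p2 \<noteq> 0"
      unfolding p1_def p2_def by (rule homogeneous_nonzero[OF D])
    have pr: "(if v$2 = 0 then Infinity else Fin (v$1 / v$2)) = (if p2 = 0 then Infinity else Fin (p1 / p2))"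
      using s v by (simp add: EH_proj_abs p1_def p2_def)
    obtain k where k: "k \<noteq> 0" "p1 = k * v$1" "p2 = k * v$2"
    proof (cases "p2 = 0")
      case True
      then have "v$2 = 0" using pr by (auto split: if_splits)
      moreover from this have "v$1 \<noteq> 0" using v unfolding total_space_def by auto
      ultimately show ?thesis using that[of "p1 / v$1"] True nz by auto
    next
      case False
      then have "v$2 \<noteq> 0" "v$1 / v$2 = p1 / p2" using pr by (auto split: if_splits)
      then show ?thesis using that[of "p2 / v$2"] False by (auto simp: field_simps)
    qed
    define x :: "real^3" where "x = vector [s', Re (v$3 / k\<^sup>2), Im (v$3 / k\<^sup>2)]"
    have xs: "x$1 = s'" "x$2 = Re (v$3 / k\<^sup>2)" "x$3 = Im (v$3 / k\<^sup>2)"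
      by (simp_all add: x_def)
    have "EH_rel v (param_lift A c x)"
      unfolding EH_rel_def using v(1) param_lift_total_space[OF A, of c x] k s'(1)
      by (auto simp: xs p1_def p2_def intro!: exI[of _ k])
    then have "q = param A c x"
      using v param_lift_total_space[OF A, of c x] by (simp add: param_def abs_EH_eq_iff)
    moreover have "x \<in> param_box L" using s' by (simp add: param_box_def xs)
    ultimately show "q \<in> param A c ` param_box L" by blast
  qed
qed

text \<open>Elements of \<open>L\<^sup>2(N)\<close> are represented by square-integrable functions, with equality almost
  everywhere. An operator is represented by its graph, a set of pairs of such functions.\<close>

definition L2 :: "'a measure \<Rightarrow> ('a \<Rightarrow> complex) set" where
  "L2 N = {f \<in> borel_measurable N. integrable N (\<lambda>x. (cmod (f x))\<^sup>2)}"

definition L2_norm :: "'a measure \<Rightarrow> ('a \<Rightarrow> complex) \<Rightarrow> real" where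
  "L2_norm N f = sqrt (\<integral>x. (cmod (f x))\<^sup>2 \<partial>N)"

definition L2_lim :: "'a measure \<Rightarrow> (nat \<Rightarrow> 'a \<Rightarrow> complex) \<Rightarrow> ('a \<Rightarrow> complex) \<Rightarrow> bool" where
  "L2_lim N F f \<longleftrightarrow> (\<lambda>n. L2_norm N (\<lambda>x. F n x - f x)) \<longlonglongrightarrow> 0"

type_synonym 'a oper = "(('a \<Rightarrow> complex) \<times> ('a \<Rightarrow> complex)) set"

definition op_closure :: "'a measure \<Rightarrow> 'a oper \<Rightarrow> 'a oper" where
  "op_closure N T = {(f, g). f \<in> L2 N \<and> g \<in> L2 N \<and>
     (\<exists>F G. (\<forall>n. F n \<in> L2 N \<and> G n \<in> L2 N \<and> (F n, G n) \<in> T) \<and> L2_lim N F f \<and> L2_lim N G g)}"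

definition op_shift :: "'a oper \<Rightarrow> complex \<Rightarrow> 'a oper" where
  "op_shift T z = {(f, \<lambda>x. g x - z * f x) | f g. (f, g) \<in> T}"

definition op_kernel :: "'a measure \<Rightarrow> 'a oper \<Rightarrow> ('a \<Rightarrow> complex) set" where
  "op_kernel N T = {f. \<exists>g. (f, g) \<in> T \<and> (AE x in N. g x = 0)}"

definition op_range :: "'a oper \<Rightarrow> ('a \<Rightarrow> complex) set" where
  "op_range T = {g. \<exists>f. (f, g) \<in> T}"

definition L2_closed :: "'a measure \<Rightarrow> ('a \<Rightarrow> complex) set \<Rightarrow> bool" where
  "L2_closed N S \<longleftrightarrow>
     (\<forall>F f. (\<forall>n. F n \<in> S) \<and> f \<in> L2 N \<and> L2_lim N F f \<longrightarrow> (\<exists>g\<in>S. AE x in N. f x = g x))"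

text \<open>For \<open>U = {\<lambda>x. 0}\<close> this says that \<open>S\<close> has finite dimension, and for \<open>S = L2 N\<close> that \<open>U\<close> has
  finite codimension.\<close>

definition finite_dim_modulo :: "'a measure \<Rightarrow> ('a \<Rightarrow> complex) set \<Rightarrow> ('a \<Rightarrow> complex) set \<Rightarrow> bool" where
  "finite_dim_modulo N S U \<longleftrightarrow> (\<exists>B. finite B \<and> B \<subseteq> L2 N \<and>
     (\<forall>f\<in>S. \<exists>u\<in>U. \<exists>a. AE x in N. f x = u x + (\<Sum>b\<in>B. a b * b x)))"

definition fredholm :: "'a measure \<Rightarrow> 'a oper \<Rightarrow> bool" where
  "fredholm N T \<longleftrightarrow> finite_dim_modulo N (op_kernel N T) {\<lambda>x. 0} \<and>
     L2_closed N (op_range T) \<and> finite_dim_modulo N (L2 N) (op_range T)"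

definition essential_spectrum :: "'a measure \<Rightarrow> 'a oper \<Rightarrow> complex set" where
  "essential_spectrum N T = {z. \<not> fredholm N (op_shift T z)}"

definition closed_laplacian ::
  "real \<Rightarrow> complex^2^2 \<Rightarrow> (real \<Rightarrow> complex) \<Rightarrow> real \<Rightarrow> EH oper" where
  "closed_laplacian t A c L =
     op_closure (volume_measure t A c L) {(\<phi>, laplacian t A c L \<phi>) | \<phi>. \<phi> \<in> test_functions A c}"

end

(*
  Zero itself lies in the essential spectrum, because the range of the Laplacian has infinite
  codimension. For a function X of u_1^2 alone, Green's formula moves the Laplacian of a test
  function onto X: the horizontal lift of the curve direction annihilates u_1, so the resulting
  function is again radial, with the ordinary differential operator radial_laplacian applied to X.
  The manifold is asymptotically conical. Hence for X supported in n <= u_1 <= 2n the quotient of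
  the norms of the transformed function and of X is O(1/n). Along n = n_0 2^k one gets orthonormal
  functions p_k with disjoint supports and functions e_k tending to 0 in L^2 such that
  <Delta f, p_k> = <f, e_k> on the domain of the closure. If finitely many b spanned a complement
  of the range, every g in L^2 would satisfy |<g, p_k>| <= C_g (|e_k| + sum_b |<b, p_k>|). The
  bracket tends to 0, and a sparse series g = sum_j 2^(-j) p_(k_j) violates this bound.
*)
theory Submission
  imports Defs
begin

section \<open>Weak convergence and ranges of infinite codimension\<close>

text \<open>A Weyl sequence would have to lie in the domain of the closure, so it would consist of
  smooth test functions or limits of such. Working with the range reverses the roles: the smooth
  test function is arbitrary and the cut-offs occur only in pairings. They may then be mere C^2
  functions, here rescaled cubes of a truncated quadratic. The zero section is the other obstacle,
  since the metric is given there only as a limit. It is never evaluated: the parameters of the zero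
  section form a null set, and off this set metric, density and flux agree with expressions that are
  continuously differentiable for all parameters. Integration by parts is carried out with these
  expressions on the whole strip. The unitary matrix disappears early, because the potential and its
  Hessian see the homogeneous coordinates only through Hermitian products.\<close>

lemma L2_pairing:
  fixes p :: "'a \<Rightarrow> real"
  assumes "f \<in> L2 N" "p \<in> borel_measurable N" "integrable N (\<lambda>x. (p x)\<^sup>2)"
  shows "integrable N (\<lambda>x. f x * of_real (p x))"
    and "cmod (\<integral>x. f x * of_real (p x) \<partial>N) \<le> L2_norm N f * sqrt (\<integral>x. (p x)\<^sup>2 \<partial>N)"
proof -
  have f [measurable]: "f \<in> borel_measurable N" and f2: "integrable N (\<lambda>x. (cmod (f x))\<^sup>2)"
    using assms(1) by (auto simp: L2_def)
  note [measurable] = assms(2)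
  show i: "integrable N (\<lambda>x. f x * of_real (p x))"
  proof (rule Bochner_Integration.integrable_bound[OF Bochner_Integration.integrable_add[OF f2 assms(3)]])
    have "cmod (f x) * \<bar>p x\<bar> \<le> (cmod (f x))\<^sup>2 + (p x)\<^sup>2" for x
    proof -
      have "2 * (cmod (f x) * \<bar>p x\<bar>) \<le> (cmod (f x))\<^sup>2 + (p x)\<^sup>2"
        using sum_squares_bound[of "cmod (f x)" "\<bar>p x\<bar>"] by simp
      moreover have "0 \<le> cmod (f x) * \<bar>p x\<bar>" by simp
      ultimately show ?thesis by linarith
    qed
    then show "AE x in N. norm (f x * of_real (p x)) \<le> norm ((cmod (f x))\<^sup>2 + (p x)\<^sup>2)"
      by (simp add: norm_mult)
  qed measurable
  have i': "integrable N (\<lambda>x. cmod (f x) * \<bar>p x\<bar>)"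
    using integrable_norm[OF i] by (simp add: norm_mult)
  \<comment> \<open>Cauchy-Schwarz is applied to extended nonnegative integrals. The integral of the
    product is moved to \<open>ennreal\<close> by its integrability, which rests on 2ab <= a^2 +
    b^2.\<close>
  define I where "I = (\<integral>x. cmod (f x) * \<bar>p x\<bar> \<partial>N)"
  have I: "I \<ge> 0" unfolding I_def by (intro integral_nonneg_AE) simp
  have "(\<integral>\<^sup>+x. ennreal (cmod (f x)) * ennreal \<bar>p x\<bar> \<partial>N) = ennreal I"
    unfolding I_def by (subst nn_integral_eq_integral[OF i', symmetric]) (simp_all add: ennreal_mult)
  then have "ennreal (I^2) = (\<integral>\<^sup>+x. ennreal (cmod (f x)) * ennreal \<bar>p x\<bar> \<partial>N)\<^sup>2"
    by (simp add: ennreal_power I)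
  also have "\<dots> \<le> (\<integral>\<^sup>+x. (ennreal (cmod (f x)))\<^sup>2 \<partial>N) * (\<integral>\<^sup>+x. (ennreal \<bar>p x\<bar>)\<^sup>2 \<partial>N)"
    by (rule Cauchy_Schwarz_nn_integral) measurable
  also have "\<dots> = ennreal ((\<integral>x. (cmod (f x))\<^sup>2 \<partial>N) * (\<integral>x. (p x)\<^sup>2 \<partial>N))"
    using nn_integral_eq_integral[OF f2] nn_integral_eq_integral[OF assms(3)]
    by (simp add: ennreal_power ennreal_mult)
  finally have "I^2 \<le> (\<integral>x. (cmod (f x))\<^sup>2 \<partial>N) * (\<integral>x. (p x)\<^sup>2 \<partial>N)"
    by (subst (asm) ennreal_le_iff) auto
  then have "I \<le> sqrt ((\<integral>x. (cmod (f x))\<^sup>2 \<partial>N) * (\<integral>x. (p x)\<^sup>2 \<partial>N))"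
    by (rule real_le_rsqrt)
  then have "I \<le> L2_norm N f * sqrt (\<integral>x. (p x)\<^sup>2 \<partial>N)"
    by (simp add: L2_norm_def real_sqrt_mult)
  moreover have "cmod (\<integral>x. f x * of_real (p x) \<partial>N) \<le> I"
    unfolding I_def using integral_norm_bound[of N "\<lambda>x. f x * of_real (p x)"] by (simp add: norm_mult)
  ultimately show "cmod (\<integral>x. f x * of_real (p x) \<partial>N) \<le> L2_norm N f * sqrt (\<integral>x. (p x)\<^sup>2 \<partial>N)" by simp
qed

lemma L2_diff:
  assumes "f \<in> L2 N" "g \<in> L2 N"
  shows "(\<lambda>x. f x - g x) \<in> L2 N"
proof -
  have [measurable]: "f \<in> borel_measurable N" "g \<in> borel_measurable N"
    and i: "integrable N (\<lambda>x. (cmod (f x))\<^sup>2)" "integrable N (\<lambda>x. (cmod (g x))\<^sup>2)"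
    using assms by (auto simp: L2_def)
  have "(cmod (f x - g x))\<^sup>2 \<le> 2 * (cmod (f x))\<^sup>2 + 2 * (cmod (g x))\<^sup>2" for x
  proof -
    have "(cmod (f x - g x))\<^sup>2 \<le> (cmod (f x) + cmod (g x))\<^sup>2"
      by (intro power_mono norm_triangle_ineq4) simp
    also have "\<dots> \<le> 2 * (cmod (f x))\<^sup>2 + 2 * (cmod (g x))\<^sup>2"
      using sum_squares_bound[of "cmod (f x)" "cmod (g x)"] by (simp add: power2_sum)
    finally show ?thesis .
  qed
  then have "integrable N (\<lambda>x. (cmod (f x - g x))\<^sup>2)"
    by (intro Bochner_Integration.integrable_bound[OF Bochner_Integration.integrable_add[OF
          integrable_mult_right[OF i(1), of 2] integrable_mult_right[OF i(2), of 2]]]) auto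
  then show ?thesis by (simp add: L2_def)
qed

lemma L2_lim_pairing:
  fixes p :: "'a \<Rightarrow> real"
  assumes "\<And>n. F n \<in> L2 N" "f \<in> L2 N" "L2_lim N F f"
    and "p \<in> borel_measurable N" "integrable N (\<lambda>x. (p x)\<^sup>2)"
  shows "(\<lambda>n. \<integral>x. F n x * of_real (p x) \<partial>N) \<longlonglongrightarrow> (\<integral>x. f x * of_real (p x) \<partial>N)"
proof (rule Lim_transform_bound[THEN LIM_zero_cancel])
  have "cmod ((\<integral>x. F n x * of_real (p x) \<partial>N) - (\<integral>x. f x * of_real (p x) \<partial>N))
     \<le> L2_norm N (\<lambda>x. F n x - f x) * sqrt (\<integral>x. (p x)\<^sup>2 \<partial>N)" for n
    using L2_pairing(2)[OF L2_diff[OF assms(1)[of n] assms(2)] assms(4,5)]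
      L2_pairing(1)[OF assms(1)[of n] assms(4,5)] L2_pairing(1)[OF assms(2,4,5)]
    by (simp add: algebra_simps)
  then show "\<forall>\<^sub>F n in sequentially. norm ((\<integral>x. F n x * of_real (p x) \<partial>N) - (\<integral>x. f x * of_real (p x) \<partial>N))
     \<le> norm (L2_norm N (\<lambda>x. F n x - f x) * sqrt (\<integral>x. (p x)\<^sup>2 \<partial>N))"
    by (smt (verit) always_eventually real_norm_def)
  show "(\<lambda>n. L2_norm N (\<lambda>x. F n x - f x) * sqrt (\<integral>x. (p x)\<^sup>2 \<partial>N)) \<longlonglongrightarrow> 0"
    using assms(3) unfolding L2_lim_def by (rule tendsto_mult_left_zero)
qed

text \<open>Both sides are continuous under convergence in L^2, so the identity passes from
  \<open>T\<close> to its closure. It is demanded only of pairs in \<open>L2 N\<close>, where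
  \<open>op_closure\<close> takes its approximants; for the Laplacian this later supplies
  measurability.\<close>

lemma op_closure_pairing:
  fixes p e :: "'a \<Rightarrow> real"
  assumes "p \<in> borel_measurable N" "integrable N (\<lambda>x. (p x)\<^sup>2)"
    and "e \<in> borel_measurable N" "integrable N (\<lambda>x. (e x)\<^sup>2)"
    and "\<And>f g. (f, g) \<in> T \<Longrightarrow> f \<in> L2 N \<Longrightarrow> g \<in> L2 N \<Longrightarrow>
       (\<integral>x. g x * of_real (p x) \<partial>N) = (\<integral>x. f x * of_real (e x) \<partial>N)"
    and "(f, g) \<in> op_closure N T"
  shows "(\<integral>x. g x * of_real (p x) \<partial>N) = (\<integral>x. f x * of_real (e x) \<partial>N)"
proof -
  obtain F G where FG: "\<And>n. F n \<in> L2 N" "\<And>n. G n \<in> L2 N" "\<And>n. (F n, G n) \<in> T"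
     "L2_lim N F f" "L2_lim N G g" and "f \<in> L2 N" "g \<in> L2 N"
    using assms(6) unfolding op_closure_def by blast
  have "(\<lambda>n. \<integral>x. G n x * of_real (p x) \<partial>N) \<longlonglongrightarrow> (\<integral>x. g x * of_real (p x) \<partial>N)"
    by (rule L2_lim_pairing) fact+
  moreover have "(\<lambda>n. \<integral>x. F n x * of_real (e x) \<partial>N) \<longlonglongrightarrow> (\<integral>x. f x * of_real (e x) \<partial>N)"
    by (rule L2_lim_pairing) fact+
  moreover have "(\<integral>x. G n x * of_real (p x) \<partial>N) = (\<integral>x. F n x * of_real (e x) \<partial>N)" for n
    by (rule assms(5)[OF FG(3,1,2)])
  ultimately show ?thesis using LIMSEQ_unique by simp
qed

lemma disjoint_sum:
  fixes a :: "nat \<Rightarrow> 'b::comm_monoid_add"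
  assumes "\<And>l. l \<noteq> k \<Longrightarrow> a l = 0"
  shows "(\<Sum>l<n. a l) = (if k < n then a k else 0)"
proof -
  have "(\<Sum>l<n. a l) = (\<Sum>l<n. if l = k then a k else 0)" using assms by (intro sum.cong) auto
  then show ?thesis by (simp add: sum.delta)
qed

text \<open>A form of Bessel's inequality: the pairing with \<open>p k\<close> sees \<open>b\<close>
  only on the support of \<open>p k\<close>, and disjoint supports share out the finite squared norm
  of \<open>b\<close>. The squared norms of these pieces are therefore summable.\<close>

lemma disjoint_pairing_tendsto_0:
  fixes p :: "nat \<Rightarrow> 'a \<Rightarrow> real"
  assumes p: "\<And>k. p k \<in> borel_measurable N" "\<And>k. integrable N (\<lambda>x. (p k x)\<^sup>2)" "\<And>k. (\<integral>x. (p k x)\<^sup>2 \<partial>N) = 1"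
    and disj: "\<And>k l x. x \<in> space N \<Longrightarrow> k \<noteq> l \<Longrightarrow> p k x * p l x = 0"
    and b: "b \<in> L2 N"
  shows "(\<lambda>k. cmod (\<integral>x. b x * of_real (p k x) \<partial>N)) \<longlonglongrightarrow> 0"
proof -
  have [measurable]: "b \<in> borel_measurable N" "\<And>k. p k \<in> borel_measurable N"
    and b2: "integrable N (\<lambda>x. (cmod (b x))\<^sup>2)"
    using b p by (auto simp: L2_def)
  define q where "q k x = (if p k x = 0 then 0 else b x)" for k x
  have q2: "integrable N (\<lambda>x. (cmod (q k x))\<^sup>2)" for k
    by (rule Bochner_Integration.integrable_bound[OF b2]) (auto simp: q_def)
  have [measurable]: "q k \<in> borel_measurable N" for k unfolding q_def by measurable
  have q: "q k \<in> L2 N" for k using q2[of k] by (auto simp: L2_def)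
  have bd: "(\<Sum>k<n. \<integral>x. (cmod (q k x))\<^sup>2 \<partial>N) \<le> (\<integral>x. (cmod (b x))\<^sup>2 \<partial>N)" for n
  proof -
    have "(\<Sum>k<n. \<integral>x. (cmod (q k x))\<^sup>2 \<partial>N) = (\<integral>x. (\<Sum>k<n. (cmod (q k x))\<^sup>2) \<partial>N)"
      by (rule Bochner_Integration.integral_sum[symmetric]) (rule q2)
    also have "\<dots> \<le> (\<integral>x. (cmod (b x))\<^sup>2 \<partial>N)"
    proof (rule integral_mono[OF _ b2])
      show "integrable N (\<lambda>x. \<Sum>k<n. (cmod (q k x))\<^sup>2)" using q2 by simp
      fix x assume x: "x \<in> space N"
      obtain k where "\<And>l. l \<noteq> k \<Longrightarrow> p l x = 0"
      proof (cases "\<exists>k. p k x \<noteq> 0")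
        case True
        then obtain k where "p k x \<noteq> 0" ..
        then show ?thesis using that[of k] disj[OF x, of k] by fastforce
      qed auto
      then have "(\<Sum>l<n. (cmod (q l x))\<^sup>2) = (if k < n then (cmod (q k x))\<^sup>2 else 0)"
        by (intro disjoint_sum) (simp add: q_def)
      then show "(\<Sum>k<n. (cmod (q k x))\<^sup>2) \<le> (cmod (b x))\<^sup>2" by (simp add: q_def)
    qed
    finally show ?thesis .
  qed
  have "summable (\<lambda>k. \<integral>x. (cmod (q k x))\<^sup>2 \<partial>N)"
    by (rule summableI_nonneg_bounded[OF _ bd]) (simp add: integral_nonneg_AE)
  then have "(\<lambda>k. \<integral>x. (cmod (q k x))\<^sup>2 \<partial>N) \<longlonglongrightarrow> 0" by (rule summable_LIMSEQ_zero)
  then have lim: "(\<lambda>k. L2_norm N (q k)) \<longlonglongrightarrow> 0"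
    unfolding L2_norm_def using tendsto_real_sqrt by fastforce
  have "cmod (\<integral>x. b x * of_real (p k x) \<partial>N) \<le> L2_norm N (q k)" for k
  proof -
    have "(\<integral>x. b x * of_real (p k x) \<partial>N) = (\<integral>x. q k x * of_real (p k x) \<partial>N)"
      by (intro Bochner_Integration.integral_cong) (auto simp: q_def)
    then show ?thesis using L2_pairing(2)[OF q p(1,2), of k k] p(3) by simp
  qed
  then show ?thesis
    by (intro Lim_null_comparison[OF _ lim]) auto
qed

lemma infinite_codim_range:
  fixes p e :: "nat \<Rightarrow> 'a \<Rightarrow> real"
  assumes p: "\<And>k. p k \<in> borel_measurable N" "\<And>k. integrable N (\<lambda>x. (p k x)\<^sup>2)" "\<And>k. (\<integral>x. (p k x)\<^sup>2 \<partial>N) = 1"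
    and disj: "\<And>k l x. x \<in> space N \<Longrightarrow> k \<noteq> l \<Longrightarrow> p k x * p l x = 0"
    and e: "\<And>k. e k \<in> borel_measurable N" "\<And>k. integrable N (\<lambda>x. (e k x)\<^sup>2)" 
       "(\<lambda>k. \<integral>x. (e k x)\<^sup>2 \<partial>N) \<longlonglongrightarrow> 0"
    and T: "\<And>f g k. (f, g) \<in> T \<Longrightarrow> f \<in> L2 N \<and> g \<in> L2 N \<and>
       (\<integral>x. g x * of_real (p k x) \<partial>N) = (\<integral>x. f x * of_real (e k x) \<partial>N)"
  shows "\<not> finite_dim_modulo N (L2 N) (op_range T)"
proof
  assume "finite_dim_modulo N (L2 N) (op_range T)"
  then obtain B where B: "finite B" "B \<subseteq> L2 N"
    and sol: "\<And>f. f \<in> L2 N \<Longrightarrow> \<exists>u\<in>op_range T. \<exists>a. AE x in N. f x = u x + (\<Sum>b\<in>B. a b * b x)"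
    unfolding finite_dim_modulo_def by blast
  define d where "d k = sqrt (\<integral>x. (e k x)\<^sup>2 \<partial>N) + (\<Sum>b\<in>B. cmod (\<integral>x. b x * of_real (p k x) \<partial>N))" for k
  have "(\<lambda>k. sqrt (\<integral>x. (e k x)\<^sup>2 \<partial>N)) \<longlonglongrightarrow> 0" using tendsto_real_sqrt[OF e(3)] by simp
  moreover have "(\<lambda>k. \<Sum>b\<in>B. cmod (\<integral>x. b x * of_real (p k x) \<partial>N)) \<longlonglongrightarrow> 0"
    using B disjoint_pairing_tendsto_0[OF p disj] by (intro tendsto_null_sum) auto
  ultimately have d0: "d \<longlonglongrightarrow> 0" unfolding d_def using tendsto_add by fastforce
  \<comment> \<open>The rate (1/4)^k is chosen below the coefficients (1/2)^k of \<open>g\<close>.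
    The pairing of \<open>g\<close> with \<open>p (r k)\<close> is exactly (1/2)^k, so solvability
    would force 2^k <= C for every \<open>k\<close>.\<close>
  have "\<exists>r. \<forall>k. d (r k) \<le> (1/4)^k \<and> r k < r (Suc k)"
  proof (rule dependent_nat_choice)
    have ex: "\<exists>y>x. d y \<le> (1/4)^n" for x n :: nat
    proof -
      obtain M where M: "\<And>m. m \<ge> M \<Longrightarrow> norm (d m) < (1/4)^n"
        using LIMSEQ_D[OF d0, of "(1/4)^n"] by auto
      have "d (Suc (max x M)) < (1/4)^n" using M[of "Suc (max x M)"] by (simp add: abs_less_iff)
      then show ?thesis by (intro exI[of _ "Suc (max x M)"]) auto
    qed
    show "\<exists>x. d x \<le> (1/4)^0" using ex[of 0 0] by blast
    show "\<exists>y. d y \<le> (1/4)^Suc n \<and> x < y" for x n using ex[where n="Suc n"] by blast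
  qed
  then obtain r where r: "\<And>k. d (r k) \<le> (1/4)^k" and "\<And>k. r k < r (Suc k)" by blast
  then have sm: "inj r" using strict_mono_Suc_iff strict_mono_imp_inj_on by blast
  define g where "g x = (\<Sum>k. (1/2)^k * p (r k) x)" for x
  \<comment> \<open>At each point at most one term survives, so the series for \<open>g\<close> and
    for its square are finite sums there.\<close>
  have one: "\<exists>k. \<forall>l. l \<noteq> k \<longrightarrow> p (r l) x = 0" if "x \<in> space N" for x
  proof (cases "\<exists>k. p (r k) x \<noteq> 0")
    case True
    then obtain k where k: "p (r k) x \<noteq> 0" ..
    have "p (r l) x = 0" if "l \<noteq> k" for l
      using disj[OF \<open>x \<in> space N\<close>, of "r k" "r l"] k injD[OF sm, of k l] that by auto
    then show ?thesis by blast
  qed auto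
  have gk: "g x = (1/2)^k * p (r k) x" if "\<forall>l. l \<noteq> k \<longrightarrow> p (r l) x = 0" for x k
    unfolding g_def using that by (subst suminf_finite[of "{k}"]) auto
  have g_meas [measurable]: "g \<in> borel_measurable N"
    unfolding g_def using p(1) by measurable
  have gp: "g x * p (r k) x = (1/2)^k * (p (r k) x)\<^sup>2" if "x \<in> space N" for x k
  proof -
    obtain l where "\<forall>j. j \<noteq> l \<longrightarrow> p (r j) x = 0" using one[OF \<open>x \<in> space N\<close>] by blast
    then show ?thesis using gk[of l x] by (cases "k = l") (auto simp: power2_eq_square)
  qed
  have g2s: "(g x)\<^sup>2 = (\<Sum>k. (1/4)^k * (p (r k) x)\<^sup>2)" "summable (\<lambda>k. (1/4)^k * (p (r k) x)\<^sup>2)" if "x \<in> space N" for x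
  proof -
    obtain l where l: "\<forall>j. j \<noteq> l \<longrightarrow> p (r j) x = 0" using one[OF \<open>x \<in> space N\<close>] by blast
    have "(\<Sum>k. (1/4)^k * (p (r k) x)\<^sup>2) = (1/4)^l * (p (r l) x)\<^sup>2"
      using l by (subst suminf_finite[of "{l}"]) auto
    moreover have "((1/2)^l)\<^sup>2 = (1/4::real)^l"
      by (simp add: power2_eq_square power_mult_distrib[symmetric])
    ultimately show "(g x)\<^sup>2 = (\<Sum>k. (1/4)^k * (p (r k) x)\<^sup>2)"
      using gk[OF l] by (simp add: power_mult_distrib)
    show "summable (\<lambda>k. (1/4)^k * (p (r k) x)\<^sup>2)"
      using l by (intro summable_finite[of "{l}"]) auto
  qed
  have "integrable N (\<lambda>x. \<Sum>k. (1/4)^k * (p (r k) x)\<^sup>2)"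
  proof (rule integrable_suminf)
    show "integrable N (\<lambda>x. (1/4)^k * (p (r k) x)\<^sup>2)" for k using p(2) by simp
    show "AE x in N. summable (\<lambda>k. norm ((1/4)^k * (p (r k) x)\<^sup>2))"
      using g2s(2) by (intro AE_I2) (simp add: abs_mult)
    show "summable (\<lambda>k. \<integral>x. norm ((1/4)^k * (p (r k) x)\<^sup>2) \<partial>N)"
      using p(3) by (simp add: abs_mult summable_geometric)
  qed
  then have "integrable N (\<lambda>x. (g x)\<^sup>2)"
    using g2s(1) by (subst Bochner_Integration.integrable_cong[OF refl]) auto
  then have gL: "(\<lambda>x. complex_of_real (g x)) \<in> L2 N"
    by (auto simp: L2_def)
  obtain u a where u: "u \<in> op_range T" and ua: "AE x in N. complex_of_real (g x) = u x + (\<Sum>b\<in>B. a b * b x)"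
    using sol[OF gL] by blast
  obtain f where f: "(f, u) \<in> T" using u by (auto simp: op_range_def)
  have fL: "f \<in> L2 N" and uL: "u \<in> L2 N" using T[OF f] by auto
  define C where "C = L2_norm N f + (\<Sum>b\<in>B. cmod (a b))"
  have half_nonneg: "0 \<le> (1/2::real)" by simp
  have C: "(1/2)^k \<le> C * (1/4)^k" for k
  proof -
    let ?P = "\<lambda>x. complex_of_real (p (r k) x)"
    note pp = p(1)[of "r k"] p(2)[of "r k"]
    have "complex_of_real ((1/2)^k) = of_real (\<integral>x. g x * p (r k) x \<partial>N)"
      using gp p(3) by (subst Bochner_Integration.integral_cong[OF refl, where g="\<lambda>x. (1/2)^k * (p (r k) x)\<^sup>2"]) auto
    also have "\<dots> = (\<integral>x. complex_of_real (g x) * ?P x \<partial>N)"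
      by (simp only: of_real_mult[symmetric] integral_complex_of_real)
    also have "\<dots> = (\<integral>x. u x * ?P x + (\<Sum>b\<in>B. a b * (b x * ?P x)) \<partial>N)"
    proof (rule integral_cong_AE)
      have bm: "b \<in> borel_measurable N" if "b \<in> B" for b using B that by (auto simp: L2_def)
      have [measurable]: "u \<in> borel_measurable N" using uL by (auto simp: L2_def)
      have pm [measurable]: "?P \<in> borel_measurable N" using p(1) by measurable
      have [measurable]: "(\<lambda>x. \<Sum>b\<in>B. a b * (b x * ?P x)) \<in> borel_measurable N"
        by (intro borel_measurable_sum borel_measurable_times borel_measurable_const bm pm)
      show "(\<lambda>x. complex_of_real (g x) * ?P x) \<in> borel_measurable N" by measurable
      show "(\<lambda>x. u x * ?P x + (\<Sum>b\<in>B. a b * (b x * ?P x))) \<in> borel_measurable N" by measurable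
      show "AE x in N. complex_of_real (g x) * ?P x = u x * ?P x + (\<Sum>b\<in>B. a b * (b x * ?P x))"
        using ua by eventually_elim (simp add: algebra_simps sum_distrib_left)
    qed
    also have "\<dots> = (\<integral>x. u x * ?P x \<partial>N) + (\<Sum>b\<in>B. a b * (\<integral>x. b x * ?P x \<partial>N))"
    proof -
      have ib: "integrable N (\<lambda>x. b x * ?P x)" if "b \<in> B" for b using L2_pairing(1)[OF _ pp] B that by auto
      have "(\<integral>x. u x * ?P x + (\<Sum>b\<in>B. a b * (b x * ?P x)) \<partial>N) = (\<integral>x. u x * ?P x \<partial>N) + (\<integral>x. (\<Sum>b\<in>B. a b * (b x * ?P x)) \<partial>N)"
        using L2_pairing(1)[OF uL pp] ib by (intro Bochner_Integration.integral_add) auto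
      also have "(\<integral>x. (\<Sum>b\<in>B. a b * (b x * ?P x)) \<partial>N) = (\<Sum>b\<in>B. a b * (\<integral>x. b x * ?P x \<partial>N))"
        using ib by (subst Bochner_Integration.integral_sum) auto
      finally show ?thesis .
    qed
    also have "(\<integral>x. u x * ?P x \<partial>N) = (\<integral>x. f x * of_real (e (r k) x) \<partial>N)" using T[OF f] by blast
    finally have "(1/2)^k = cmod ((\<integral>x. f x * of_real (e (r k) x) \<partial>N) + (\<Sum>b\<in>B. a b * (\<integral>x. b x * ?P x \<partial>N)))"
      by (metis norm_of_real abs_of_nonneg zero_le_power half_nonneg)
    also have "\<dots> \<le> L2_norm N f * sqrt (\<integral>x. (e (r k) x)\<^sup>2 \<partial>N) + (\<Sum>b\<in>B. cmod (a b) * cmod (\<integral>x. b x * ?P x \<partial>N))"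
      by (intro norm_triangle_le add_mono L2_pairing(2)[OF fL e(1,2)] sum_norm_le) (simp add: norm_mult)
    also have "\<dots> \<le> L2_norm N f * d (r k) + (\<Sum>b\<in>B. cmod (a b) * d (r k))"
    proof (intro add_mono mult_left_mono sum_mono)
      show "0 \<le> L2_norm N f" by (simp add: L2_norm_def integral_nonneg_AE)
      have "0 \<le> sqrt (\<integral>x. (e (r k) x)\<^sup>2 \<partial>N)" by (simp add: integral_nonneg_AE)
      moreover have "0 \<le> (\<Sum>b\<in>B. cmod (\<integral>x. b x * ?P x \<partial>N))" by (simp add: sum_nonneg)
      moreover have "cmod (\<integral>x. b x * ?P x \<partial>N) \<le> (\<Sum>b\<in>B. cmod (\<integral>x. b x * ?P x \<partial>N))" if "b \<in> B" for b
        using B that by (intro member_le_sum) auto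
      ultimately show "sqrt (\<integral>x. (e (r k) x)\<^sup>2 \<partial>N) \<le> d (r k)"
        "\<And>b. b \<in> B \<Longrightarrow> cmod (\<integral>x. b x * ?P x \<partial>N) \<le> d (r k)" 
        unfolding d_def by (linarith, fastforce intro: add_increasing)
    qed auto
    also have "\<dots> = C * d (r k)" by (simp add: C_def sum_distrib_right distrib_right)
    also have "\<dots> \<le> C * (1/4)^k"
      using r by (intro mult_left_mono) (auto simp: C_def L2_norm_def integral_nonneg_AE intro!: add_nonneg_nonneg sum_nonneg)
    finally show ?thesis .
  qed
  obtain k where k: "C < 2^k" using real_arch_pow[of 2 C] by auto
  have "(1/4::real)^k = (1/2)^k * (1/2)^k" by (simp add: power_mult_distrib[symmetric])
  then have "1 \<le> C * (1/2)^k" using C[of k] by (simp add: field_simps)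
  then show False using k by (simp add: field_simps)
qed

section \<open>Integration by parts on the parameter box\<close>

declare Ck.simps [simp del]

lemma has_derivative_vec3:
  fixes f :: "'a::real_normed_vector \<Rightarrow> 'b::euclidean_space^3"
  assumes "((\<lambda>x. f x $ 1) has_derivative (\<lambda>h. f' h $ 1)) (at x)"
    "((\<lambda>x. f x $ 2) has_derivative (\<lambda>h. f' h $ 2)) (at x)"
    "((\<lambda>x. f x $ 3) has_derivative (\<lambda>h. f' h $ 3)) (at x)"
  shows "(f has_derivative f') (at x)"
proof (subst has_derivative_componentwise_within, intro ballI)
  have a: "((\<lambda>x. f x $ i) has_derivative (\<lambda>h. f' h $ i)) (at x)" for i
    using exhaust_3[of i] assms by auto
  fix b :: "'b^3" assume "b \<in> Basis"
  then obtain i u where b: "b = axis i u" by (auto simp: Basis_vec_def)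
  show "((\<lambda>x. f x \<bullet> b) has_derivative (\<lambda>x. f' x \<bullet> b)) (at x)"
    unfolding b inner_axis by (rule has_derivative_inner_left[OF a])
qed

lemma Ck1I:
  assumes "\<And>x. (f has_derivative f' x) (at x)" "\<And>v. continuous_on UNIV (\<lambda>x. f' x v)"
  shows "Ck (Suc 0) f"
proof -
  have "frechet_derivative f (at x) = f' x" for x
    using frechet_derivative_at[OF assms(1)] by simp
  then show ?thesis using assms by (auto simp: differentiable_def Ck.simps)
qed

lemma Ck1D:
  assumes "Ck (Suc 0) f"
  shows "(f has_derivative frechet_derivative f (at x)) (at x)"
    and "continuous_on UNIV (\<lambda>x. frechet_derivative f (at x) v)"
  using assms by (auto simp: frechet_derivative_works Ck.simps)

lemma Ck1_differentiable: "Ck (Suc 0) f \<Longrightarrow> f differentiable (at x)" by (simp add: Ck.simps)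

lemma Ck1_continuous: "Ck (Suc 0) f \<Longrightarrow> continuous_on UNIV f"
  by (auto intro!: differentiable_imp_continuous_on simp: differentiable_on_def Ck1_differentiable)

lemma Ck1_bounded_linear:
  assumes "bounded_linear h" "Ck (Suc 0) f"
  shows "Ck (Suc 0) (\<lambda>x. h (f x))"
  by (rule Ck1I[OF bounded_linear.has_derivative[OF assms(1) Ck1D(1)[OF assms(2)]]])
    (rule bounded_linear.continuous_on[OF assms(1) Ck1D(2)[OF assms(2)]])

lemma Ck1_const: "Ck (Suc 0) (\<lambda>x. a)"
  by (rule Ck1I[OF has_derivative_const]) simp

lemma Ck1_ident: "Ck (Suc 0) (\<lambda>x. x)"
  by (rule Ck1I[OF has_derivative_ident]) simp

lemma Ck1_vec_nth: "Ck (Suc 0) (\<lambda>x::'a::real_normed_vector^'n. x $ i)"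
  by (rule Ck1_bounded_linear[OF bounded_linear_vec_nth Ck1_ident])

lemma Ck1_add:
  assumes "Ck (Suc 0) f" "Ck (Suc 0) g"
  shows "Ck (Suc 0) (\<lambda>x. f x + g x)"
  by (rule Ck1I[OF has_derivative_add[OF assms[THEN Ck1D(1)]]])
    (intro continuous_on_add assms[THEN Ck1D(2)])

lemma Ck1_mult:
  fixes f g :: "'a::real_normed_vector \<Rightarrow> 'b::real_normed_algebra"
  assumes "Ck (Suc 0) f" "Ck (Suc 0) g"
  shows "Ck (Suc 0) (\<lambda>x. f x * g x)"
  by (rule Ck1I[OF has_derivative_mult[OF assms[THEN Ck1D(1)]]])
    (intro continuous_on_add continuous_on_mult assms[THEN Ck1D(2)] assms[THEN Ck1_continuous])

lemma Ck1_inner: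
  fixes f g :: "'a::real_normed_vector \<Rightarrow> 'b::real_inner"
  assumes "Ck (Suc 0) f" "Ck (Suc 0) g"
  shows "Ck (Suc 0) (\<lambda>x. f x \<bullet> g x)"
  by (rule Ck1I[OF has_derivative_inner[OF assms[THEN Ck1D(1)]]])
    (intro continuous_on_add continuous_on_inner assms[THEN Ck1D(2)] assms[THEN Ck1_continuous])

lemma Ck1_power2: "Ck (Suc 0) f \<Longrightarrow> Ck (Suc 0) (\<lambda>x. (f x :: real)^2)"
  unfolding power2_eq_square by (intro Ck1_mult)

lemma Ck1_of_real: "Ck (Suc 0) f \<Longrightarrow> Ck (Suc 0) (\<lambda>x. complex_of_real (f x))"
  by (rule Ck1_bounded_linear[OF bounded_linear_of_real])

lemma Ck1_compose_real:
  fixes g :: "'a::real_normed_vector \<Rightarrow> real"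
  assumes "Ck (Suc 0) g" "\<And>x. (k has_real_derivative k' (g x)) (at (g x))" "continuous_on UNIV (\<lambda>x. k' (g x))"
  shows "Ck (Suc 0) (\<lambda>x. k (g x))"
  by (rule Ck1I[OF has_derivative_compose[OF Ck1D(1)[OF assms(1)] assms(2)[unfolded has_field_derivative_def]]])
    (intro continuous_on_mult Ck1D(2)[OF assms(1)] assms(3))

text \<open>With a real argument the outer derivative is a multiple of its value at 1. The varying
  direction thus becomes a scalar factor, and continuity in fixed directions is enough.\<close>

lemma Ck1_compose_curve:
  fixes k :: "real \<Rightarrow> 'b::real_normed_vector"
  assumes "Ck (Suc 0) k" "Ck (Suc 0) g"
  shows "Ck (Suc 0) (\<lambda>x. k (g x))"
proof (rule Ck1I[where f'="\<lambda>x v. frechet_derivative g (at x) v *\<^sub>R frechet_derivative k (at (g x)) 1"])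
  have e: "frechet_derivative k (at s) v = v *\<^sub>R frechet_derivative k (at s) 1" for s v
    using linear_cmul[OF has_derivative_linear[OF Ck1D(1)[OF assms(1)]], of s v 1] by simp
  show "((\<lambda>x. k (g x)) has_derivative (\<lambda>v. frechet_derivative g (at x) v *\<^sub>R frechet_derivative k (at (g x)) 1)) (at x)" for x
    by (subst e[symmetric]) (rule has_derivative_compose[OF Ck1D(1)[OF assms(2)] Ck1D(1)[OF assms(1)]])
  show "continuous_on UNIV (\<lambda>x. frechet_derivative g (at x) v *\<^sub>R frechet_derivative k (at (g x)) 1)" for v
    by (intro continuous_on_scaleR Ck1D(2)[OF assms(2)] continuous_on_compose2[OF Ck1D(2)[OF assms(1)] Ck1_continuous[OF assms(2)]]) auto
qed

lemma Ck1_inverse: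
  fixes g :: "'a::real_normed_vector \<Rightarrow> real"
  assumes "Ck (Suc 0) g" "\<And>x. g x \<noteq> 0"
  shows "Ck (Suc 0) (\<lambda>x. inverse (g x))"
  by (rule Ck1_compose_real[OF assms(1), where k'="\<lambda>x. - (inverse x)\<^sup>2"])
    (use assms Ck1_continuous[OF assms(1)] in \<open>auto intro!: derivative_eq_intros continuous_intros simp: power2_eq_square\<close>)

lemma Ck1_sqrt:
  fixes g :: "'a::real_normed_vector \<Rightarrow> real"
  assumes "Ck (Suc 0) g" "\<And>x. g x > 0"
  shows "Ck (Suc 0) (\<lambda>x. sqrt (g x))"
proof (rule Ck1_compose_real[OF assms(1), where k'="\<lambda>x. inverse (sqrt x) / 2"])
  have "sqrt (g x) \<noteq> 0" for x using assms(2)[of x] by simp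
  then show "continuous_on UNIV (\<lambda>x. inverse (sqrt (g x)) / 2)"
    using Ck1_continuous[OF assms(1)] by (auto intro!: continuous_intros)
qed (use assms(2) in \<open>rule DERIV_real_sqrt\<close>)

lemma Ck1_diff:
  assumes "Ck (Suc 0) f" "Ck (Suc 0) g"
  shows "Ck (Suc 0) (\<lambda>x. f x - g x)"
  by (rule Ck1I[OF has_derivative_diff[OF assms[THEN Ck1D(1)]]])
    (intro continuous_on_diff assms[THEN Ck1D(2)])

lemma Ck1_first: "Ck (Suc 0) k \<Longrightarrow> Ck (Suc 0) (\<lambda>x::real^3. k (x$1))"
  by (rule Ck1_compose_curve[OF _ Ck1_vec_nth])

lemma smooth_differentiable: "smooth f \<Longrightarrow> f differentiable (at x)"
  unfolding smooth_def using Ck.simps(2)[of 0 f] by blast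

lemma smooth_Ck1: "smooth f \<Longrightarrow> Ck (Suc 0) f"
  unfolding smooth_def by blast

lemma smooth_Ck1_derivative: "smooth f \<Longrightarrow> Ck (Suc 0) (\<lambda>x. frechet_derivative f (at x) v)"
  unfolding smooth_def using Ck.simps(2)[of "Suc 0" f] by blast

section \<open>Rules for coordinate derivatives\<close>

lemma Ck1_pd: "smooth f \<Longrightarrow> Ck (Suc 0) (pd i f)"
  unfolding pd_def by (rule smooth_Ck1_derivative)

lemma pd_eqI: "(f has_derivative f') (at x) \<Longrightarrow> pd i f x = f' (axis i 1)"
  unfolding pd_def by (simp add: frechet_derivative_at[symmetric])

lemma pd_mult:
  fixes f g :: "real^'n \<Rightarrow> complex"
  assumes "f differentiable (at x)" "g differentiable (at x)"
  shows "pd i (\<lambda>x. f x * g x) x = f x * pd i g x + pd i f x * g x"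
  unfolding pd_def using assms[unfolded frechet_derivative_works]
  by (subst frechet_derivative_at[OF has_derivative_mult, symmetric]) auto

lemma pd_diff:
  assumes "f differentiable (at x)" "g differentiable (at x)"
  shows "pd i (\<lambda>x. f x - g x) x = pd i f x - pd i g x"
  unfolding pd_def using assms[unfolded frechet_derivative_works]
  by (subst frechet_derivative_at[OF has_derivative_diff, symmetric]) auto

lemma pd_mult_real:
  fixes f g :: "real^'n \<Rightarrow> real"
  assumes "f differentiable (at x)" "g differentiable (at x)"
  shows "pd i (\<lambda>x. f x * g x) x = f x * pd i g x + pd i f x * g x"
  unfolding pd_def using assms[unfolded frechet_derivative_works]
  by (subst frechet_derivative_at[OF has_derivative_mult, symmetric]) auto

lemma pd_of_real:
  assumes "g differentiable (at x)"
  shows "pd i (\<lambda>x. complex_of_real (g x)) x = of_real (pd i g x)"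
  using assms unfolding pd_def frechet_derivative_works
  by (subst frechet_derivative_at[OF has_derivative_of_real, symmetric]) auto

lemma pd_compose_real:
  fixes g :: "real^'n \<Rightarrow> real"
  assumes "g differentiable (at x)" "(k has_real_derivative k') (at (g x))"
  shows "pd i (\<lambda>x. k (g x)) x = k' * pd i g x"
  unfolding pd_def
  using frechet_derivative_at[OF has_derivative_compose[OF assms(1)[unfolded frechet_derivative_works]
    assms(2)[unfolded has_field_derivative_def]]] by metis

lemma pd_shift: "pd i (\<lambda>x. f (x + a)) x = pd i f (x + a)" if "f differentiable (at (x + a))"
proof -
  have "((\<lambda>x. f (x + a)) has_derivative frechet_derivative f (at (x + a))) (at x)"
  proof -
    have "((\<lambda>x. x + a) has_derivative (\<lambda>x. x)) (at x)" by (auto intro!: derivative_eq_intros)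
    from has_derivative_compose[OF this that[unfolded frechet_derivative_works]] show ?thesis .
  qed
  then show ?thesis unfolding pd_def by (simp add: frechet_derivative_at[symmetric])
qed

text \<open>Serves to differentiate formulas for the metric that are known only away from the zero
  section.\<close>

lemma pd_cong_open:
  assumes "open U" "x \<in> U" "\<And>y. y \<in> U \<Longrightarrow> f y = g y" "g differentiable (at x)"
  shows "pd i f x = pd i g x"
proof -
  have "(g has_derivative frechet_derivative g (at x)) (at x)" using assms(4) by (simp add: frechet_derivative_works)
  then have "(f has_derivative frechet_derivative g (at x)) (at x)"
    by (rule has_derivative_transform_within_open[OF _ assms(1,2)]) (simp add: assms(3))
  then show ?thesis unfolding pd_def by (simp add: frechet_derivative_at[symmetric])
qed

lemma has_derivative_vec_nth_id [derivative_intros]: "((\<lambda>x::'a::real_normed_vector^'n. x $ i) has_derivative (\<lambda>x. x $ i)) (at a within s)"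
  by (rule bounded_linear_imp_has_derivative[OF bounded_linear_vec_nth])

lemma pd_nth: "pd i (\<lambda>x::real^'n. x $ j) x = (if i = j then 1 else 0)"
  by (subst pd_eqI[OF has_derivative_vec_nth_id]) (simp add: axis_def)

lemma continuous_pd: "Ck (Suc 0) f \<Longrightarrow> continuous_on UNIV (pd i f)"
  unfolding pd_def by (rule Ck1D(2))

section \<open>Translations and dilations of Lebesgue integrals over the strip\<close>

lemma lborel_integral_translation:
  fixes f :: "'a::euclidean_space \<Rightarrow> 'b::{banach, second_countable_topology}"
  assumes "f \<in> borel_measurable borel"
  shows "(\<integral>x. f (a + x) \<partial>lborel) = (\<integral>x. f x \<partial>lborel)"
  using integral_distr[of "(+) a" lborel borel f] assms by (simp add: lborel_distr_plus)

text \<open>Only the two fibre coordinates are dilated, which gives the Jacobian \<open>n^2\<close>.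
  This brings the shells at radius \<open>n\<close> back to one fixed shell.\<close>

lemma lborel_scale3:
  fixes f :: "real^3 \<Rightarrow> real"
  assumes f: "f \<in> borel_measurable borel" and n: "n > 0"
  shows "(\<integral>x. f x \<partial>lborel) = n^2 * (\<integral>x. f (vector [(x::real^3)$1, n * x$2, n * x$3]) \<partial>lborel)"
proof -
  define c where "c j = (if j = axis 1 1 then 1 else n)" for j :: "real^3"
  define T where "T x = 0 + (\<Sum>j\<in>Basis. (c j * (x \<bullet> j)) *\<^sub>R j)" for x :: "real^3"
  have B: "(Basis :: (real^3) set) = (\<lambda>i. axis i 1) ` UNIV" by (auto simp: Basis_vec_def)
  have inj: "inj (\<lambda>i::3. axis i (1::real))" by (auto simp: inj_on_def axis_eq_axis)
  have T: "T x = vector [x$1, n * x$2, n * x$3]" for x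
    unfolding T_def B sum.reindex[OF inj] 
    by (simp add: sum_3 c_def vec_eq_iff forall_3 inner_axis axis_eq_axis) (simp add: axis_def)
  have Tm [measurable]: "T \<in> borel \<rightarrow>\<^sub>M borel" unfolding T_def by simp
  have p: "(\<Prod>j\<in>Basis. \<bar>c j\<bar>) = n^2"
  proof -
    have "(\<Prod>i\<in>UNIV. h i) = h 1 * (h 2 * h 3)" for h :: "3 \<Rightarrow> real" unfolding UNIV_3 by simp
    then show ?thesis
      unfolding B prod.reindex[OF inj] using n by (simp add: c_def axis_eq_axis power2_eq_square)
  qed
  have "lborel = density (distr lborel borel T) (\<lambda>_. ennreal (\<Prod>j\<in>Basis. \<bar>c j\<bar>))"
    unfolding T_def[abs_def] by (rule lborel_affine_euclidean) (use n in \<open>auto simp: c_def\<close>)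
  then have "(\<integral>x. f x \<partial>lborel) = (\<integral>x. f x \<partial>density (distr lborel borel T) (\<lambda>_. ennreal (n^2)))"
    unfolding p by simp
  also have "\<dots> = (\<integral>x. n^2 *\<^sub>R f x \<partial>distr lborel borel T)"
    by (rule integral_density) (use f in auto)
  also have "\<dots> = (\<integral>x. n^2 *\<^sub>R f (T x) \<partial>lborel)"
    by (rule integral_distr) (use f in auto)
  finally show ?thesis by (simp add: T)
qed

lemma vec3_cbox:
  "x \<in> cbox (vector [a, b, d]) (vector [a', b', d'] :: real^3) \<longleftrightarrow>
    a \<le> x$1 \<and> x$1 \<le> a' \<and> b \<le> x$2 \<and> x$2 \<le> b' \<and> d \<le> x$3 \<and> x$3 \<le> d'"
  by (auto simp: mem_box_cart forall_3)

text \<open>The indicator confines the curve parameter and the support condition the fibre, so a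
  compact box dominates. The strip is half-open to let its translates fit together without
  overlap.\<close>

lemma integrable_strip:
  fixes H :: "real^3 \<Rightarrow> 'b::euclidean_space"
  assumes "continuous_on UNIV H" "\<And>x. \<bar>x$2\<bar> > M \<or> \<bar>x$3\<bar> > M \<Longrightarrow> H x = 0"
  shows "integrable lborel (\<lambda>x. indicator {x::real^3. a \<le> x$1 \<and> x$1 < b} x *\<^sub>R H x)"
proof -
  let ?K = "cbox (vector [a, -M, -M]) (vector [b, M, M]) :: (real^3) set"
  have [measurable]: "H \<in> borel_measurable borel"
    using assms(1) by (rule borel_measurable_continuous_onI)
  have [measurable]: "(\<lambda>x::real^3. x$1) \<in> borel_measurable borel"
    by (intro borel_measurable_continuous_onI continuous_intros)
  have "integrable lborel (\<lambda>x. indicator ?K x *\<^sub>R H x)"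
    by (rule borel_integrable_compact) (use assms(1) continuous_on_subset in auto)
  then show ?thesis
  proof (rule Bochner_Integration.integrable_bound)
    show "(\<lambda>x. indicator {x. a \<le> x $ 1 \<and> x $ 1 < b} x *\<^sub>R H x) \<in> borel_measurable lborel" by measurable
    have "norm (indicator {x. a \<le> x $ 1 \<and> x $ 1 < b} x *\<^sub>R H x) \<le> norm (indicator ?K x *\<^sub>R H x)" for x
    proof (cases "H x = 0")
      case False
      then have "\<bar>x$2\<bar> \<le> M" "\<bar>x$3\<bar> \<le> M" using assms(2)[of x] by (auto simp: not_le[symmetric])
      then show ?thesis by (auto simp: indicator_def vec3_cbox)
    qed simp
    then show "AE x in lborel. norm (indicator {x. a \<le> x $ 1 \<and> x $ 1 < b} x *\<^sub>R H x) \<le> norm (indicator ?K x *\<^sub>R H x)" by simp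
  qed
qed

text \<open>A shift along the fibre preserves the strip. A shift along the curve loses a piece at
  one end and gains one at the other, and periodicity makes their integrals equal.\<close>

lemma integral_box_translation:
  fixes F :: "real^3 \<Rightarrow> complex"
  assumes F: "continuous_on UNIV F" and supp: "\<And>x. \<bar>x$2\<bar> > M \<or> \<bar>x$3\<bar> > M \<Longrightarrow> F x = 0"
    and per: "\<And>x. F (x + axis 1 L) = F x" and L: "L > 0" and h: "h \<ge> 0"
  shows "(\<integral>x. indicator (param_box L) x *\<^sub>R F (axis i h + x) \<partial>lborel) = (\<integral>x. indicator (param_box L) x *\<^sub>R F x \<partial>lborel)"
proof -
  have [measurable]: "F \<in> borel_measurable borel" using F by (rule borel_measurable_continuous_onI)
  have [measurable]: "(\<lambda>x::real^3. x$1) \<in> borel_measurable borel"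
    by (intro borel_measurable_continuous_onI continuous_intros)
  define I where "I a b = (\<lambda>x::real^3. indicator {x::real^3. a \<le> x$1 \<and> x$1 < b} x *\<^sub>R F x)" for a b
  have Im [measurable]: "I a b \<in> borel_measurable borel" for a b unfolding I_def by measurable
  have Ii: "integrable lborel (I a b)" for a b unfolding I_def by (rule integrable_strip[OF F supp])
  have box: "param_box L = {x. 0 \<le> x$1 \<and> x$1 < L}" by (simp add: param_box_def)
  show ?thesis
  proof (cases "i = 1")
    case False
    then have "(\<lambda>x. indicator (param_box L) x *\<^sub>R F (axis i h + x)) = (\<lambda>x. I 0 L (axis i h + x))"
      by (auto simp: I_def box indicator_def axis_def fun_eq_iff)
    then show ?thesis using lborel_integral_translation[OF Im[of 0 L], of "axis i h"] by (simp add: I_def box)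
  next
    case True
    then have "(\<lambda>x. indicator (param_box L) x *\<^sub>R F (axis i h + x)) = (\<lambda>x. I h (L + h) (axis 1 h + x))"
      by (auto simp: I_def box indicator_def axis_def fun_eq_iff)
    then have "(\<integral>x. indicator (param_box L) x *\<^sub>R F (axis i h + x) \<partial>lborel) = (\<integral>x. I h (L + h) x \<partial>lborel)"
      using lborel_integral_translation[OF Im[of h "L+h"], of "axis 1 h"] by simp
    also have "I h (L + h) = (\<lambda>x. I 0 L x - I 0 h x + I L (L + h) x)"
      using L h by (auto simp: I_def indicator_def fun_eq_iff)
    also have "(\<integral>x. I 0 L x - I 0 h x + I L (L + h) x \<partial>lborel) = (\<integral>x. I 0 L x \<partial>lborel) - (\<integral>x. I 0 h x \<partial>lborel) + (\<integral>x. I L (L + h) x \<partial>lborel)"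
      using Ii by simp
    also have "(\<integral>x. I L (L + h) x \<partial>lborel) = (\<integral>x. I L (L + h) (axis 1 L + x) \<partial>lborel)"
      by (rule lborel_integral_translation[OF Im, symmetric])
    also have "(\<lambda>x. I L (L + h) (axis 1 L + x)) = I 0 h"
      using per by (auto simp: I_def indicator_def fun_eq_iff axis_def add.commute)
    finally show ?thesis by (simp add: I_def box)
  qed
qed

text \<open>By translation invariance and periodicity the difference quotients of \<open>F\<close> integrate to zero.\<close>

lemma integral_box_pd:
  fixes F :: "real^3 \<Rightarrow> complex"
  assumes F: "Ck (Suc 0) F" and supp: "\<And>x. \<bar>x$2\<bar> > M \<or> \<bar>x$3\<bar> > M \<Longrightarrow> F x = 0"
    and per: "\<And>x. F (x + axis 1 L) = F x" and L: "L > 0"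
  shows "integrable lborel (\<lambda>x. indicator (param_box L) x *\<^sub>R pd i F x)"
    and "(\<integral>x. indicator (param_box L) x *\<^sub>R pd i F x \<partial>lborel) = 0"
proof -
  define G where "G = pd i F"
  have Fc: "continuous_on UNIV F" by (rule Ck1_continuous[OF F])
  have Gc: "continuous_on UNIV G" unfolding G_def by (rule continuous_pd[OF F])
  have [measurable]: "F \<in> borel_measurable borel" "G \<in> borel_measurable borel"
    using Fc Gc by (auto intro: borel_measurable_continuous_onI)
  have [measurable]: "(\<lambda>x::real^3. x$1) \<in> borel_measurable borel"
    by (intro borel_measurable_continuous_onI continuous_intros)
  have box [measurable]: "param_box L \<in> sets borel" unfolding param_box_def by measurable
  \<comment> \<open>Steps are at most 1. Hence the difference quotients vanish outside
    \<open>?K'\<close> within the strip, and for points of \<open>?K'\<close> the segments joining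
    them to their shifts stay in \<open>?K\<close>. The maximum of \<open>G\<close> on
    \<open>?K\<close> then gives an integrable bound on \<open>?K'\<close>.\<close>
  let ?K = "cbox (vector [0, - M - 2, - M - 2]) (vector [L + 1, M + 2, M + 2]) :: (real^3) set"
  let ?K' = "cbox (vector [0, - M - 1, - M - 1]) (vector [L, M + 1, M + 1]) :: (real^3) set"
  have "bounded (G ` ?K)"
    by (intro compact_imp_bounded compact_continuous_image continuous_on_subset[OF Gc]) auto
  then obtain C where C: "C > 0" "\<And>x. x \<in> ?K \<Longrightarrow> norm (G x) \<le> C"
    unfolding bounded_pos by auto
  define h where "h n = inverse (real (Suc n))" for n
  have h: "0 < h n" "h n \<le> 1" for n by (auto simp: h_def field_simps)
  have h0: "h \<longlonglongrightarrow> 0" unfolding h_def by (rule LIMSEQ_inverse_real_of_nat)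
  define q where "q n x = indicator (param_box L) x *\<^sub>R ((F (axis i (h n) + x) - F x) /\<^sub>R h n)" for n x
  have lined: "((\<lambda>s. F (axis i s + x)) has_vector_derivative G (axis i s + x)) (at s within A)" for x s A
  proof -
    have a: "axis i s = s *\<^sub>R (axis i 1 :: real^3)" for s by (simp add: axis_def vec_eq_iff)
    have "((\<lambda>s. axis i s + x) has_derivative (\<lambda>u. axis i u)) (at s within A)"
    proof -
      have "axis i = (\<lambda>s. s *\<^sub>R (axis i 1 :: real^3))" using a by blast
      then have "bounded_linear (axis i :: real \<Rightarrow> real^3)"
        using bounded_linear_scaleR_left by metis
      then show ?thesis using has_derivative_add_const bounded_linear_imp_has_derivative by blast
    qed
    from has_derivative_compose[OF this Ck1D(1)[OF F]]
    have "((\<lambda>s. F (axis i s + x)) has_derivative (\<lambda>u. frechet_derivative F (at (axis i s + x)) (axis i u))) (at s within A)" .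
    moreover have "frechet_derivative F (at y) (axis i u) = u *\<^sub>R G y" for y u
      unfolding G_def pd_def a[of u] by (rule linear_cmul[OF has_derivative_linear[OF Ck1D(1)[OF F]]])
    ultimately show ?thesis by (simp add: has_vector_derivative_def)
  qed
  have bound: "norm (q n x) \<le> C * indicator ?K' x" for n x
  proof (cases "x \<in> param_box L")
    case True
    show ?thesis
    proof (cases "\<bar>x$2\<bar> > M + 1 \<or> \<bar>x$3\<bar> > M + 1")
      case True
      have "\<bar>(axis i (h n) + x)$2\<bar> > M \<or> \<bar>(axis i (h n) + x)$3\<bar> > M" "\<bar>x$2\<bar> > M \<or> \<bar>x$3\<bar> > M"
        using True h[of n] by (auto simp: axis_def)
      then show ?thesis using supp C by (simp add: q_def)
    next
      case False
      have K: "axis i s + x \<in> ?K" if "s \<in> {0..h n}" for s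
        using False \<open>x \<in> param_box L\<close> that h[of n] unfolding vec3_cbox by (auto simp: axis_def param_box_def)
      have "norm (F (axis i (h n) + x) - F (axis i 0 + x)) \<le> C * norm (h n - 0)"
      proof (rule differentiable_bound[where S="{0..h n}"])
        show "((\<lambda>s. F (axis i s + x)) has_derivative (\<lambda>u. u *\<^sub>R G (axis i s + x))) (at s within {0..h n})" for s
          using lined by (simp add: has_vector_derivative_def)
        show "onorm (\<lambda>u. u *\<^sub>R G (axis i s + x)) \<le> C" if "s \<in> {0..h n}" for s
          using C(2)[OF K[OF that]] by (intro onorm_le) (simp add: mult.commute[of C] mult_left_mono)
      qed (use h[of n] in auto)
      moreover have "x \<in> ?K'" using False True unfolding vec3_cbox by (auto simp: param_box_def)
      moreover have "axis i (0::real) + x = x" by (simp add: axis_def vec_eq_iff)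
      ultimately show ?thesis
        using h[of n] True by (simp add: q_def pos_divide_le_eq divide_inverse[symmetric] inverse_eq_divide mult.commute)
    qed
  qed (use C in \<open>auto simp: q_def\<close>)
  have lim: "(\<lambda>n. q n x) \<longlonglongrightarrow> indicator (param_box L) x *\<^sub>R G x" for x
  proof -
    have "(\<lambda>e. norm (F (axis i (0 + e) + x) - F (axis i 0 + x) - e *\<^sub>R G (axis i 0 + x)) / norm e) \<midarrow>0\<rightarrow> 0"
      using lined[of x 0 UNIV] unfolding has_vector_derivative_def has_derivative_at by blast
    moreover have "filterlim h (at 0) sequentially"
      using h0 h by (intro filterlim_atI) (auto intro!: always_eventually simp: less_imp_neq[symmetric])
    ultimately have "(\<lambda>n. norm (F (axis i (0 + h n) + x) - F (axis i 0 + x) - h n *\<^sub>R G (axis i 0 + x)) / norm (h n)) \<longlonglongrightarrow> 0"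
      by (rule filterlim_compose)
    moreover have "axis i (0::real) + x = x" by (simp add: axis_def vec_eq_iff)
    moreover have "norm (F (axis i (h n) + x) - F x - h n *\<^sub>R G x) / norm (h n) = norm ((F (axis i (h n) + x) - F x) /\<^sub>R h n - G x)" for n
    proof -
      have "(F (axis i (h n) + x) - F x) /\<^sub>R h n - G x = (F (axis i (h n) + x) - F x - h n *\<^sub>R G x) /\<^sub>R h n"
        using h[of n] by (simp add: scaleR_diff_right)
      then show ?thesis by (simp add: divide_inverse mult.commute)
    qed
    ultimately have "(\<lambda>n. norm ((F (axis i (h n) + x) - F x) /\<^sub>R h n - G x)) \<longlonglongrightarrow> 0" by simp
    then have "(\<lambda>n. (F (axis i (h n) + x) - F x) /\<^sub>R h n) \<longlonglongrightarrow> G x"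
      by (rule LIM_zero_cancel[OF tendsto_norm_zero_cancel])
    then show ?thesis unfolding q_def by (intro tendsto_scaleR tendsto_const)
  qed
  have int: "(\<integral>x. q n x \<partial>lborel) = 0" for n
  proof -
    have box': "param_box L = {x. 0 \<le> x$1 \<and> x$1 < L}" by (simp add: param_box_def)
    have "integrable lborel (\<lambda>x. indicator (param_box L) x *\<^sub>R F x)"
       unfolding box' by (rule integrable_strip[OF Fc supp])
    moreover have "integrable lborel (\<lambda>x. indicator (param_box L) x *\<^sub>R F (axis i (h n) + x))"
      unfolding box'
    proof (rule integrable_strip[where M="M+1"])
      show "continuous_on UNIV (\<lambda>x. F (axis i (h n) + x))"
        by (intro continuous_on_compose2[OF Fc] continuous_intros) auto
      show "F (axis i (h n) + x) = 0" if "M + 1 < \<bar>x $ 2\<bar> \<or> M + 1 < \<bar>x $ 3\<bar>" for x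
        using that h[of n] by (intro supp) (auto simp: axis_def)
    qed
    moreover have "q n x = (indicator (param_box L) x *\<^sub>R F (axis i (h n) + x) - indicator (param_box L) x *\<^sub>R F x) /\<^sub>R h n" for x
      unfolding q_def by (simp add: indicator_def)
    ultimately show ?thesis
      by (simp add: integral_box_translation[OF Fc supp per L less_imp_le[OF h(1)]])
  qed
  have K'i: "integrable lborel (\<lambda>x. C * indicator ?K' x)"
    by (intro integrable_mult_right integrable_real_indicator) (auto simp: emeasure_lborel_cbox_eq)
  have [measurable]: "q n \<in> borel_measurable lborel" for n
    unfolding q_def by measurable
  note DC = K'i AE_I2[OF lim] AE_I2[OF bound]
  show "integrable lborel (\<lambda>x. indicator (param_box L) x *\<^sub>R pd i F x)"
    unfolding G_def[symmetric] by (rule integrable_dominated_convergence[OF _ _ DC]) measurable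
  have "(\<lambda>n. \<integral>x. q n x \<partial>lborel) \<longlonglongrightarrow> (\<integral>x. indicator (param_box L) x *\<^sub>R pd i F x \<partial>lborel)"
    unfolding G_def[symmetric] by (rule integral_dominated_convergence[OF _ _ DC]) measurable
  then show "(\<integral>x. indicator (param_box L) x *\<^sub>R pd i F x \<partial>lborel) = 0"
    unfolding int by (simp add: LIMSEQ_const_iff)
qed

section \<open>The potential and its complex Hessian\<close>

definition base_norm_sq :: "complex^3 \<Rightarrow> real" where "base_norm_sq v = v$1 \<bullet> v$1 + v$2 \<bullet> v$2"
definition u1_sq :: "complex^3 \<Rightarrow> real" where "u1_sq v = (v$3 \<bullet> v$3) * (base_norm_sq v)^2"

lemma base_norm_sq_pos: "v \<in> total_space \<Longrightarrow> 0 < base_norm_sq v"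
  by (auto simp: base_norm_sq_def total_space_def add_pos_nonneg add_nonneg_pos)
lemma u1_sq_pos: "v \<in> total_space \<Longrightarrow> v$3 \<noteq> 0 \<Longrightarrow> 0 < u1_sq v"
  using base_norm_sq_pos[of v] by (simp add: u1_sq_def)

lemma EH_u1_abs:
  assumes "v \<in> total_space"
  shows "EH_u1 (abs_EH v) = sqrt (u1_sq v)"
proof -
  have "EH_rel v v" using assms unfolding EH_rel_def by (auto intro!: exI[of _ 1])
  then have "EH_u1 (abs_EH v) = (cmod (v$1 * csqrt (v$3)))\<^sup>2 + (cmod (v$2 * csqrt (v$3)))\<^sup>2"
    by (simp add: EH_u1.abs_eq)
  also have "\<dots> = cmod (v$3) * base_norm_sq v"
    by (simp add: norm_mult power_mult_distrib norm_csqrt base_norm_sq_def dot_square_norm algebra_simps)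
  also have "\<dots> = sqrt (u1_sq v)"
    using base_norm_sq_pos[OF assms] by (simp add: u1_sq_def real_sqrt_mult norm_eq_sqrt_inner)
  finally show ?thesis .
qed

lemma DERIV_sqrt_add:
  assumes "q + a > (0::real)"
  shows "((\<lambda>q. sqrt (q + a)) has_real_derivative 1 / (2 * sqrt (q + a))) (at q)"
  using assms by (auto intro!: derivative_eq_intros simp: field_simps)

text \<open>The potential \<open>f\<^sub>t\<close> as a function of \<open>u\<^sub>1\<^sup>2\<close>, which is smooth on \<open>total_space\<close>, unlike \<open>u\<^sub>1\<close>.\<close>

definition potential_of_sq :: "real \<Rightarrow> real \<Rightarrow> real" where
  "potential_of_sq t q = sqrt (q + t^4) + t\<^sup>2 * ln (sqrt q / (sqrt (q + t^4) + t\<^sup>2))"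

lemma EH_potential_abs:
  assumes "v \<in> total_space"
  shows "EH_potential t (abs_EH v) = potential_of_sq t (u1_sq v)"
  using base_norm_sq_pos[OF assms] by (simp add: EH_potential_def potential_of_sq_def EH_u1_abs[OF assms] u1_sq_def)

lemma has_derivative_base_norm_sq [derivative_intros]:
  "(base_norm_sq has_derivative (\<lambda>X. 2 * (X$1 \<bullet> v$1 + X$2 \<bullet> v$2))) (at v)"
  unfolding base_norm_sq_def by (auto intro!: derivative_eq_intros simp: inner_commute)

lemma has_derivative_u1_sq:
  "(u1_sq has_derivative (\<lambda>X. 2 * (X$3 \<bullet> v$3) * (base_norm_sq v)^2
      + (v$3 \<bullet> v$3) * (4 * base_norm_sq v * (X$1 \<bullet> v$1 + X$2 \<bullet> v$2)))) (at v)"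
  unfolding u1_sq_def by (auto intro!: derivative_eq_intros simp: inner_commute algebra_simps)

text \<open>With S = sqrt (q + t^4) one has q = (S - t^2)(S + t^2), and the contributions of the
  logarithm combine with that of S into S / (2q). As d log u_1 = dq / (2q), this says that the
  derivative of f_t with respect to log u_1 is S.\<close>

lemma potential_of_sq_deriv:
  assumes "q > 0" "t > 0"
  shows "(potential_of_sq t has_real_derivative sqrt (q + t^4) / (2 * q)) (at q)"
proof -
  define S where "S = sqrt (q + t^4)"
  have p: "q + t^4 > 0" using assms by (simp add: add_pos_nonneg)
  have S: "S > 0" "S^2 = q + t^4" using p by (auto simp: S_def)
  define r where "r = sqrt q"
  have r: "r > 0" "r^2 = q" using assms by (auto simp: r_def)
  define m where "m = S + t\<^sup>2"
  have m: "m > 0" using S by (simp add: m_def add_pos_nonneg)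
  have d1: "((\<lambda>q. sqrt (q + t^4)) has_real_derivative 1 / (2 * S)) (at q)"
    using DERIV_sqrt_add[OF p] by (simp add: S_def)
  have d2: "(sqrt has_real_derivative 1 / (2 * r)) (at q)"
    using DERIV_sqrt_add[of q 0] assms by (simp add: r_def)
  have d3: "((\<lambda>q. sqrt (q + t^4) + t\<^sup>2) has_real_derivative 1 / (2 * S)) (at q)"
    using DERIV_add[OF d1 DERIV_const] by simp
  have "((\<lambda>q. ln (sqrt (q + t^4) + t\<^sup>2)) has_real_derivative 1 / (2 * S) / m) (at q)"
    by (rule DERIV_cong[OF DERIV_chain2[OF DERIV_ln_divide d3]]) (use m in \<open>auto simp: m_def S_def\<close>)
  moreover have "((\<lambda>q. ln (sqrt q)) has_real_derivative 1 / (2 * r) / r) (at q)"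
    by (rule DERIV_cong[OF DERIV_chain2[OF DERIV_ln_divide d2]]) (use r in \<open>auto simp: r_def\<close>)
  ultimately have D: "((\<lambda>q. sqrt (q + t^4) + t\<^sup>2 * (ln (sqrt q) - ln (sqrt (q + t^4) + t\<^sup>2)))
      has_real_derivative 1 / (2 * S) + t\<^sup>2 * (1 / (2 * r) / r - 1 / (2 * S) / m)) (at q)"
    by (intro DERIV_add d1 DERIV_cmult DERIV_diff)
  have E: "1 / (2 * S) + t\<^sup>2 * (1 / (2 * r) / r - 1 / (2 * S) / m) = S / (2 * q)"
  proof -
    have e: "q = (S - t\<^sup>2) * m" using S(2) by (simp add: m_def algebra_simps power2_eq_square power4_eq_xxxx)
    have "1 / (2 * r) / r = 1 / (2 * q)" using r by (simp add: power2_eq_square)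
    moreover have "1 / (2 * S) / m = (S - t\<^sup>2) / (2 * S * q)"
    proof -
      have "S - t\<^sup>2 \<noteq> 0" using e assms by auto
      then show ?thesis using S m by (simp add: e)
    qed
    moreover have "1 / (2 * S) + t\<^sup>2 * (1 / (2 * q) - (S - t\<^sup>2) / (2 * S * q)) = (q + t^4) / (2 * S * q)"
      using S assms by (simp add: field_simps)
    moreover have "(q + t^4) / (2 * S * q) = S / (2 * q)"
      using S(1) unfolding S(2)[symmetric] by (simp add: power2_eq_square)
    ultimately show ?thesis by presburger
  qed
  have F: "ln (sqrt y) - ln (sqrt (y + t^4) + t\<^sup>2) = ln (sqrt y / (sqrt (y + t^4) + t\<^sup>2))"
    if "y \<in> {0<..}" for y
    using that add_nonneg_pos[of "sqrt (y + t^4)" "t\<^sup>2"] assms by (simp add: ln_div)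
  show ?thesis
    unfolding S_def[symmetric]
    by (rule has_field_derivative_transform_within_open[OF D[unfolded E], of "{0<..}"])
      (use assms F in \<open>auto simp: potential_of_sq_def\<close>)
qed

definition off_zero_section :: "(complex^3) set" where "off_zero_section = {v \<in> total_space. v$3 \<noteq> 0}"
lemma open_off_zero_section: "open off_zero_section"
proof -
  have "open ({v :: complex^3. v$3 \<noteq> 0})"
    by (intro open_Collect_neq continuous_intros)
  then show ?thesis using open_Int[OF open_total_space] by (simp add: off_zero_section_def Collect_conj_eq)
qed
lemma off_zero_sectionD: "v \<in> off_zero_section \<Longrightarrow> base_norm_sq v > 0" "v \<in> off_zero_section \<Longrightarrow> u1_sq v > 0" "v \<in> off_zero_section \<Longrightarrow> v$3 \<noteq> 0" "v \<in> off_zero_section \<Longrightarrow> v \<in> total_space"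
  by (auto simp: off_zero_section_def base_norm_sq_pos u1_sq_pos)

text \<open>\<open>\<partial>\<^sub>k\<^sup>- log u\<^sub>1\<close>. As \<open>f\<^sub>t\<close> has derivative \<open>sig = \<surd>(u\<^sub>1\<^sup>2 + t\<^sup>4)\<close> with respect to \<open>log u\<^sub>1\<close>,
  one gets \<open>\<partial>\<partial>\<^sup>- f\<^sub>t = sig \<cdot> \<partial>\<partial>\<^sup>- log u\<^sub>1 + (u\<^sub>1\<^sup>2 / sig) \<cdot> \<partial> log u\<^sub>1 \<and> \<partial>\<^sup>- log u\<^sub>1\<close>.\<close>

definition dbar_log_u1 :: "3 \<Rightarrow> complex^3 \<Rightarrow> complex" where
  "dbar_log_u1 k v = (if k = 3 then 1 / (2 * cnj (v$3)) else v$k / of_real (base_norm_sq v))"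

definition sig_lift :: "real \<Rightarrow> complex^3 \<Rightarrow> real" where "sig_lift t v = sqrt (u1_sq v + t^4)"

definition u1_sq_deriv :: "complex^3 \<Rightarrow> complex^3 \<Rightarrow> real" where
  "u1_sq_deriv v X = 2 * (X$3 \<bullet> v$3) * (base_norm_sq v)^2 + (v$3 \<bullet> v$3) * (4 * base_norm_sq v * (X$1 \<bullet> v$1 + X$2 \<bullet> v$2))"

lemma potential_has_derivative:
  assumes "v \<in> off_zero_section" "t > 0"
  shows "((\<lambda>z. complex_of_real (EH_potential t (abs_EH z))) has_derivative
     (\<lambda>X. of_real (sig_lift t v / (2 * u1_sq v) * u1_sq_deriv v X))) (at v)"
proof -
  have "((\<lambda>z. potential_of_sq t (u1_sq z)) has_derivative (\<lambda>X. sig_lift t v / (2 * u1_sq v) * u1_sq_deriv v X)) (at v)"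
    using has_derivative_compose[OF has_derivative_u1_sq potential_of_sq_deriv[OF off_zero_sectionD(2)[OF assms(1)] assms(2), unfolded has_field_derivative_def]]
    by (simp add: sig_lift_def u1_sq_deriv_def)
  then have "((\<lambda>z. complex_of_real (potential_of_sq t (u1_sq z))) has_derivative (\<lambda>X. of_real (sig_lift t v / (2 * u1_sq v) * u1_sq_deriv v X))) (at v)"
    by (rule has_derivative_of_real)
  then show ?thesis
    by (rule has_derivative_transform_within_open[OF _ open_total_space])
      (use assms off_zero_sectionD in \<open>auto simp: EH_potential_abs\<close>)
qed

lemma u1_sq_deriv_axis:
  "u1_sq_deriv v (axis k a) = (if k = 3 then 2 * (a \<bullet> v$3) * (base_norm_sq v)^2
     else (v$3 \<bullet> v$3) * (4 * base_norm_sq v * (a \<bullet> v$k)))"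
  using exhaust_3[of k] by (auto simp: u1_sq_deriv_def axis_def)

lemma inner_1_i: "complex_of_real (1 \<bullet> z) + \<i> * complex_of_real (\<i> \<bullet> z) = z"
   "complex_of_real (1 \<bullet> z) - \<i> * complex_of_real (\<i> \<bullet> z) = cnj z"
  by (auto simp: inner_complex_def complex_eq_iff)

text \<open>Chain rule: \<open>sig_lift t v / (2 * u1_sq v)\<close> times a derivative of
  \<open>u1_sq\<close> is \<open>sig_lift t v\<close> times that derivative of log u_1.\<close>

lemma wirt_bar_potential:
  assumes "v \<in> off_zero_section" "t > 0"
  shows "wirt_bar k (\<lambda>z. complex_of_real (EH_potential t (abs_EH z))) v = of_real (sig_lift t v) * dbar_log_u1 k v"
proof -
  note R = off_zero_sectionD[OF assms(1)]
  have e: "cnj (v$3) * v$3 = of_real (v$3 \<bullet> v$3)" 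
    by (metis complex_norm_square dot_square_norm mult.commute of_real_power)
  have ne: "v$3 \<bullet> v$3 \<noteq> 0" using R by simp
  have "wirt_bar k (\<lambda>z. complex_of_real (EH_potential t (abs_EH z))) v =
     (of_real (sig_lift t v / (2 * u1_sq v) * u1_sq_deriv v (axis k 1)) + \<i> * of_real (sig_lift t v / (2 * u1_sq v) * u1_sq_deriv v (axis k \<i>))) / 2"
    unfolding wirt_bar_def by (simp only: frechet_derivative_at[OF potential_has_derivative[OF assms], symmetric])
  also have "\<dots> = of_real (sig_lift t v / (4 * u1_sq v)) * (of_real (u1_sq_deriv v (axis k 1)) + \<i> * of_real (u1_sq_deriv v (axis k \<i>)))"
    by (simp add: algebra_simps)
  also have "(of_real (u1_sq_deriv v (axis k 1)) + \<i> * of_real (u1_sq_deriv v (axis k \<i>))) = 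
     (if k = 3 then 2 * of_real ((base_norm_sq v)^2) * v$3 else of_real ((v$3 \<bullet> v$3) * 4 * base_norm_sq v) * v$k)"
    unfolding u1_sq_deriv_axis by (auto simp: complex_eq_iff inner_complex_def)
  also have "of_real (sig_lift t v / (4 * u1_sq v)) * \<dots> = of_real (sig_lift t v) * dbar_log_u1 k v"
    using R ne e by (auto simp: dbar_log_u1_def u1_sq_def field_simps power2_eq_square)
  finally show ?thesis .
qed

definition dbar_log_u1_deriv :: "3 \<Rightarrow> complex^3 \<Rightarrow> complex^3 \<Rightarrow> complex" where
  "dbar_log_u1_deriv k v X = (if k = 3 then - cnj (X$3) / (2 * (cnj (v$3))^2)
     else X$k / of_real (base_norm_sq v) - v$k * of_real (2 * (X$1 \<bullet> v$1 + X$2 \<bullet> v$2)) / of_real ((base_norm_sq v)^2))"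

lemma dbar_log_u1_has_derivative:
  assumes "v \<in> off_zero_section"
  shows "(dbar_log_u1 k has_derivative dbar_log_u1_deriv k v) (at v)"
proof (cases "k = 3")
  case True
  have "((\<lambda>v. 1 / (2 * cnj (v$3))) has_derivative (\<lambda>X. - cnj (X$3) / (2 * (cnj (v$3))^2))) (at v)"
    using off_zero_sectionD[OF assms]
    by (auto intro!: derivative_eq_intros has_derivative_cnj simp: field_simps power2_eq_square)
  then show ?thesis using True by (simp add: dbar_log_u1_def[abs_def] dbar_log_u1_deriv_def[abs_def])
next
  case False
  have "((\<lambda>v. v$k / of_real (base_norm_sq v)) has_derivative
     (\<lambda>X. X$k / of_real (base_norm_sq v) - v$k * of_real (2 * (X$1 \<bullet> v$1 + X$2 \<bullet> v$2)) / of_real ((base_norm_sq v)^2))) (at v)"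
    using off_zero_sectionD[OF assms]
    by (auto intro!: derivative_eq_intros has_derivative_base_norm_sq simp: field_simps power2_eq_square)
  then show ?thesis using False by (simp add: dbar_log_u1_def[abs_def] dbar_log_u1_deriv_def[abs_def])
qed

lemma sig_lift_has_derivative:
  assumes "v \<in> off_zero_section" "t > 0"
  shows "(sig_lift t has_derivative (\<lambda>X. u1_sq_deriv v X / (2 * sig_lift t v))) (at v)"
proof -
  have p: "u1_sq v + t^4 > 0" using off_zero_sectionD[OF assms(1)] by (simp add: add_pos_nonneg)
  show ?thesis
    using has_derivative_compose[OF has_derivative_u1_sq DERIV_sqrt_add[OF p, unfolded has_field_derivative_def]]
    by (simp add: sig_lift_def[abs_def] u1_sq_deriv_def)
qed

lemma second_has_derivative:
  assumes "v \<in> off_zero_section" "t > 0"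
  shows "(wirt_bar k (\<lambda>z. complex_of_real (EH_potential t (abs_EH z))) has_derivative
    (\<lambda>X. of_real (sig_lift t v) * dbar_log_u1_deriv k v X + of_real (u1_sq_deriv v X / (2 * sig_lift t v)) * dbar_log_u1 k v)) (at v)"
proof -
  have "((\<lambda>v. of_real (sig_lift t v) * dbar_log_u1 k v) has_derivative
    (\<lambda>X. of_real (sig_lift t v) * dbar_log_u1_deriv k v X + of_real (u1_sq_deriv v X / (2 * sig_lift t v)) * dbar_log_u1 k v)) (at v)"
    by (intro has_derivative_mult has_derivative_of_real sig_lift_has_derivative dbar_log_u1_has_derivative assms)
  then show ?thesis
    by (rule has_derivative_transform_within_open[OF _ open_off_zero_section])
      (use assms in \<open>auto simp: wirt_bar_potential\<close>)
qed

text \<open>Write log u_1 as the sum of log |gamma| and the logarithm of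
  \<open>base_norm_sq\<close>. The first summand is pluriharmonic, which explains the zeros for
  index 3; the second has the Fubini-Study form as its Hessian. The last term comes from
  differentiating the factor \<open>sig_lift\<close>.\<close>

lemma wirt_second:
  assumes "v \<in> off_zero_section" "t > 0"
  shows "wirt j (wirt_bar k (\<lambda>z. complex_of_real (EH_potential t (abs_EH z)))) v =
     of_real (sig_lift t v) * (if j = 3 \<or> k = 3 then 0 else (if j = k then 1 / of_real (base_norm_sq v) else 0) - v$k * cnj (v$j) / of_real ((base_norm_sq v)^2))
     + of_real (u1_sq v / sig_lift t v) * cnj (dbar_log_u1 j v) * dbar_log_u1 k v"
proof -
  note R = off_zero_sectionD[OF assms(1)]
  have e: "cnj (v$3) * v$3 = of_real (v$3 \<bullet> v$3)" 
    by (metis complex_norm_square dot_square_norm mult.commute of_real_power)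
  have ne: "v$3 \<bullet> v$3 \<noteq> 0" using R by simp
  have 1: "(dbar_log_u1_deriv k v (axis j 1) - \<i> * dbar_log_u1_deriv k v (axis j \<i>)) / 2 =
     (if j = 3 \<or> k = 3 then 0 else (if j = k then 1 / of_real (base_norm_sq v) else 0) - v$k * cnj (v$j) / of_real ((base_norm_sq v)^2))"
  proof -
    have a: "(axis j 1 $ 1 \<bullet> v $ 1 + axis j 1 $ 2 \<bullet> v $ 2) = (if j = 3 then 0 else 1 \<bullet> v$j)" 
       "(axis j \<i> $ 1 \<bullet> v $ 1 + axis j \<i> $ 2 \<bullet> v $ 2) = (if j = 3 then 0 else \<i> \<bullet> v$j)"
      using exhaust_3[of j] by (auto simp: axis_def)
    show ?thesis
      unfolding dbar_log_u1_deriv_def a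
      \<comment> \<open>Expresses \<open>cnj (v$j)\<close> by the same two inner products that occur
        in the real derivatives along 1 and i.\<close>
      apply (simp only: inner_1_i(2)[of "v$j",symmetric])
      using R by (auto simp: field_simps axis_def power2_eq_square)
  qed
  have 2: "(complex_of_real (u1_sq_deriv v (axis j 1)) - \<i> * of_real (u1_sq_deriv v (axis j \<i>))) / 4 = of_real (u1_sq v) * cnj (dbar_log_u1 j v)"
  proof -
    have "(of_real (u1_sq_deriv v (axis j 1)) - \<i> * of_real (u1_sq_deriv v (axis j \<i>))) = 
     (if j = 3 then 2 * of_real ((base_norm_sq v)^2) * cnj (v$3) else of_real ((v$3 \<bullet> v$3) * 4 * base_norm_sq v) * cnj (v$j))"
    unfolding u1_sq_deriv_axis by (auto simp: complex_eq_iff inner_complex_def)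
    then show ?thesis
      using R ne e by (auto simp: dbar_log_u1_def u1_sq_def field_simps power2_eq_square)
  qed
  have "wirt j (wirt_bar k (\<lambda>z. complex_of_real (EH_potential t (abs_EH z)))) v =
     of_real (sig_lift t v) * ((dbar_log_u1_deriv k v (axis j 1) - \<i> * dbar_log_u1_deriv k v (axis j \<i>)) / 2) + 
     of_real (1 / sig_lift t v) * dbar_log_u1 k v * ((complex_of_real (u1_sq_deriv v (axis j 1)) - \<i> * of_real (u1_sq_deriv v (axis j \<i>))) / 4)"
    unfolding wirt_def frechet_derivative_at[OF second_has_derivative[OF assms], symmetric] by (simp add: algebra_simps add_divide_distrib diff_divide_distrib)
  then show ?thesis unfolding 1 2 by simp
qed

section \<open>The induced metric\<close>

text \<open>The complex Hessian of the potential as a sesquilinear form: a multiple of the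
  Fubini-Study form in the base direction, plus a rank-one form built from the differential of log
  u_1.\<close>

definition levi_form :: "real \<Rightarrow> complex^3 \<Rightarrow> complex^3 \<Rightarrow> complex^3 \<Rightarrow> complex" where
  "levi_form t v X Y = of_real (sig_lift t v) * ((X$1 * cnj (Y$1) + X$2 * cnj (Y$2)) / of_real (base_norm_sq v)
      - (X$1 * cnj (v$1) + X$2 * cnj (v$2)) * cnj (Y$1 * cnj (v$1) + Y$2 * cnj (v$2)) / of_real ((base_norm_sq v)^2))
    + of_real (u1_sq v / sig_lift t v) * ((X$1 * cnj (v$1) + X$2 * cnj (v$2)) / of_real (base_norm_sq v) + X$3 / (2 * v$3))
        * cnj ((Y$1 * cnj (v$1) + Y$2 * cnj (v$2)) / of_real (base_norm_sq v) + Y$3 / (2 * v$3))"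

text \<open>Multiplying the second argument by i turns the antisymmetrization in
  \<open>i_ddbar\<close> into a symmetrization, so the metric is twice the real part of the
  Hermitian form. This is the source of the factors 2 in the Gram matrix.\<close>

lemma EH_metric_levi_form:
  assumes "v \<in> off_zero_section" "t > 0"
  shows "EH_metric t v X Y = Re (levi_form t v X Y + levi_form t v Y X)"
proof -
  let ?F = "\<lambda>z. complex_of_real (EH_potential t (abs_EH z))"
  define h where "h j k = wirt j (wirt_bar k ?F) v" for j k
  have H: "levi_form t v X Y = (\<Sum>j\<in>UNIV. \<Sum>k\<in>UNIV. h j k * (X$j * cnj (Y$k)))" for X Y
    unfolding h_def wirt_second[OF assms] levi_form_def sum_3 dbar_log_u1_def by (simp add: algebra_simps add_divide_distrib diff_divide_distrib)
  have "EH_metric t v X Y = Re (\<i> * (\<Sum>j\<in>UNIV. \<Sum>k\<in>UNIV. h j k * (X$j * cnj (\<i> * Y$k) - (\<i> * Y$j) * cnj (X$k))))"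
    using off_zero_sectionD(3)[OF assms(1)] by (simp add: EH_metric_def EH_omega_def i_ddbar_def h_def)
  also have "\<i> * (\<Sum>j\<in>UNIV. \<Sum>k\<in>UNIV. h j k * (X$j * cnj (\<i> * Y$k) - (\<i> * Y$j) * cnj (X$k)))
     = levi_form t v X Y + levi_form t v Y X"
    unfolding H sum_3 by (simp add: algebra_simps)
  finally show ?thesis .
qed

lemma matrix_inv_eqI:
  fixes A B :: "'a::field^'n^'n"
  assumes "A ** B = mat 1"
  shows "matrix_inv A = B"
proof -
  have "B ** A = mat 1" using assms matrix_left_right_inverse by blast
  then show ?thesis
    unfolding matrix_inv_def
    by (intro some_equality conjI assms) (metis assms matrix_mul_assoc matrix_mul_lid matrix_mul_rid)+
qed

text \<open>The parameters of points off the zero section. Its complement is a null set, so the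
  limit that defines the metric there never has to be computed.\<close>

definition off_axis :: "(real^3) set" where "off_axis = {x. x$2 \<noteq> 0 \<or> x$3 \<noteq> 0}"

lemma open_off_axis: "open off_axis"
  unfolding off_axis_def
  by (intro open_Collect_disj open_Collect_neq continuous_intros)

locale eh_curve =
  fixes t L :: real and c :: "real \<Rightarrow> complex" and A :: "complex^2^2"
  assumes t: "t > 0" and curve: "smooth_closed_curve c L" and unit: "unitary2 A"
begin

text \<open>Along the parametrization, \<open>xi\<close> is \<open>u\<^sub>1\<^sup>2\<close>, and \<open>\<partial>\<^sub>s - 2 Re m \<partial>\<^sub>x - 2 Im m \<partial>\<^sub>y\<close> is the lift of \<open>\<partial>\<^sub>s\<close>
  orthogonal to the fibres.\<close>

definition c1 where "c1 s = vector_derivative c (at s)"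
definition rho where "rho s = (c s \<bullet> c s) + 1"
definition xi where "xi x = ((x$2)\<^sup>2 + (x$3)\<^sup>2) * (rho (x$1))\<^sup>2" for x :: "real^3"
definition sig where "sig x = sqrt (xi x + t^4)"
definition m where "m x = c1 (x$1) * cnj (c (x$1)) * Complex (x$2) (x$3) / of_real (rho (x$1))" for x :: "real^3"
text \<open>The squared Fubini-Study speed of the curve.\<close>

definition kappa where "kappa s = (c1 s \<bullet> c1 s) / (rho s)^2"

lemma c_smooth: "smooth c" and c1_nz: "c1 s \<noteq> 0" and L_pos: "L > 0" and c_periodic: "c (s + L) = c s"
  using curve by (auto simp: smooth_closed_curve_def c1_def)

lemma c_deriv: "(c has_vector_derivative c1 s) (at s)"
  using smooth_differentiable[OF c_smooth] by (simp add: c1_def vector_derivative_works differentiable_def has_vector_derivative_def)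

lemma rho_pos: "rho s > 0" by (simp add: rho_def add_nonneg_pos)
lemma kappa_pos: "kappa s > 0" using rho_pos[of s] c1_nz[of s] by (simp add: kappa_def)

lemma unit_cols:
  "A$1$1 * cnj (A$1$1) + A$2$1 * cnj (A$2$1) = 1"
  "A$1$2 * cnj (A$1$2) + A$2$2 * cnj (A$2$2) = 1"
  "A$1$1 * cnj (A$1$2) + A$2$1 * cnj (A$2$2) = 0"
proof -
  \<comment> \<open>\<open>unitary2\<close> states orthonormality of the rows; the columns follow
    because a right inverse of a square matrix is also a left inverse.\<close>
  have "(\<chi> i j. cnj (A$j$i)) ** A = mat 1"
    using unit matrix_left_right_inverse unfolding unitary2_def by metis
  then have "((\<chi> i j. cnj (A$j$i)) ** A) $ i $ j = (mat 1 :: complex^2^2) $ i $ j" for i j by simp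
  from this[of 1 1] this[of 2 2] this[of 2 1]
  show "A$1$1 * cnj (A$1$1) + A$2$1 * cnj (A$2$1) = 1"
  "A$1$2 * cnj (A$1$2) + A$2$2 * cnj (A$2$2) = 1"
  "A$1$1 * cnj (A$1$2) + A$2$1 * cnj (A$2$2) = 0"
    by (auto simp: matrix_matrix_mult_def sum_2 mat_def mult.commute)
qed

text \<open>Here the matrix drops out: the Hermitian products of the lifted curve and its velocity
  are those of (c, 1) and (c', 0).\<close>

lemma unit_inner:
  "(A$1$1 * z + A$1$2 * w) * cnj (A$1$1 * z' + A$1$2 * w') + (A$2$1 * z + A$2$2 * w) * cnj (A$2$1 * z' + A$2$2 * w') = z * cnj z' + w * cnj w'"
proof -
  have c3: "cnj (A$1$1) * A$1$2 + cnj (A$2$1) * A$2$2 = 0"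
    using arg_cong[OF unit_cols(3), of cnj] by (simp add: mult.commute)
  have "(A$1$1 * z + A$1$2 * w) * cnj (A$1$1 * z' + A$1$2 * w') + (A$2$1 * z + A$2$2 * w) * cnj (A$2$1 * z' + A$2$2 * w')
   = (A$1$1 * cnj (A$1$1) + A$2$1 * cnj (A$2$1)) * (z * cnj z') + (A$1$2 * cnj (A$1$2) + A$2$2 * cnj (A$2$2)) * (w * cnj w')
    + (A$1$1 * cnj (A$1$2) + A$2$1 * cnj (A$2$2)) * (z * cnj w') + (cnj (A$1$1) * A$1$2 + cnj (A$2$1) * A$2$2) * (w * cnj z')"
    by (simp add: algebra_simps)
  then show ?thesis unfolding unit_cols c3 by simp
qed

lemma norm_param:
  "base_norm_sq (param_lift A c x) = rho (x$1)"
  "u1_sq (param_lift A c x) = xi x"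
  "sig_lift t (param_lift A c x) = sig x"
proof -
  have e: "complex_of_real (z \<bullet> z) = z * cnj z" for z
    by (metis complex_norm_square dot_square_norm of_real_power)
  have "complex_of_real (base_norm_sq (param_lift A c x)) = of_real (rho (x$1))"
    using unit_inner[of "c (x$1)" 1 "c (x$1)" 1] by (simp only: base_norm_sq_def rho_def of_real_add e param_lift_nth) simp
  then show R: "base_norm_sq (param_lift A c x) = rho (x$1)" by (simp only: of_real_eq_iff)
  show q: "u1_sq (param_lift A c x) = xi x"
    by (simp add: u1_sq_def R xi_def inner_complex_def power2_eq_square)
  show "sig_lift t (param_lift A c x) = sig x" by (simp add: sig_lift_def q sig_def)
qed

lemma param_lift_has_derivative:
  "(param_lift A c has_derivative (\<lambda>h. vector [A$1$1 * (h$1 *\<^sub>R c1 (x$1)), A$2$1 * (h$1 *\<^sub>R c1 (x$1)), Complex (h$2) (h$3)])) (at x)"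
proof -
  have cd: "((\<lambda>x. c (x$1)) has_derivative (\<lambda>h. h$1 *\<^sub>R c1 (x$1))) (at x)"
    using has_derivative_compose[OF has_derivative_vec_nth_id c_deriv[unfolded has_vector_derivative_def], of 1 x UNIV] by simp
  have "((\<lambda>x. of_real (x$2) + \<i> * of_real (x$3)) has_derivative (\<lambda>h. of_real (h$2) + \<i> * of_real (h$3))) (at x)"
    by (auto intro!: derivative_eq_intros)
  then have "((\<lambda>x. Complex (x$2) (x$3)) has_derivative (\<lambda>h. Complex (h$2) (h$3))) (at x)"
    by (simp add: Complex_eq)
  then show ?thesis
    by (intro has_derivative_vec3) (auto intro!: derivative_eq_intros cd)
qed

lemma pd_param_lift:
  "pd 1 (param_lift A c) x = vector [A$1$1 * c1 (x$1), A$2$1 * c1 (x$1), 0]"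
  "pd 2 (param_lift A c) x = vector [0, 0, 1]"
  "pd 3 (param_lift A c) x = vector [0, 0, \<i>]"
  unfolding pd_def frechet_derivative_at[OF param_lift_has_derivative, symmetric]
  by (simp_all add: axis_def complex_eq_iff vec_eq_iff forall_3)

lemma param_off_zero_section: "x \<in> off_axis \<Longrightarrow> param_lift A c x \<in> off_zero_section"
  using param_lift_total_space[OF unit, of c x] by (auto simp: off_zero_section_def off_axis_def complex_eq_iff)

lemma xi_nonneg: "xi x \<ge> 0" by (simp add: xi_def)
lemma sig_pos: "sig x > 0" using xi_nonneg[of x] t by (simp add: sig_def add_nonneg_pos)
text \<open>With w = x + iy this is the metric 2 sig kappa ds^2 + rho^2 / (2 sig) |dw + 2 m ds|^2.
  The completed square exhibits the horizontal direction, where dw = -2 m ds.\<close>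

definition gram :: "real^3 \<Rightarrow> real^3^3" where
  "gram x = vector [
     vector [2 * sig x * kappa (x$1) + 2 * (rho (x$1))\<^sup>2 / sig x * (m x \<bullet> m x), (rho (x$1))\<^sup>2 / sig x * Re (m x), (rho (x$1))\<^sup>2 / sig x * Im (m x)],
     vector [(rho (x$1))\<^sup>2 / sig x * Re (m x), (rho (x$1))\<^sup>2 / (2 * sig x), 0],
     vector [(rho (x$1))\<^sup>2 / sig x * Im (m x), 0, (rho (x$1))\<^sup>2 / (2 * sig x)]]"

definition gram_inv :: "real^3 \<Rightarrow> real^3^3" where
  "gram_inv x = (let P = 1 / (2 * sig x * kappa (x$1)); Q = 2 * sig x / (rho (x$1))\<^sup>2 in vector [
     vector [P, -2 * Re (m x) * P, -2 * Im (m x) * P],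
     vector [-2 * Re (m x) * P, 4 * (Re (m x))^2 * P + Q, 4 * Re (m x) * Im (m x) * P],
     vector [-2 * Im (m x) * P, 4 * Re (m x) * Im (m x) * P, 4 * (Im (m x))^2 * P + Q]])"

text \<open>The differential of log u_1 has a pole 1/w on the fibre, but it enters quadratically
  with the factor \<open>xi x\<close>, which is |w|^2 rho^2. The poles cancel, and
  \<open>gram\<close> makes sense on the axis as well.\<close>

lemma induced_metric_eq:
  assumes "x \<in> off_axis"
  shows "induced_metric t A c x = gram x"
proof -
  let ?v = "param_lift A c x"
  let ?d = "\<lambda>i. pd i (param_lift A c) x"
  define w where "w = Complex (x$2) (x$3)"
  define C where "C = c1 (x$1) * cnj (c (x$1))"
  define r where "r = rho (x$1)"
  have w: "w \<noteq> 0" using assms by (auto simp: w_def off_axis_def complex_eq_iff)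
  have ww: "xi x = (w \<bullet> w) * r^2" by (simp add: xi_def w_def inner_complex_def r_def power2_eq_square)
  have r: "r > 0" unfolding r_def by (rule rho_pos)
  have e: "complex_of_real (z \<bullet> z) = z * cnj z" for z
    by (metis complex_norm_square dot_square_norm of_real_power)
  have a1: "A$1$1 * c1 (x$1) * cnj (?v$1) + A$2$1 * c1 (x$1) * cnj (?v$2) = C"
    using unit_inner[of "c1 (x$1)" 0 "c (x$1)" 1] by (simp add: C_def)
  have a2: "A$1$1 * c1 (x$1) * cnj (A$1$1 * c1 (x$1)) + A$2$1 * c1 (x$1) * cnj (A$2$1 * c1 (x$1)) = of_real (c1 (x$1) \<bullet> c1 (x$1))"
    using unit_inner[of "c1 (x$1)" 0 "c1 (x$1)" 0] by (simp add: e)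
  \<comment> \<open>The components of the holomorphic differential of log u_1 along the three
    coordinate fields.\<close>
  define th where "th i = (if i = 1 then C / of_real r else if i = 2 then 1 / (2 * w) else \<i> / (2*w))" for i :: 3
  have b1: "?d i $ 1 * cnj (?d j $ 1) + ?d i $ 2 * cnj (?d j $ 2) = (if i = 1 \<and> j = 1 then of_real (c1 (x$1) \<bullet> c1 (x$1)) else 0)" for i j
    using exhaust_3[of i] exhaust_3[of j] a2 by (auto simp: pd_param_lift)
  have b2: "?d i $ 1 * cnj (?v $ 1) + ?d i $ 2 * cnj (?v $ 2) = (if i = 1 then C else 0)" for i
    using exhaust_3[of i] a1 by (auto simp: pd_param_lift)
  have b3: "(if i = 1 then C else 0) / of_real r + ?d i $ 3 / (2 * ?v $ 3) = th i" for i
    using exhaust_3[of i] by (auto simp: pd_param_lift th_def w_def)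
  \<comment> \<open>The Fubini-Study part of the velocity: |c|^2 = rho - 1 turns the difference of
    the two quotients into |c'|^2 / rho^2.\<close>
  have k: "(c1 (x$1) \<bullet> c1 (x$1)) / r - (C \<bullet> C) / r^2 = kappa (x$1)"
  proof -
    have "C \<bullet> C = (c1 (x$1) \<bullet> c1 (x$1)) * (r - 1)"
      by (simp add: C_def r_def rho_def dot_square_norm norm_mult power_mult_distrib)
    then show ?thesis using r by (simp add: kappa_def r_def[symmetric] field_simps power2_eq_square)
  qed
  have h: "levi_form t ?v (?d i) (?d j) = of_real (if i = 1 \<and> j = 1 then sig x * kappa (x$1) else 0)
       + of_real (xi x / sig x) * th i * cnj (th j)" for i j
    unfolding levi_form_def b1 b2 norm_param r_def[symmetric] b3 k[symmetric]
    by (simp add: e algebra_simps)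
  have im: "induced_metric t A c x $ i $ j = 2 * (if i = 1 \<and> j = 1 then sig x * kappa (x$1) else 0)
       + 2 * xi x / sig x * Re (th i * cnj (th j))" for i j
  proof -
    have "induced_metric t A c x $ i $ j = Re (levi_form t ?v (?d i) (?d j) + levi_form t ?v (?d j) (?d i))"
      by (simp add: induced_metric_def EH_metric_levi_form[OF param_off_zero_section[OF assms] t])
    also have "\<dots> = 2 * (if i = 1 \<and> j = 1 then sig x * kappa (x$1) else 0)
       + xi x / sig x * (Re (th i * cnj (th j)) + Re (th j * cnj (th i)))"
      unfolding h by (simp add: algebra_simps add_divide_distrib)
    also have "Re (th j * cnj (th i)) = Re (th i * cnj (th j))" by simp
    finally show ?thesis by (simp add: algebra_simps add_divide_distrib)
  qed
  have mC: "m x = C * w / of_real r" by (simp add: m_def C_def w_def r_def)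
  have n: "w \<bullet> w > 0" using w by simp
  have iw: "cnj (1 / w) = w / of_real (w \<bullet> w)" using w by (simp add: e field_simps)
  have t11: "xi x * Re (th 1 * cnj (th 1)) = r^2 * (m x \<bullet> m x)"
  proof -
    have "m x \<bullet> m x = (C \<bullet> C) * (w \<bullet> w) / r^2" 
      unfolding mC by (simp add: dot_square_norm norm_mult norm_divide power_mult_distrib power_divide)
    moreover have "Re (th 1 * cnj (th 1)) = (C \<bullet> C) / r^2"
      by (simp add: th_def inner_complex_def power2_eq_square)
    ultimately show ?thesis using r by (simp add: ww)
  qed
  have t12: "2 * xi x * (th 1 * cnj (th 2)) = of_real (r^2) * m x"
  proof -
    have "th 1 * cnj (th 2) = C / of_real r * cnj (1 / w) / 2" by (simp add: th_def)
    then show ?thesis unfolding iw using r n by (simp add: ww mC field_simps power2_eq_square)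
  qed
  have t13: "2 * xi x * (th 1 * cnj (th 3)) = - \<i> * of_real (r^2) * m x"
  proof -
    have "th 1 * cnj (th 3) = C / of_real r * cnj (1 / w) * (-\<i>) / 2" by (simp add: th_def)
    then show ?thesis unfolding iw using r n by (simp add: ww mC field_simps power2_eq_square)
  qed
  have t22: "4 * xi x * (1 / (2 * w) * cnj (1 / (2 * w))) = of_real (r^2)"
  proof -
    have "1 / (2 * w) * cnj (1 / (2 * w)) = 1 / w * cnj (1 / w) / 4" by simp
    then show ?thesis unfolding iw using r n w by (simp add: ww field_simps power2_eq_square)
  qed
  have q12: "2 * xi x * Re (th 1 * cnj (th 2)) = r^2 * Re (m x)"
    using arg_cong[OF t12, of Re] by simp
  have q13: "2 * xi x * Re (th 1 * cnj (th 3)) = r^2 * Im (m x)"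
    using arg_cong[OF t13, of Re] by simp
  have q22: "4 * xi x * Re (th 2 * cnj (th 2)) = r^2"
  proof -
    have "of_real (4 * xi x) * (th 2 * cnj (th 2)) = of_real (r^2)"
      using t22 by (simp add: th_def)
    then have "Re (of_real (4 * xi x) * (th 2 * cnj (th 2))) = r^2" by (simp only: Re_complex_of_real)
    then show ?thesis by (simp only: Re_complex_of_real Im_complex_of_real times_complex.sel mult_zero_left diff_zero)
  qed
  have q33: "4 * xi x * Re (th 3 * cnj (th 3)) = r^2"
  proof -
    have "th 3 * cnj (th 3) = th 2 * cnj (th 2)" by (simp add: th_def)
    then show ?thesis using q22 by presburger
  qed
  have q23: "Re (th 2 * cnj (th 3)) = 0"
  proof -
    have "th 3 = \<i> * th 2" by (simp add: th_def)
    then show ?thesis by simp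
  qed
  have sy: "Re (th j * cnj (th i)) = Re (th i * cnj (th j))" for i j by simp
  have "induced_metric t A c x $ i $ j = gram x $ i $ j" for i j
  proof -
    have s: "induced_metric t A c x $ i $ j = induced_metric t A c x $ j $ i" for i j
      unfolding im using sy[of i j] by auto
    have 1: "induced_metric t A c x $ 1 $ 1 = 2 * sig x * kappa (x$1) + 2 / sig x * (xi x * Re (th 1 * cnj (th 1)))"
      unfolding im by simp
    have 2: "induced_metric t A c x $ 1 $ 2 = (2 * xi x * Re (th 1 * cnj (th 2))) / sig x"
        "induced_metric t A c x $ 1 $ 3 = (2 * xi x * Re (th 1 * cnj (th 3))) / sig x"
        "induced_metric t A c x $ 2 $ 2 = (4 * xi x * Re (th 2 * cnj (th 2))) / (2 * sig x)"
        "induced_metric t A c x $ 3 $ 3 = (4 * xi x * Re (th 3 * cnj (th 3))) / (2 * sig x)"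
        "induced_metric t A c x $ 2 $ 3 = 0"
      unfolding im q23 by simp_all
    show ?thesis
      using exhaust_3[of i] exhaust_3[of j] 1 2 s[of 2 1] s[of 3 1] s[of 3 2]
      unfolding t11 q12 q13 q22 q33 by (auto simp: gram_def r_def)
  qed
  then show ?thesis by (simp add: vec_eq_iff)
qed

lemma gram_matrix_inv: "matrix_inv (gram x) = gram_inv x"
proof -
  have nz: "sig x \<noteq> 0" "kappa (x$1) \<noteq> 0" "rho (x$1) \<noteq> 0"
    using sig_pos[of x] kappa_pos[of "x$1"] rho_pos[of "x$1"] by auto
  define a b K T where ab: "a = Re (m x)" "b = Im (m x)" "K = kappa (x$1)" "T = (rho (x$1))\<^sup>2 / (2 * sig x)"
  have T: "T \<noteq> 0" using nz by (simp add: ab)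
  have mm: "m x \<bullet> m x = a^2 + b^2" by (simp add: inner_complex_def ab power2_eq_square)
  have H: "gram x = vector [vector [2 * sig x * K + 4 * T * (a^2+b^2), 2 * T * a, 2 * T * b], vector [2 * T * a, T, 0], vector [2 * T * b, 0, T]]"
    unfolding gram_def mm by (simp add: ab algebra_simps)
  have I: "gram_inv x = (let P = 1 / (2 * sig x * K); Q = 1 / T in vector [
     vector [P, -2 * a * P, -2 * b * P],
     vector [-2 * a * P, 4 * a^2 * P + Q, 4 * a * b * P],
     vector [-2 * b * P, 4 * a * b * P, 4 * b^2 * P + Q]])"
    unfolding gram_inv_def by (simp add: ab)
  have "gram x ** gram_inv x = mat 1"
    unfolding H I Let_def using nz(1,2) T
    by (simp add: matrix_matrix_mult_def vec_eq_iff forall_3 sum_3 mat_def ab(3)[symmetric] field_simps power2_eq_square)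
  then show ?thesis by (rule matrix_inv_eqI)
qed

text \<open>The shear from (ds, dw) to (ds, dw + 2 m ds) has determinant 1, so the determinant is
  the product of the coefficients 2 sig kappa, rho^2 / (2 sig) and rho^2 / (2 sig).\<close>

lemma gram_det: "det (gram x) = kappa (x$1) * (rho (x$1))^4 / (2 * sig x)"
proof -
  have nz: "sig x \<noteq> 0" using sig_pos[of x] by auto
  have mm: "m x \<bullet> m x = Re (m x)^2 + Im (m x)^2" by (simp add: inner_complex_def power2_eq_square)
  show ?thesis unfolding gram_def det_3 mm using nz
    by (simp add: field_simps power2_eq_square power4_eq_xxxx)
qed

end

section \<open>Green's formula against radial functions\<close>

context eh_curve
begin

section \<open>Regularity of the coefficients of metric, density and flux\<close>

lemma c1_Ck1: "Ck (Suc 0) c1"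
proof -
  have "frechet_derivative c (at s) 1 = c1 s" for s
    using c_deriv[of s] unfolding has_vector_derivative_def by (simp add: frechet_derivative_at[symmetric])
  then have "c1 = (\<lambda>s. frechet_derivative c (at s) 1)" by auto
  then show ?thesis using smooth_Ck1_derivative[OF c_smooth, of 1] by simp
qed

lemma c_Ck1: "Ck (Suc 0) c" by (rule smooth_Ck1[OF c_smooth])

lemma rho_Ck1: "Ck (Suc 0) rho"
  unfolding rho_def[abs_def] by (intro Ck1_add Ck1_inner c_Ck1 Ck1_const)

lemma kappa_Ck1: "Ck (Suc 0) kappa"
proof -
  have "kappa = (\<lambda>s. (c1 s \<bullet> c1 s) * inverse ((rho s)^2))" by (auto simp: kappa_def divide_inverse)
  moreover have "(rho s)^2 \<noteq> 0" for s using rho_pos[of s] by simp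
  ultimately show ?thesis
    by (simp only:) (intro Ck1_mult Ck1_inner c1_Ck1 Ck1_inverse Ck1_power2 rho_Ck1)
qed

text \<open>The factor of the volume density that depends on the curve parameter alone. The
  remaining factor depends on u_1 only, which makes dilations of the fibre effective.\<close>

definition curve_weight where "curve_weight s = sqrt (kappa s * (1/2)) * (rho s)^2"

lemma curve_weight_pos: "curve_weight s > 0" using kappa_pos[of s] rho_pos[of s] by (simp add: curve_weight_def)

lemma curve_weight_Ck1: "Ck (Suc 0) curve_weight"
  unfolding curve_weight_def[abs_def] using kappa_pos by (intro Ck1_mult Ck1_sqrt kappa_Ck1 Ck1_const Ck1_power2 rho_Ck1) auto

text \<open>The square root of \<open>sig\<close> as a function of z = u_1^2. In terms of it the
  density and the flux contain only powers, so the identities of Green's formula become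
  rational.\<close>

definition sqrt_sig where "sqrt_sig z = sqrt (sqrt (z + t^4))"

lemma sqrt_sig_pos: "z \<ge> 0 \<Longrightarrow> sqrt_sig z > 0" using t by (simp add: sqrt_sig_def add_nonneg_pos)
lemma sig_eq_sqrt_sig: "sig x = (sqrt_sig (xi x))^2" using sig_pos[of x] by (simp add: sqrt_sig_def sig_def)

definition vol_density where "vol_density x = curve_weight (x$1) * inverse (sqrt_sig (xi x))" for x :: "real^3"

lemma vol_density_pos: "vol_density x > 0" using curve_weight_pos sqrt_sig_pos[OF xi_nonneg] by (simp add: vol_density_def)

lemma vol_density_eq: "vol_density x = sqrt (det (gram x))"
proof -
  have "vol_density x = sqrt ((vol_density x)^2)" using vol_density_pos[of x] by simp
  also have "(vol_density x)^2 = det (gram x)"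
  proof -
    have "(curve_weight (x$1))^2 = kappa (x$1) / 2 * rho (x$1) ^ 4"
      using kappa_pos[of "x$1"] by (simp add: curve_weight_def power_mult_distrib)
    then show ?thesis
      unfolding gram_det vol_density_def sig_eq_sqrt_sig power_mult_distrib using sqrt_sig_pos[OF xi_nonneg, of x] by (simp add: field_simps)
  qed
  finally show ?thesis .
qed

lemma xi_has_derivative:
  "(xi has_derivative (\<lambda>h. (2 * x$2 * h$2 + 2 * x$3 * h$3) * (rho (x$1))^2
     + ((x$2)^2 + (x$3)^2) * (4 * rho (x$1) * (c (x$1) \<bullet> c1 (x$1)) * h$1))) (at x)"
proof -
  have cd: "((\<lambda>x. c (x$1)) has_derivative (\<lambda>h. h$1 *\<^sub>R c1 (x$1))) (at x)"
    using has_derivative_compose[OF has_derivative_vec_nth_id c_deriv[unfolded has_vector_derivative_def], of 1 x UNIV] by simp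
  have r: "((\<lambda>x. rho (x$1)) has_derivative (\<lambda>h. 2 * (c (x$1) \<bullet> c1 (x$1)) * h$1)) (at x)"
  proof -
    have e: "(\<lambda>x. rho (x$1)) = (\<lambda>x. 1 + (c (x$1) \<bullet> c (x$1)))" by (simp add: rho_def add.commute)
    have "((\<lambda>x. 1 + (c (x$1) \<bullet> c (x$1))) has_derivative (\<lambda>h. c (x$1) \<bullet> (h$1 *\<^sub>R c1 (x$1)) + (h$1 *\<^sub>R c1 (x$1)) \<bullet> c (x$1))) (at x)"
      using has_derivative_add_const[OF has_derivative_inner[OF cd cd]] by (simp add: add.commute)
    then show ?thesis unfolding e by (simp add: inner_commute algebra_simps)
  qed
  have q: "((\<lambda>x. (x$2)^2 + (x$3)^2) has_derivative (\<lambda>h. 2 * x$2 * h$2 + 2 * x$3 * h$3)) (at x)"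
    by (auto intro!: derivative_eq_intros simp: power2_eq_square)
  have "((\<lambda>x. (rho (x$1))^2) has_derivative (\<lambda>h. 2 * rho (x$1) * (2 * (c (x$1) \<bullet> c1 (x$1)) * h$1))) (at x)"
    using has_derivative_mult[OF r r] by (simp add: power2_eq_square algebra_simps)
  from has_derivative_mult[OF q this] show ?thesis
    unfolding xi_def[abs_def] by (simp add: algebra_simps)
qed

lemma pd_xi:
  "pd 1 xi x = ((x$2)^2 + (x$3)^2) * (4 * rho (x$1) * (c (x$1) \<bullet> c1 (x$1)))"
  "pd 2 xi x = 2 * x$2 * (rho (x$1))^2"
  "pd 3 xi x = 2 * x$3 * (rho (x$1))^2"
  unfolding pd_eqI[OF xi_has_derivative] by (simp_all add: axis_def)

lemma xi_Ck1: "Ck (Suc 0) xi"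
  unfolding xi_def[abs_def] by (intro Ck1_mult Ck1_add Ck1_power2 Ck1_vec_nth Ck1_first rho_Ck1)

text \<open>The correction by \<open>2 * m\<close> multiplies w by a complex scalar with real part 2
  Re (c' cnj c) / rho, and Re (c' cnj c) is half the derivative of rho. The resulting change of
  |w|^2 offsets that of rho^2.\<close>

lemma xi_rotation: "pd 1 xi x - 2 * Re (m x) * pd 2 xi x - 2 * Im (m x) * pd 3 xi x = 0"
proof -
  have *: "Re (m x) = Re (c1 (x$1) * cnj (c (x$1)) * Complex (x$2) (x$3)) / rho (x$1)"
    "Im (m x) = Im (c1 (x$1) * cnj (c (x$1)) * Complex (x$2) (x$3)) / rho (x$1)"
    unfolding m_def by simp_all
  show ?thesis unfolding pd_xi * using rho_pos[of "x$1"]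
    by (simp add: inner_complex_def field_simps power2_eq_square)
qed

lemma sig_Ck1: "Ck (Suc 0) sig"
  unfolding sig_def[abs_def] using sig_pos by (intro Ck1_sqrt Ck1_add xi_Ck1 Ck1_const) (simp add: sig_def)

lemma sqrt_sig_Ck1: "Ck (Suc 0) (\<lambda>x. sqrt_sig (xi x))"
  using Ck1_sqrt[OF sig_Ck1 sig_pos] by (simp add: sqrt_sig_def sig_def)

lemma vol_density_Ck1: "Ck (Suc 0) vol_density"
  unfolding vol_density_def[abs_def] using sqrt_sig_pos[OF xi_nonneg]
  by (intro Ck1_mult Ck1_first curve_weight_Ck1 Ck1_inverse sqrt_sig_Ck1) (metis less_irrefl)

lemma m_Ck1: "Ck (Suc 0) (\<lambda>x. Re (m x))" "Ck (Suc 0) (\<lambda>x. Im (m x))"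
proof -
  have r: "rho (x$1) \<noteq> 0" for x :: "real^3" using rho_pos[of "x$1"] by simp
  have "Ck (Suc 0) (\<lambda>x::real^3. c1 (x$1) * cnj (c (x$1)) * (of_real (x$2) + \<i> * of_real (x$3)) * of_real (inverse (rho (x$1))))"
    by (intro Ck1_mult Ck1_add Ck1_bounded_linear[OF bounded_linear_cnj] Ck1_of_real Ck1_inverse Ck1_const Ck1_vec_nth
        Ck1_first c1_Ck1 c_Ck1 rho_Ck1 r)
  moreover have "(\<lambda>x::real^3. c1 (x$1) * cnj (c (x$1)) * (of_real (x$2) + \<i> * of_real (x$3)) * of_real (inverse (rho (x$1)))) = m"
    by (auto simp: m_def Complex_eq divide_inverse fun_eq_iff)
  ultimately have "Ck (Suc 0) m" by simp
  then show "Ck (Suc 0) (\<lambda>x. Re (m x))" "Ck (Suc 0) (\<lambda>x. Im (m x))"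
    by (rule Ck1_bounded_linear[OF bounded_linear_Re], rule Ck1_bounded_linear[OF bounded_linear_Im])
qed

definition horizontal where "horizontal f x = pd 1 f x - 2 * of_real (Re (m x)) * pd 2 f x - 2 * of_real (Im (m x)) * pd 3 f x"
  for f :: "real^3 \<Rightarrow> complex"
text \<open>\<open>flux f\<close> is the gradient of \<open>f\<close> times the volume density. The inverse metric is
  \<open>(2 sig kappa)\<^sup>-\<^sup>1 e \<otimes> e + (2 sig / rho\<^sup>2) (\<partial>\<^sub>x \<otimes> \<partial>\<^sub>x + \<partial>\<^sub>y \<otimes> \<partial>\<^sub>y)\<close>, where \<open>e\<close> is the horizontal lift.
  These formulas stay smooth across the zero section, so no boundary term arises there.\<close>

definition flux_s where "flux_s x = vol_density x * inverse (2 * sig x * kappa (x$1))"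
definition flux_w where "flux_w x = vol_density x * (2 * sig x * inverse ((rho (x$1))^2))"

definition flux :: "(real^3 \<Rightarrow> complex) \<Rightarrow> 3 \<Rightarrow> real^3 \<Rightarrow> complex" where
  "flux f i x = (if i = 1 then of_real (flux_s x) * horizontal f x
     else if i = 2 then of_real (-2 * Re (m x) * flux_s x) * horizontal f x + of_real (flux_w x) * pd 2 f x
     else of_real (-2 * Im (m x) * flux_s x) * horizontal f x + of_real (flux_w x) * pd 3 f x)"

lemma flux_s_Ck1: "Ck (Suc 0) flux_s"
proof -
  have "2 * sig x * kappa (x$1) \<noteq> 0" for x using sig_pos[of x] kappa_pos[of "x$1"] by simp
  then show ?thesis unfolding flux_s_def[abs_def]
    by (intro Ck1_mult Ck1_inverse vol_density_Ck1 sig_Ck1 Ck1_const Ck1_first kappa_Ck1)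
qed

lemma flux_w_Ck1: "Ck (Suc 0) flux_w"
proof -
  have "(rho (x$1))^2 \<noteq> 0" for x :: "real^3" using rho_pos[of "x$1"] by simp
  then show ?thesis unfolding flux_w_def[abs_def]
    by (intro Ck1_mult Ck1_inverse vol_density_Ck1 sig_Ck1 Ck1_const Ck1_power2 Ck1_first rho_Ck1)
qed

lemma flux_Ck1:
  assumes "smooth f"
  shows "Ck (Suc 0) (flux f i)"
proof -
  have e: "horizontal f = (\<lambda>x. pd 1 f x + (-2) * of_real (Re (m x)) * pd 2 f x + (-2) * of_real (Im (m x)) * pd 3 f x)"
    by (auto simp: horizontal_def)
  have 1: "Ck (Suc 0) (horizontal f)"
    unfolding e by (intro Ck1_add Ck1_mult Ck1_const Ck1_of_real m_Ck1 Ck1_pd assms)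
  have "Ck (Suc 0) (\<lambda>x. of_real (flux_s x) * horizontal f x)"
    by (intro Ck1_mult Ck1_of_real flux_s_Ck1 1)
  moreover have "Ck (Suc 0) (\<lambda>x. of_real (-2 * Re (m x) * flux_s x) * horizontal f x + of_real (flux_w x) * pd 2 f x)"
    by (intro Ck1_add Ck1_mult Ck1_of_real flux_s_Ck1 flux_w_Ck1 1 Ck1_const m_Ck1 Ck1_pd assms)
  moreover have "Ck (Suc 0) (\<lambda>x. of_real (-2 * Im (m x) * flux_s x) * horizontal f x + of_real (flux_w x) * pd 3 f x)"
    by (intro Ck1_add Ck1_mult Ck1_of_real flux_s_Ck1 flux_w_Ck1 1 Ck1_const m_Ck1 Ck1_pd assms)
  ultimately show ?thesis unfolding flux_def[abs_def] by (cases "i = 1"; cases "i = 2") (simp_all only: if_True if_False simp_thms)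
qed

lemma grad_eq:
  assumes "x \<in> off_axis"
  shows "of_real (sqrt (det (induced_metric t A c x))) * grad_coord (induced_metric t A c) f x $ i = flux f i x"
proof -
  define P Q where "P = 1 / (2 * sig x * kappa (x$1))" and "Q = 2 * sig x / (rho (x$1))\<^sup>2"
  have h: "gram_inv x = vector [
     vector [P, -2 * Re (m x) * P, -2 * Im (m x) * P],
     vector [-2 * Re (m x) * P, 4 * (Re (m x))^2 * P + Q, 4 * Re (m x) * Im (m x) * P],
     vector [-2 * Im (m x) * P, 4 * Re (m x) * Im (m x) * P, 4 * (Im (m x))^2 * P + Q]]" (is "_ = ?h")
    by (simp add: gram_inv_def P_def Q_def Let_def)
  have d: "flux_s x = vol_density x * P" "flux_w x = vol_density x * Q"
    by (simp_all only: flux_s_def flux_w_def P_def Q_def divide_inverse mult_1_left)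
  show ?thesis
    unfolding grad_coord_def induced_metric_eq[OF assms] gram_matrix_inv vol_density_eq[symmetric] h
    using exhaust_3[of i]
  proof (elim disjE)
    assume "i = 1"
    then show "complex_of_real (vol_density x) * (\<chi> i. \<Sum>j\<in>UNIV. of_real (?h $ i $ j) * pd j f x) $ i = flux f i x"
      by (simp add: sum_3 flux_def horizontal_def d algebra_simps)
  next
    assume "i = 2"
    then show "complex_of_real (vol_density x) * (\<chi> i. \<Sum>j\<in>UNIV. of_real (?h $ i $ j) * pd j f x) $ i = flux f i x"
      by (simp add: sum_3 flux_def horizontal_def d algebra_simps power2_eq_square)
  next
    assume "i = 3"
    then show "complex_of_real (vol_density x) * (\<chi> i. \<Sum>j\<in>UNIV. of_real (?h $ i $ j) * pd j f x) $ i = flux f i x"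
      by (simp add: sum_3 flux_def horizontal_def d algebra_simps power2_eq_square)
  qed
qed

text \<open>The formula for the gradient is available only on \<open>off_axis\<close>, but this set
  is open, so the derivatives of the two sides agree there too.\<close>

lemma laplacian_eq:
  assumes "x \<in> off_axis" "smooth f"
  shows "div_coord (induced_metric t A c) (grad_coord (induced_metric t A c) f) x = (\<Sum>i\<in>UNIV. pd i (flux f i) x) / of_real (vol_density x)"
proof -
  have "pd i (\<lambda>y. of_real (sqrt (det (induced_metric t A c y))) * grad_coord (induced_metric t A c) f y $ i) x = pd i (flux f i) x" for i
    by (rule pd_cong_open[where U=off_axis])
      (use open_off_axis assms grad_eq Ck1_differentiable[OF flux_Ck1[OF assms(2)]] in \<open>auto simp: off_axis_def\<close>)
  then show ?thesis unfolding div_coord_def by (simp add: induced_metric_eq[OF assms(1)] vol_density_eq)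
qed

section \<open>Periodicity along the curve\<close>

lemma periodic:
  "rho (s + L) = rho s" "c1 (s + L) = c1 s" "kappa (s + L) = kappa s" "curve_weight (s + L) = curve_weight s"
proof -
  show r: "rho (s + L) = rho s" by (simp add: rho_def c_periodic)
  have "((\<lambda>s. c (s + L)) has_vector_derivative c1 (s + L)) (at s)"
  proof -
    have "((\<lambda>s. s + L) has_vector_derivative 1) (at s)"
      by (auto simp: has_vector_derivative_def intro!: derivative_eq_intros)
    from vector_diff_chain_at[OF this c_deriv[of "s + L"]] show ?thesis by (simp add: o_def)
  qed
  then have "(c has_vector_derivative c1 (s + L)) (at s)" by (simp add: c_periodic)
  then show c: "c1 (s + L) = c1 s" unfolding c1_def[of s] by (simp add: vector_derivative_at)
  show k: "kappa (s + L) = kappa s" by (simp add: kappa_def c r)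
  show "curve_weight (s + L) = curve_weight s" by (simp add: curve_weight_def k r)
qed

lemma periodic3:
  "xi (x + axis 1 L) = xi x" "m (x + axis 1 L) = m x" "sig (x + axis 1 L) = sig x" "vol_density (x + axis 1 L) = vol_density x" 
  "flux_s (x + axis 1 L) = flux_s x" "flux_w (x + axis 1 L) = flux_w x"
proof -
  have a: "axis 1 L $ (1::3) = L" "axis 1 L $ (2::3) = 0" "axis 1 L $ (3::3) = 0"
    by (auto simp: axis_def)
  show xi: "xi (x + axis 1 L) = xi x" by (simp add: xi_def a periodic)
  show "m (x + axis 1 L) = m x" by (simp add: m_def a periodic c_periodic)
  show sig: "sig (x + axis 1 L) = sig x" by (simp add: sig_def xi)
  show vol_density: "vol_density (x + axis 1 L) = vol_density x" by (simp add: vol_density_def xi a periodic)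
  show "flux_s (x + axis 1 L) = flux_s x" "flux_w (x + axis 1 L) = flux_w x" by (simp_all add: flux_s_def flux_w_def sig vol_density a periodic)
qed

lemma flux_periodic:
  assumes "smooth f" "\<And>x. f (x + axis 1 L) = f x"
  shows "flux f i (x + axis 1 L) = flux f i x"
proof -
  have "pd j f (x + axis 1 L) = pd j f x" for j
    using pd_shift[OF smooth_differentiable[OF assms(1)], of j "axis 1 L" x] by (simp add: assms(2))
  then show ?thesis by (simp add: flux_def horizontal_def periodic3)
qed

lemma sqrt_sig_deriv:
  assumes "z \<ge> 0"
  shows "(sqrt_sig has_real_derivative inverse (sqrt_sig z ^ 3) / 4) (at z)"
proof -
  have p: "z + t^4 > 0" using assms t by (simp add: add_nonneg_pos)
  have q: "sqrt (z + t^4) + 0 > 0" using p by simp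
  have e: "sqrt (z + t^4) = (sqrt_sig z)^2" "sqrt (sqrt (z + t^4)) = sqrt_sig z" using p by (simp_all add: sqrt_sig_def)
  have 1: "(sqrt has_real_derivative 1 / (2 * sqrt_sig z)) (at (sqrt (z + t^4)))"
    using DERIV_sqrt_add[OF q] by (simp only: add_0_right e(2))
  have 2: "((\<lambda>z. sqrt (z + t^4)) has_real_derivative 1 / (2 * (sqrt_sig z)^2)) (at z)"
    using DERIV_sqrt_add[OF p] by (simp only: e(1))
  have "((\<lambda>z. sqrt (sqrt (z + t^4))) has_real_derivative inverse (sqrt_sig z ^ 3) / 4) (at z)"
    by (rule DERIV_cong[OF DERIV_chain2[OF 1 2]])
      (use sqrt_sig_pos[OF assms] in \<open>simp add: field_simps power2_eq_square power3_eq_cube\<close>)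
  moreover have "sqrt_sig = (\<lambda>z. sqrt (sqrt (z + t^4)))" by (simp add: sqrt_sig_def fun_eq_iff)
  ultimately show ?thesis by (simp only:)
qed

text \<open>Since rho >= 1, u_1^2 dominates the squared fibre norm. A function of \<open>xi\<close>
  that vanishes above \<open>M\<close> is thus supported in one bounded region of the fibre for all
  curve parameters.\<close>

lemma xi_gt:
  assumes "\<bar>x$2\<bar> > \<bar>M\<bar> + 1 \<or> \<bar>x$3\<bar> > \<bar>M\<bar> + 1"
  shows "xi x > M"
  proof -
    have "\<bar>M\<bar> + 1 \<le> (\<bar>M\<bar> + 1)^2" by (simp add: power2_eq_square algebra_simps)
    also have "\<dots> \<le> (x$2)^2 + (x$3)^2"
      using assms
    proof
      assume "\<bar>x$2\<bar> > \<bar>M\<bar> + 1"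
      then have "(\<bar>M\<bar> + 1)^2 \<le> \<bar>x$2\<bar>^2" by (intro power_mono) auto
      then show ?thesis by (simp add: add_increasing2)
    next
      assume "\<bar>x$3\<bar> > \<bar>M\<bar> + 1"
      then have "(\<bar>M\<bar> + 1)^2 \<le> \<bar>x$3\<bar>^2" by (intro power_mono) auto
      then show ?thesis by (simp add: add_increasing)
    qed
    also have "\<dots> \<le> xi x"
    proof -
      have "1 \<le> (rho (x$1))^2" using inner_ge_zero[of "c (x$1)"] by (simp add: rho_def)
      then show ?thesis unfolding xi_def using mult_left_mono[of 1 "(rho (x$1))^2" "(x$2)^2 + (x$3)^2"] by simp
    qed
    finally show ?thesis by linarith
  qed

text \<open>\<open>F\<close> is Green's field X grad f - f grad X times the density. The gradient of
  X (u_1^2) has no curve component, because the horizontal direction annihilates u_1: its flux is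
  (0, x B, y B), and the bracket on the right is the divergence of this field divided by the
  density. Bounded support in the fibre is supplied by X, and periodicity handles the ends of the
  strip.\<close>

lemma green_radial:
  fixes f :: "real^3 \<Rightarrow> complex" and X X' X'' :: "real \<Rightarrow> real"
  assumes f: "smooth f" and per: "\<And>x. f (x + axis 1 L) = f x"
    and X: "\<And>z. (X has_real_derivative X' z) (at z)" "\<And>z. (X' has_real_derivative X'' z) (at z)" "continuous_on UNIV X''"
    and supp: "\<And>z. z > M \<Longrightarrow> X z = 0 \<and> X' z = 0 \<and> X'' z = 0"
  shows "(\<integral>x. indicator (param_box L) x *\<^sub>R ((\<Sum>i\<in>UNIV. pd i (flux f i) x) * of_real (X (xi x))) \<partial>lborel)
    = (\<integral>x. indicator (param_box L) x *\<^sub>R (f x * of_real (vol_density x * (8 * sig x * X' (xi x) + 2 * xi x * X' (xi x) / sig x + 8 * xi x * sig x * X'' (xi x)))) \<partial>lborel)"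
proof -
  \<comment> \<open>Determined by \<open>flux_w x * X' (xi x) * pd i xi x = x$i * B x\<close> for
    the fibre coordinates: rho^2 cancels, and \<open>vol_density x * sig x\<close> is
    \<open>curve_weight (x$1) * sqrt_sig (xi x)\<close>.\<close>
  define bt where "bt z = 4 * sqrt_sig z * X' z" for z
  define bt' where "bt' z = X' z * inverse (sqrt_sig z ^ 3) + 4 * sqrt_sig z * X'' z" for z
  define B where "B x = curve_weight (x$1) * bt (xi x)" for x
  have bt: "(bt has_real_derivative bt' z) (at z)" if "z \<ge> 0" for z
    unfolding bt_def[abs_def] bt'_def using DERIV_mult[OF DERIV_cmult[OF sqrt_sig_deriv[OF that], of 4] X(2)[of z]]
    by (simp add: algebra_simps)
  have xc: "continuous_on UNIV xi" by (rule Ck1_continuous[OF xi_Ck1])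
  have rc: "continuous_on UNIV (\<lambda>x. sqrt_sig (xi x))" by (rule Ck1_continuous[OF sqrt_sig_Ck1])
  have X'c: "continuous_on UNIV X'" using X(2) DERIV_continuous continuous_at_imp_continuous_on by blast
  have cc: "continuous_on UNIV (\<lambda>x. X' (xi x))" "continuous_on UNIV (\<lambda>x. X'' (xi x))"
    by (auto intro: continuous_on_compose2[OF X'c xc] continuous_on_compose2[OF X(3) xc])
  have btC: "Ck (Suc 0) (\<lambda>x. bt (xi x))"
  proof (rule Ck1_compose_real[OF xi_Ck1 bt[OF xi_nonneg]])
    have "sqrt_sig (xi x) ^ 3 \<noteq> 0" for x using sqrt_sig_pos[OF xi_nonneg, of x] by simp
    then show "continuous_on UNIV (\<lambda>x. bt' (xi x))"
      unfolding bt'_def by (intro continuous_intros cc rc) auto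
  qed
  have BC: "Ck (Suc 0) B" unfolding B_def[abs_def] by (intro Ck1_mult Ck1_first curve_weight_Ck1 btC)
  have PhiC: "Ck (Suc 0) (\<lambda>x. X (xi x))" by (rule Ck1_compose_real[OF xi_Ck1 X(1) cc(1)])
  note D = Ck1_differentiable
  note supp3 = xi_gt[of M]
  define F where "F i x = flux f i x * of_real (X (xi x)) - (if i = 1 then 0 else f x * of_real (x$i * B x))" for i :: 3 and x
  have C1: "Ck (Suc 0) (\<lambda>x. flux f i x * of_real (X (xi x)))" for i
    by (intro Ck1_mult flux_Ck1 f Ck1_of_real PhiC)
  have C2: "Ck (Suc 0) (\<lambda>x. x$i * B x)" for i
    by (intro Ck1_mult Ck1_vec_nth BC)
  have C3: "Ck (Suc 0) (\<lambda>x. f x * of_real (x$i * B x))" for i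
    by (intro Ck1_mult Ck1_of_real C2 smooth_Ck1[OF f] Ck1_vec_nth BC)
  have FC: "Ck (Suc 0) (F i)" for i
    unfolding F_def[abs_def] using C1[of i] Ck1_diff[OF C1[of i] C3[of i]] by (cases "i = 1") simp_all
  have Fint: "integrable lborel (\<lambda>x. indicator (param_box L) x *\<^sub>R pd i (F i) x)"
     "(\<integral>x. indicator (param_box L) x *\<^sub>R pd i (F i) x \<partial>lborel) = 0" for i
  proof -
    have 1: "F i x = 0" if "\<bar>x$2\<bar> > \<bar>M\<bar> + 1 \<or> \<bar>x$3\<bar> > \<bar>M\<bar> + 1" for x
      using supp[OF supp3[OF that]] by (simp add: F_def B_def bt_def)
    have a: "axis 1 L $ (1::3) = L" by (simp add: axis_def)
    have a': "axis 1 L $ i = 0" if "i \<noteq> 1" for i :: 3 using that by (simp add: axis_def)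
    have 2: "F i (x + axis 1 L) = F i x" for x
      by (simp add: F_def B_def flux_periodic[OF f per] per periodic periodic3 a a')
    note * = integral_box_pd[OF FC[of i] 1 2 L_pos]
    show "integrable lborel (\<lambda>x. indicator (param_box L) x *\<^sub>R pd i (F i) x)"
     "(\<integral>x. indicator (param_box L) x *\<^sub>R pd i (F i) x \<partial>lborel) = 0" by (rule *; assumption)+
  qed
  define Q where "Q x = f x * of_real (vol_density x * (8 * sig x * X' (xi x) + 2 * xi x * X' (xi x) / sig x + 8 * xi x * sig x * X'' (xi x)))" for x
  have id: "(\<Sum>i\<in>UNIV. pd i (F i) x) = (\<Sum>i\<in>UNIV. pd i (flux f i) x) * of_real (X (xi x)) - Q x" for x
  proof -
    define z where "z = xi x"
    have r: "sqrt_sig z > 0" unfolding z_def by (rule sqrt_sig_pos[OF xi_nonneg])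
    have sig: "sig x = (sqrt_sig z)^2" by (simp add: sig_eq_sqrt_sig z_def)
    have Dx: "vol_density x = curve_weight (x$1) * inverse (sqrt_sig z)" by (simp add: vol_density_def z_def)
    have 1: "pd i (\<lambda>x. flux f i x * of_real (X (xi x))) x = flux f i x * of_real (X' z * pd i xi x) + pd i (flux f i) x * of_real (X z)" for i
      using pd_mult[OF D[OF flux_Ck1[OF f]] D[OF Ck1_of_real[OF PhiC]]] 
      by (simp add: pd_of_real[OF D[OF PhiC]] pd_compose_real[OF D[OF xi_Ck1] X(1)] z_def)
    have 2: "pd i B x = curve_weight (x$1) * (bt' z * pd i xi x)" if "i \<noteq> 1" for i
    proof -
      have "pd i (\<lambda>x. curve_weight (x$1)) x = 0"
      proof -
        have "((\<lambda>x::real^3. curve_weight (x$1)) has_derivative (\<lambda>h. frechet_derivative curve_weight (at (x$1)) (h$1))) (at x)"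
          by (rule has_derivative_compose[OF has_derivative_vec_nth_id Ck1D(1)[OF curve_weight_Ck1]])
        then show ?thesis using that has_derivative_linear[OF Ck1D(1)[OF curve_weight_Ck1], THEN linear_0]
          by (simp add: pd_eqI axis_def)
      qed
      then show ?thesis unfolding B_def[abs_def] z_def
        by (simp only: pd_mult_real[OF D[OF Ck1_first[OF curve_weight_Ck1]] D[OF btC]] pd_compose_real[OF D[OF xi_Ck1] bt[OF xi_nonneg]]
            mult_zero_left add_0_right)
    qed
    have 3: "pd i (\<lambda>x. f x * of_real (x$i * B x)) x = f x * of_real (x$i * (curve_weight (x$1) * (bt' z * pd i xi x)) + B x) + pd i f x * of_real (x$i * B x)" if "i \<noteq> 1" for i
    proof -
      have "pd i (\<lambda>x. x$i * B x) x = x$i * (curve_weight (x$1) * (bt' z * pd i xi x)) + B x"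
        by (simp only: pd_mult_real[OF D[OF Ck1_vec_nth[of i]] D[OF BC]] pd_nth 2[OF that] refl if_True mult_1_left)
      then show ?thesis
        by (simp only: pd_mult[OF D[OF smooth_Ck1[OF f]] D[OF Ck1_of_real[OF C2]]] pd_of_real[OF D[OF C2]])
    qed
    have 4: "pd 1 (F 1) x = flux f 1 x * of_real (X' z * pd 1 xi x) + pd 1 (flux f 1) x * of_real (X z)"
      using 1[of 1] by (simp add: F_def[abs_def])
    have 5: "pd i (F i) x = flux f i x * of_real (X' z * pd i xi x) + pd i (flux f i) x * of_real (X z)
       - (f x * of_real (x$i * (curve_weight (x$1) * (bt' z * pd i xi x)) + B x) + pd i f x * of_real (x$i * B x))" if "i \<noteq> 1" for i
      unfolding F_def[abs_def] using that 1[of i] 3[OF that] pd_diff[OF D[OF C1[of i]] D[OF C3[of i]], of i] by simp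
    \<comment> \<open>With this substitution all terms with \<open>flux_s\<close> cancel, and only
      the vertical flux is paired with the differential of \<open>xi\<close>.\<close>
    have rot: "pd 1 xi x = 2 * Re (m x) * pd 2 xi x + 2 * Im (m x) * pd 3 xi x"
      using xi_rotation[of x] by simp
    have "flux f 1 x * of_real (X' z * pd 1 xi x) + flux f 2 x * of_real (X' z * pd 2 xi x) + flux f 3 x * of_real (X' z * pd 3 xi x)
       = of_real (flux_w x * X' z) * (pd 2 f x * of_real (pd 2 xi x) + pd 3 f x * of_real (pd 3 xi x))"
      unfolding rot by (simp add: flux_def algebra_simps)
    also have "\<dots> = pd 2 f x * of_real (x$2 * B x) + pd 3 f x * of_real (x$3 * B x)"
    proof -
      have "flux_w x * X' z * pd i xi x = x$i * B x" if "i = 2 \<or> i = 3" for i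
        using that r rho_pos[of "x$1"] unfolding flux_w_def B_def bt_def z_def[symmetric] Dx sig
        by (auto simp: pd_xi field_simps power2_eq_square)
      from this[of 2] this[of 3] show ?thesis by (simp add: algebra_simps flip: of_real_mult)
    qed
    finally have 6: "flux f 1 x * of_real (X' z * pd 1 xi x) + flux f 2 x * of_real (X' z * pd 2 xi x) + flux f 3 x * of_real (X' z * pd 3 xi x)
       = pd 2 f x * of_real (x$2 * B x) + pd 3 f x * of_real (x$3 * B x)" .
    \<comment> \<open>Euler's identity: \<open>xi\<close> is homogeneous of degree 2 in the
      fibre.\<close>
    have e: "x$2 * pd 2 xi x + x$3 * pd 3 xi x = 2 * z"
      by (simp add: pd_xi z_def xi_def algebra_simps power2_eq_square)
    have 7: "x$2 * (curve_weight (x$1) * (bt' z * pd 2 xi x)) + B x + (x$3 * (curve_weight (x$1) * (bt' z * pd 3 xi x)) + B x)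
        = vol_density x * (8 * sig x * X' z + 2 * z * X' z / sig x + 8 * z * sig x * X'' z)"
    proof -
      have "x$2 * (curve_weight (x$1) * (bt' z * pd 2 xi x)) + B x + (x$3 * (curve_weight (x$1) * (bt' z * pd 3 xi x)) + B x)
        = curve_weight (x$1) * (bt' z * (x$2 * pd 2 xi x + x$3 * pd 3 xi x) + 2 * bt z)"
        by (simp add: B_def z_def algebra_simps)
      also have "\<dots> = vol_density x * (8 * sig x * X' z + 2 * z * X' z / sig x + 8 * z * sig x * X'' z)"
        unfolding e Dx sig bt_def bt'_def using r by (simp add: field_simps power2_eq_square power3_eq_cube)
      finally show ?thesis .
    qed
    have Qz: "Q x = f x * of_real (x$2 * (curve_weight (x$1) * (bt' z * pd 2 xi x)) + B x + (x$3 * (curve_weight (x$1) * (bt' z * pd 3 xi x)) + B x))"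
      unfolding 7 by (simp add: Q_def z_def)
    have "(\<Sum>i\<in>UNIV. pd i (F i) x) = (flux f 1 x * of_real (X' z * pd 1 xi x) + flux f 2 x * of_real (X' z * pd 2 xi x) + flux f 3 x * of_real (X' z * pd 3 xi x))
        + (\<Sum>i\<in>UNIV. pd i (flux f i) x) * of_real (X z) - Q x - (pd 2 f x * of_real (x$2 * B x) + pd 3 f x * of_real (x$3 * B x))"
      unfolding sum_3 4 5[of 2, simplified] 5[of 3, simplified] Qz by (simp add: algebra_simps)
    then show ?thesis unfolding 6 by (simp add: z_def)
  qed
  have Sc: "continuous_on UNIV sig" "sig x \<noteq> 0" for x using Ck1_continuous[OF sig_Ck1] sig_pos[of x] by auto
  have Qi: "integrable lborel (\<lambda>x. indicator (param_box L) x *\<^sub>R Q x)"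
    unfolding param_box_def
  proof (rule integrable_strip)
    show "continuous_on UNIV Q"
      unfolding Q_def[abs_def] using Sc
      by (intro continuous_intros cc xc Ck1_continuous[OF smooth_Ck1[OF f]] Ck1_continuous[OF vol_density_Ck1]) auto
    show "Q x = 0" if "\<bar>x$2\<bar> > \<bar>M\<bar> + 1 \<or> \<bar>x$3\<bar> > \<bar>M\<bar> + 1" for x
      using supp[OF supp3[OF that]] by (simp add: Q_def)
  qed
  have Si: "integrable lborel (\<lambda>x. \<Sum>i\<in>UNIV. indicator (param_box L) x *\<^sub>R pd i (F i) x)"
    using Fint(1) by (intro Bochner_Integration.integrable_sum) auto
  have "(\<integral>x. indicator (param_box L) x *\<^sub>R ((\<Sum>i\<in>UNIV. pd i (flux f i) x) * of_real (X (xi x))) \<partial>lborel)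
     = (\<integral>x. (\<Sum>i\<in>UNIV. indicator (param_box L) x *\<^sub>R pd i (F i) x) + indicator (param_box L) x *\<^sub>R Q x \<partial>lborel)"
    by (intro Bochner_Integration.integral_cong refl) (simp add: scaleR_sum_right[symmetric] id algebra_simps)
  also have "\<dots> = (\<integral>x. indicator (param_box L) x *\<^sub>R Q x \<partial>lborel)"
  proof -
    have "(\<integral>x. (\<Sum>i\<in>UNIV. indicator (param_box L) x *\<^sub>R pd i (F i) x) \<partial>lborel)
      = (\<Sum>i\<in>UNIV. \<integral>x. indicator (param_box L) x *\<^sub>R pd i (F i) x \<partial>lborel)"
      by (rule Bochner_Integration.integral_sum) (rule Fint(1))
    also have "\<dots> = 0" by (simp only: Fint(2) sum.neutral_const)
    finally show ?thesis using Bochner_Integration.integral_add[OF Si Qi] by (simp only: add_0_left)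
  qed
  finally show ?thesis unfolding Q_def .
qed

end

section \<open>The volume measure\<close>

text \<open>Open sets of the quotient are tested by their preimages in \<open>total_space\<close>,
  where u_1 is the continuous function \<open>?u\<close>.\<close>

lemma measurable_EH_u1 [measurable]: "EH_u1 \<in> borel_measurable borel"
proof (rule borel_measurableI)
  fix U :: "real set" assume "open U"
  let ?u = "\<lambda>v. sqrt (u1_sq v)"
  have "continuous_on UNIV ?u" unfolding u1_sq_def base_norm_sq_def by (intro continuous_intros)
  then have "open (total_space \<inter> ?u -` U)"
    using \<open>open U\<close> by (intro open_Int open_total_space open_vimage)
  moreover have "{v \<in> total_space. abs_EH v \<in> EH_u1 -` U} = total_space \<inter> ?u -` U"
    by (auto simp: EH_u1_abs)
  ultimately have "open (EH_u1 -` U)" by (simp add: open_EH_def)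
  then show "EH_u1 -` U \<inter> space borel \<in> sets borel" by simp
qed

context eh_curve
begin

abbreviation "N \<equiv> volume_measure t A c L"

lemma param_periodic: "param A c (x + axis 1 L) = param A c x"
proof -
  have "param_lift A c (x + axis 1 L) = param_lift A c x"
    by (simp add: param_lift_def axis_def c_periodic)
  then show ?thesis by (simp add: param_def)
qed

lemma param_in_M3: "param A c x \<in> M3_curve A c"
  using EH_proj_param[OF unit, of c x] unfolding M3_curve_def M3_def by blast

lemma EH_u1_param: "(EH_u1 (param A c x))^2 = xi x"
  unfolding param_def EH_u1_abs[OF param_lift_total_space[OF unit]] norm_param by (simp add: xi_nonneg)

lemma measurable_param: "param A c \<in> borel \<rightarrow>\<^sub>M restrict_space borel (M3_curve A c)"
proof (rule measurable_restrict_space2)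
  have "continuous_on UNIV (param_lift A c)"
    by (intro continuous_at_imp_continuous_on ballI has_derivative_continuous[OF param_lift_has_derivative])
  then show "param A c \<in> borel_measurable borel"
  proof (intro borel_measurableI)
    fix U :: "EH set" assume "open U"
    then have "open {v \<in> total_space. abs_EH v \<in> U}" by (simp add: open_EH_def)
    then have "open (param_lift A c -` {v \<in> total_space. abs_EH v \<in> U})"
      using \<open>continuous_on UNIV (param_lift A c)\<close> by (intro open_vimage)
    moreover have "param_lift A c -` {v \<in> total_space. abs_EH v \<in> U} = param A c -` U"
      using param_lift_total_space[OF unit] by (auto simp: param_def)
    ultimately show "param A c -` U \<inter> space borel \<in> sets borel" by simp
  qed
qed (simp add: param_in_M3)

lemma AE_off_axis: "AE x in lebesgue. x \<in> off_axis"
proof -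
  \<comment> \<open>The axis lies in the hyperplane \<open>x$2 = 0\<close>, which is already
    negligible.\<close>
  have "negligible {x::real^3. x$2 = 0}" by (rule negligible_standard_hyperplane_cart)
  then have "AE x in lebesgue. x \<notin> {x::real^3. x$2 = 0}" 
    by (intro AE_not_in) (simp add: negligible_iff_null_sets)
  then show ?thesis by eventually_elim (simp add: off_axis_def)
qed

lemma box_sets [measurable]: "param_box L \<in> sets borel"
proof -
  have [measurable]: "(\<lambda>x::real^3. x$1) \<in> borel_measurable borel"
    by (intro borel_measurable_continuous_onI continuous_intros)
  show ?thesis unfolding param_box_def by measurable
qed

lemma vol_density_measurable [measurable]: "vol_density \<in> borel_measurable borel"
  by (rule borel_measurable_continuous_onI[OF Ck1_continuous[OF vol_density_Ck1]])

lemma xi_measurable [measurable]: "xi \<in> borel_measurable borel"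
  by (rule borel_measurable_continuous_onI[OF Ck1_continuous[OF xi_Ck1]])

lemma AE_density: "AE x in lebesgue. sqrt (det (induced_metric t A c x)) = vol_density x"
  using AE_off_axis by eventually_elim (simp add: induced_metric_eq vol_density_eq)

lemma sets_N: "sets N = sets (restrict_space borel (M3_curve A c))" and space_N: "space N = M3_curve A c"
  by (simp_all add: volume_measure_def space_restrict_space)

lemma measurable_param_comp:
  assumes "g \<in> borel_measurable N"
  shows "(\<lambda>x. g (param A c x)) \<in> borel_measurable borel"
  using assms unfolding measurable_cong_sets[OF sets_N refl] by (rule measurable_compose[OF measurable_param])

text \<open>The measure is built from a completed Lebesgue measure and the determinant of a metric
  left implicit on the zero section. Almost everywhere equality replaces them by
  \<open>lborel\<close> and the continuous \<open>vol_density\<close>.\<close>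

lemma N_integral:
  fixes g :: "EH \<Rightarrow> 'b::euclidean_space"
  assumes g: "g \<in> borel_measurable N"
  shows "integral\<^sup>L N g = (\<integral>x. indicator (param_box L) x *\<^sub>R (vol_density x *\<^sub>R g (param A c x)) \<partial>lborel)"
    and "integrable N g \<longleftrightarrow> integrable lborel (\<lambda>x. indicator (param_box L) x *\<^sub>R (vol_density x *\<^sub>R g (param A c x)))"
proof -
  define d where "d x = sqrt (det (induced_metric t A c x))" for x
  let ?M = "lebesgue_on (param_box L)"
  have box: "param_box L \<inter> space lebesgue \<in> sets lebesgue" by simp
  have "vol_density \<in> borel_measurable lebesgue" by (rule measurable_completion) measurable
  \<comment> \<open>On the axis \<open>d\<close> involves the limit of the metric, so its
    measurability is inferred from almost everywhere equality with \<open>vol_density\<close>; this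
    uses the completed measure.\<close>
  then have dm: "d \<in> borel_measurable lebesgue"
    by (rule borel_measurable_AE) (use AE_density in \<open>auto simp: d_def\<close>)
  have d: "d \<in> borel_measurable ?M" using dm by (rule measurable_restrict_space1)
  have dDD: "AE x in ?M. d x = vol_density x"
    using AE_density unfolding AE_restrict_space_iff[OF box] d_def by eventually_elim simp
  then have d0: "AE x in ?M. 0 \<le> d x" by eventually_elim (simp add: vol_density_pos less_imp_le)
  have gp: "(\<lambda>x. g (param A c x)) \<in> borel_measurable borel" by (rule measurable_param_comp[OF g])
  then have gp': "(\<lambda>x. g (param A c x)) \<in> borel_measurable ?M"
    by (intro measurable_restrict_space1 measurable_completion) simp
  have g': "g \<in> borel_measurable (restrict_space borel (M3_curve A c))"
    using g unfolding measurable_cong_sets[OF sets_N refl] .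
  have pm: "param A c \<in> density ?M d \<rightarrow>\<^sub>M restrict_space borel (M3_curve A c)"
    unfolding measurable_cong_sets[OF sets_density refl]
    by (intro measurable_restrict_space1 measurable_completion) (use measurable_param in simp)
  have N: "N = distr (density ?M d) (restrict_space borel (M3_curve A c)) (param A c)"
    by (simp add: volume_measure_def d_def)
  have m1: "(\<lambda>x. d x *\<^sub>R g (param A c x)) \<in> borel_measurable ?M" using d gp' by simp
  have DDm: "vol_density \<in> borel_measurable ?M" by (intro measurable_restrict_space1 measurable_completion) simp
  then have m2: "(\<lambda>x. vol_density x *\<^sub>R g (param A c x)) \<in> borel_measurable ?M" using gp' by simp
  have ae: "AE x in ?M. d x *\<^sub>R g (param A c x) = vol_density x *\<^sub>R g (param A c x)"
    using dDD by eventually_elim simp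
  have m3: "(\<lambda>x. indicator (param_box L) x *\<^sub>R (vol_density x *\<^sub>R g (param A c x))) \<in> borel_measurable lborel"
    using gp by simp
  have "integral\<^sup>L N g = (\<integral>x. vol_density x *\<^sub>R g (param A c x) \<partial>?M)"
    unfolding N integral_distr[OF pm g'] integral_density[OF gp' d d0]
    by (rule integral_cong_AE[OF m1 m2 ae])
  also have "\<dots> = (\<integral>x. indicator (param_box L) x *\<^sub>R (vol_density x *\<^sub>R g (param A c x)) \<partial>lborel)"
    unfolding integral_restrict_space[OF box] by (rule integral_completion[OF m3])
  finally show "integral\<^sup>L N g = (\<integral>x. indicator (param_box L) x *\<^sub>R (vol_density x *\<^sub>R g (param A c x)) \<partial>lborel)" .
  have "integrable N g \<longleftrightarrow> integrable ?M (\<lambda>x. vol_density x *\<^sub>R g (param A c x))"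
    unfolding N integrable_distr_eq[OF pm g'] integrable_density[OF gp' d d0]
    by (rule integrable_cong_AE[OF m1 m2 ae])
  also have "\<dots> \<longleftrightarrow> integrable lborel (\<lambda>x. indicator (param_box L) x *\<^sub>R (vol_density x *\<^sub>R g (param A c x)))"
    unfolding integrable_restrict_space[OF box] by (rule integrable_completion[OF m3])
  finally show "integrable N g \<longleftrightarrow> integrable lborel (\<lambda>x. indicator (param_box L) x *\<^sub>R (vol_density x *\<^sub>R g (param A c x)))" .
qed

definition radial :: "(real \<Rightarrow> real) \<Rightarrow> EH \<Rightarrow> real" where "radial k q = k ((EH_u1 q)^2)"

lemma radial_measurable:
  assumes [measurable]: "k \<in> borel_measurable borel"
  shows "radial k \<in> borel_measurable N"
  unfolding measurable_cong_sets[OF sets_N refl] radial_def[abs_def]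
  by (intro measurable_restrict_space1) measurable

lemma radial_param: "radial k (param A c x) = k (xi x)"
  by (simp add: radial_def EH_u1_param)

text \<open>The Laplacian of \<open>X (u\<^sub>1\<^sup>2)\<close> as a function of \<open>z = u\<^sub>1\<^sup>2\<close>, in terms of the derivatives of \<open>X\<close>.\<close>

definition radial_laplacian :: "(real \<Rightarrow> real) \<Rightarrow> (real \<Rightarrow> real) \<Rightarrow> real \<Rightarrow> real" where
  "radial_laplacian X' X'' z = - (8 * sqrt (z + t^4) * X' z + 2 * z * X' z / sqrt (z + t^4) + 8 * z * sqrt (z + t^4) * X'' z)"

text \<open>\<open>green_radial\<close> read on the manifold: the density of the measure cancels the
  denominator of the divergence, and the coordinate formula is used off the axis, hence almost
  everywhere.\<close>

lemma laplacian_pairing: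
  assumes X: "\<And>z. (X has_real_derivative X' z) (at z)" "\<And>z. (X' has_real_derivative X'' z) (at z)" "continuous_on UNIV X''"
    and supp: "\<And>z. z > M \<Longrightarrow> X z = 0 \<and> X' z = 0 \<and> X'' z = 0"
    and \<psi>: "\<psi> \<in> test_functions A c" "\<psi> \<in> borel_measurable N" "laplacian t A c L \<psi> \<in> borel_measurable N"
  shows "(\<integral>q. laplacian t A c L \<psi> q * of_real (radial X q) \<partial>N) = (\<integral>q. \<psi> q * of_real (radial (radial_laplacian X' X'') q) \<partial>N)"
proof -
  define f where "f = \<psi> \<circ> param A c"
  have f: "smooth f" using \<psi>(1) by (simp add: f_def test_functions_def)
  have per: "f (x + axis 1 L) = f x" for x by (simp add: f_def param_periodic)
  have X'c: "continuous_on UNIV X'" using X(2) DERIV_continuous continuous_at_imp_continuous_on by blast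
  have Xc: "continuous_on UNIV X" using X(1) DERIV_continuous continuous_at_imp_continuous_on by blast
  have Xm [measurable]: "X \<in> borel_measurable borel" "X' \<in> borel_measurable borel" "X'' \<in> borel_measurable borel"
    using X(3) X'c Xc by (auto intro: borel_measurable_continuous_onI)
  have Hm [measurable]: "radial_laplacian X' X'' \<in> borel_measurable borel" unfolding radial_laplacian_def[abs_def] by measurable
  note [measurable] = \<psi>(2,3)
  have VVc [measurable]: "pd i (flux f i) \<in> borel_measurable borel" for i
    by (rule borel_measurable_continuous_onI[OF continuous_pd[OF flux_Ck1[OF f]]])
  have lap: "laplacian t A c L \<psi> (param A c x) * of_real (vol_density x) = - (\<Sum>i\<in>UNIV. pd i (flux f i) x)"
    if "x \<in> param_box L" "x \<in> off_axis" for x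
  proof -
    \<comment> \<open>The Laplacian is evaluated through the inverse on the fundamental domain,
      which returns \<open>x\<close> for points of the box.\<close>
    have "inv_into (param_box L) (param A c) (param A c x) = x"
      using bij_betw_imp_inj_on[OF param_bij[OF curve unit]] that(1) by (rule inv_into_f_f)
    then have "laplacian t A c L \<psi> (param A c x) = - ((\<Sum>i\<in>UNIV. pd i (flux f i) x) / of_real (vol_density x))"
      using laplacian_eq[OF that(2) f] by (simp add: laplacian_def Let_def f_def)
    then show ?thesis using vol_density_pos[of x] by simp
  qed
  have mX: "radial X \<in> borel_measurable N" "radial (radial_laplacian X' X'') \<in> borel_measurable N" using radial_measurable[OF Xm(1)] radial_measurable[OF Hm] by simp_all
  have lm: "(\<lambda>x. laplacian t A c L \<psi> (param A c x)) \<in> borel_measurable borel"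
    by (rule measurable_param_comp[OF \<psi>(3)])
  have "(\<integral>q. laplacian t A c L \<psi> q * of_real (radial X q) \<partial>N) =
     (\<integral>x. indicator (param_box L) x *\<^sub>R (vol_density x *\<^sub>R (laplacian t A c L \<psi> (param A c x) * of_real (X (xi x)))) \<partial>lborel)"
    using mX by (subst N_integral(1)) (auto simp: radial_param)
  also have "\<dots> = (\<integral>x. - (indicator (param_box L) x *\<^sub>R ((\<Sum>i\<in>UNIV. pd i (flux f i) x) * of_real (X (xi x)))) \<partial>lborel)"
  proof (rule integral_cong_AE)
    have "AE x in lborel. x \<in> off_axis"
      using AE_off_axis by (simp add: AE_completion_iff)
    then show "AE x in lborel. indicator (param_box L) x *\<^sub>R (vol_density x *\<^sub>R (laplacian t A c L \<psi> (param A c x) * of_real (X (xi x)))) =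
       - (indicator (param_box L) x *\<^sub>R ((\<Sum>i\<in>UNIV. pd i (flux f i) x) * of_real (X (xi x))))"
    proof eventually_elim
      case (elim x)
      show ?case
      proof (cases "x \<in> param_box L")
        case True
        have "vol_density x *\<^sub>R (laplacian t A c L \<psi> (param A c x) * of_real (X (xi x))) = (laplacian t A c L \<psi> (param A c x) * of_real (vol_density x)) * of_real (X (xi x))"
          by (simp add: scaleR_conv_of_real)
        then show ?thesis unfolding lap[OF True elim] by simp
      qed simp
    qed
  qed (use lm in measurable)
  also have "\<dots> = - (\<integral>x. indicator (param_box L) x *\<^sub>R (f x * of_real (vol_density x * (8 * sig x * X' (xi x) + 2 * xi x * X' (xi x) / sig x + 8 * xi x * sig x * X'' (xi x)))) \<partial>lborel)"
    by (simp only: Bochner_Integration.integral_minus green_radial[OF f per X supp])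
  also have "\<dots> = (\<integral>x. indicator (param_box L) x *\<^sub>R (vol_density x *\<^sub>R (\<psi> (param A c x) * of_real (radial_laplacian X' X'' (xi x)))) \<partial>lborel)"
    unfolding Bochner_Integration.integral_minus[symmetric]
    by (intro Bochner_Integration.integral_cong refl) 
      (simp add: f_def radial_laplacian_def sig_def[symmetric] scaleR_conv_of_real algebra_simps)
  also have "\<dots> = (\<integral>q. \<psi> q * of_real (radial (radial_laplacian X' X'') q) \<partial>N)"
    using mX \<psi>(2) by (subst N_integral(1)) (auto simp: radial_param)
  finally show ?thesis .
qed

end

section \<open>Radial cut-offs\<close>

text \<open>The point 0 is the delicate one: an exponent of at least 2 makes the difference quotient
  there at most |h|^(k + 1). Exponents 3 and 2 yield the two derivatives of the cut-off.\<close>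

lemma DERIV_max_0_power:
  "((\<lambda>y::real. max 0 y ^ Suc (Suc k)) has_real_derivative real (Suc (Suc k)) * max 0 y ^ Suc k) (at y)"
proof (cases y "0::real" rule: linorder_cases)
  case less
  have "((\<lambda>y::real. 0) has_real_derivative real (Suc (Suc k)) * max 0 y ^ Suc k) (at y)"
    using less by simp
  then show ?thesis
    by (rule has_field_derivative_transform_within_open[where S="{..<0}"]) (use less in auto)
next
  case greater
  have "((\<lambda>y::real. y ^ Suc (Suc k)) has_real_derivative real (Suc (Suc k)) * y ^ Suc k) (at y)"
    by (rule DERIV_cong[OF DERIV_pow]) simp
  then have "((\<lambda>y::real. y ^ Suc (Suc k)) has_real_derivative real (Suc (Suc k)) * max 0 y ^ Suc k) (at y)"
    using greater by simp
  then show ?thesis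
    by (rule has_field_derivative_transform_within_open[where S="{0<..}"]) (use greater in \<open>auto simp: max_def\<close>)
next
  case equal
  have "(\<lambda>h::real. max 0 h ^ Suc (Suc k) / h) \<midarrow>0\<rightarrow> 0"
  proof (rule Lim_null_comparison)
    have "norm (max 0 h ^ Suc (Suc k) / h) \<le> \<bar>h\<bar> ^ Suc k" for h :: real
    proof (cases "h > 0")
      case False
      then have "max 0 h = 0" by simp
      then have "norm (max 0 h ^ Suc (Suc k) / h) = 0" by simp
      also have "\<dots> \<le> \<bar>h\<bar> ^ Suc k" by (rule zero_le_power) simp
      finally show ?thesis .
    qed (simp add: max_def)
    then show "\<forall>\<^sub>F h in at 0. norm (max 0 h ^ Suc (Suc k) / h) \<le> \<bar>h::real\<bar> ^ Suc k" by simp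
    have "(\<lambda>h::real. \<bar>h\<bar> ^ Suc k) \<midarrow>0\<rightarrow> \<bar>0\<bar> ^ Suc k" by (intro tendsto_intros)
    then show "(\<lambda>h::real. \<bar>h\<bar> ^ Suc k) \<midarrow>0\<rightarrow> 0" by simp
  qed
  then show ?thesis using equal by (simp add: DERIV_def)
qed

text \<open>The argument stands for u_1^2, so the support 1 < z < 4 is the shell 1 < u_1 < 2. The
  cube taken next is of class C^2, as Green's formula requires.\<close>

definition bump :: "real \<Rightarrow> real" where "bump z = max 0 ((z - 1) * (4 - z))"
definition cut :: "real \<Rightarrow> real" where "cut z = bump z ^ 3"
definition cut' :: "real \<Rightarrow> real" where "cut' z = 3 * bump z ^ 2 * (5 - 2 * z)"
definition cut'' :: "real \<Rightarrow> real" where "cut'' z = 6 * bump z * (5 - 2 * z)^2 - 6 * bump z ^ 2"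

lemma bump_bounds:
  "0 \<le> bump z" "bump z \<le> 3" "bump z \<noteq> 0 \<longleftrightarrow> 1 < z \<and> z < 4"
proof -
  have "(z - 1) * (4 - z) = 9/4 - (z - 5/2)^2" by (simp add: power2_eq_square field_simps)
  also have "\<dots> \<le> 3" using zero_le_power2[of "z - 5/2"] by linarith
  finally show "bump z \<le> 3" by (simp add: bump_def)
  show "0 \<le> bump z" by (simp add: bump_def)
  show "bump z \<noteq> 0 \<longleftrightarrow> 1 < z \<and> z < 4"
  proof -
    have "bump z \<noteq> 0 \<longleftrightarrow> 0 < (z - 1) * (4 - z)" unfolding bump_def by linarith
    then show ?thesis by (auto simp: zero_less_mult_iff)
  qed
qed

lemma cut_deriv: "(cut has_real_derivative cut' z) (at z)"
proof -
  have i: "((\<lambda>z. (z - 1) * (4 - z)) has_real_derivative 5 - 2 * z) (at z)"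
    by (auto intro!: derivative_eq_intros)
  show ?thesis
    unfolding cut_def[abs_def] cut'_def bump_def
    using DERIV_chain2[OF DERIV_max_0_power[of 1] i] by (simp add: numeral_3_eq_3 numeral_2_eq_2)
qed

lemma cut'_deriv: "(cut' has_real_derivative cut'' z) (at z)"
proof -
  have i: "((\<lambda>z. (z - 1) * (4 - z)) has_real_derivative 5 - 2 * z) (at z)"
    by (auto intro!: derivative_eq_intros)
  have "((\<lambda>z. bump z ^ 2) has_real_derivative 2 * bump z * (5 - 2 * z)) (at z)"
    unfolding bump_def using DERIV_chain2[OF DERIV_max_0_power[of 0] i] by (simp add: numeral_2_eq_2)
  then have "((\<lambda>z. 3 * bump z ^ 2 * (5 - 2 * z)) has_real_derivative (3 * (2 * bump z * (5 - 2 * z))) * (5 - 2 * z) + (0 - 2) * (3 * bump z ^ 2)) (at z)"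
    by (intro DERIV_mult DERIV_cmult DERIV_diff DERIV_const DERIV_cmult_Id)
  then show ?thesis
    unfolding cut'_def[abs_def] cut''_def by (simp add: algebra_simps power2_eq_square)
qed

lemma continuous_cut: "continuous_on UNIV cut" "continuous_on UNIV cut'" "continuous_on UNIV cut''"
  unfolding cut_def cut'_def cut''_def bump_def by (intro continuous_intros)+

lemma cut_zero: "\<not> (1 < z \<and> z < 4) \<Longrightarrow> cut z = 0 \<and> cut' z = 0 \<and> cut'' z = 0"
  using bump_bounds(3)[of z] by (auto simp: cut_def cut'_def cut''_def)

text \<open>On the support both \<open>bump z\<close> and \<open>\<bar>5 - 2 * z\<bar>\<close> are
  at most 3. Hence 27 = 3^3, 81 = 3 * 9 * 3 and 216 = 6 * 3 * 9 + 6 * 9.\<close>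

lemma cut_bounds: "\<bar>cut z\<bar> \<le> 27" "\<bar>cut' z\<bar> \<le> 81" "\<bar>cut'' z\<bar> \<le> 216"
proof -
  have b: "0 \<le> bump z" "bump z \<le> 3" by (rule bump_bounds)+
  have b2: "bump z ^ 2 \<le> 9" using power_mono[OF b(2) b(1), of 2] by simp
  show "\<bar>cut z\<bar> \<le> 27" using power_mono[OF b(2) b(1), of 3] b by (simp add: cut_def)
  show "\<bar>cut' z\<bar> \<le> 81"
  proof (cases "1 < z \<and> z < 4")
    case True
    then have "\<bar>5 - 2 * z\<bar> \<le> 3" by auto
    then have "bump z ^ 2 * \<bar>5 - 2 * z\<bar> \<le> 9 * 3" using b2 by (intro mult_mono) auto
    then show ?thesis by (simp add: cut'_def abs_mult)
  qed (use cut_zero in auto)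
  show "\<bar>cut'' z\<bar> \<le> 216"
  proof (cases "1 < z \<and> z < 4")
    case True
    then have "\<bar>5 - 2 * z\<bar>^2 \<le> 3^2" by (intro power_mono) auto
    then have "bump z * (5 - 2 * z)^2 \<le> 3 * 9" using b by (intro mult_mono) auto
    moreover have "0 \<le> bump z * (5 - 2 * z)^2" using b by simp
    moreover have "0 \<le> bump z ^ 2" by simp
    ultimately show ?thesis using b2 unfolding cut''_def by linarith
  qed (use cut_zero in auto)
qed

text \<open>Division by \<open>n^2\<close>, as the argument is u_1^2; the support becomes the shell
  n < u_1 < 2n.\<close>

definition cutoff where "cutoff n z = cut (z / n^2)"
definition cutoff' where "cutoff' n z = cut' (z / n^2) / n^2"
definition cutoff'' where "cutoff'' n z = cut'' (z / n^2) / n^2 / n^2"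

lemma cutoff_deriv:
  assumes "n > 0"
  shows "(cutoff n has_real_derivative cutoff' n z) (at z)" "(cutoff' n has_real_derivative cutoff'' n z) (at z)"
proof -
  have i: "((\<lambda>z. z / n^2) has_real_derivative 1 / n^2) (at z)"
    by (rule DERIV_cdivide[OF DERIV_ident])
  show "(cutoff n has_real_derivative cutoff' n z) (at z)"
    unfolding cutoff_def[abs_def] cutoff'_def using DERIV_chain2[OF cut_deriv i] by simp
  show "(cutoff' n has_real_derivative cutoff'' n z) (at z)"
    unfolding cutoff'_def[abs_def] cutoff''_def by (rule DERIV_cong[OF DERIV_cdivide[OF DERIV_chain2[OF cut'_deriv i]]]) simp
qed

lemma cutoff_continuous:
  "continuous_on UNIV (cutoff n)" "continuous_on UNIV (cutoff' n)" "continuous_on UNIV (cutoff'' n)"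
  unfolding cutoff_def cutoff'_def cutoff''_def divide_inverse
  by (intro continuous_intros continuous_on_compose2[OF continuous_cut(1)] continuous_on_compose2[OF continuous_cut(2)]
      continuous_on_compose2[OF continuous_cut(3)]; simp)+

lemma cutoff_zero:
  assumes "n > 0" "\<not> (n^2 < z \<and> z < 4 * n^2)"
  shows "cutoff n z = 0 \<and> cutoff' n z = 0 \<and> cutoff'' n z = 0"
proof -
  have "\<not> (1 < z / n^2 \<and> z / n^2 < 4)" using assms by (simp add: field_simps)
  then show ?thesis using cut_zero by (simp add: cutoff_def cutoff'_def cutoff''_def)
qed

context eh_curve
begin

section \<open>Norm estimates for the cut-offs and their Laplacians\<close>

lemma integrable_weighted:
  fixes w :: "real^3 \<Rightarrow> real"
  assumes w: "continuous_on UNIV w" and k [measurable]: "k \<in> borel_measurable borel"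
    and b: "\<And>z. \<bar>k z\<bar> \<le> C" and supp: "\<And>z. z > M \<Longrightarrow> k z = 0"
  shows "integrable lborel (\<lambda>x. indicator (param_box L) x * (w x * k (xi x)))"
proof -
  have [measurable]: "w \<in> borel_measurable borel" using w by (rule borel_measurable_continuous_onI)
  let ?a = "\<bar>M\<bar> + 1"
  let ?K = "cbox (vector [0, - ?a, - ?a]) (vector [L, ?a, ?a]) :: (real^3) set"
  have "integrable lborel (\<lambda>x. indicator ?K x *\<^sub>R (C * w x))"
    by (rule borel_integrable_compact) (auto intro!: continuous_intros continuous_on_subset[OF w])
  then show ?thesis
  proof (rule Bochner_Integration.integrable_bound)
    have "norm (indicator (param_box L) x * (w x * k (xi x))) \<le> norm (indicator ?K x *\<^sub>R (C * w x))" for x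
    proof (cases "x \<in> param_box L \<and> k (xi x) \<noteq> 0")
      case True
      have "\<not> (\<bar>x$2\<bar> > \<bar>M\<bar> + 1 \<or> \<bar>x$3\<bar> > \<bar>M\<bar> + 1)" using True xi_gt[of M x] supp by blast
      then have "x \<in> ?K" using True unfolding vec3_cbox param_box_def by auto
      moreover have "\<bar>k (xi x)\<bar> \<le> \<bar>C\<bar>" using b[of "xi x"] by linarith
      then have "\<bar>k (xi x)\<bar> * \<bar>w x\<bar> \<le> \<bar>C\<bar> * \<bar>w x\<bar>" by (intro mult_right_mono) auto
      ultimately show ?thesis using True by (simp add: abs_mult mult.commute del: mem_box_cart)
    qed auto
    then show "AE x in lborel. norm (indicator (param_box L) x * (w x * k (xi x))) \<le> norm (indicator ?K x *\<^sub>R (C * w x))" by simp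
  qed measurable
qed

lemma continuous_curve_weight: "continuous_on UNIV (\<lambda>x::real^3. curve_weight (x$1))"
  by (rule Ck1_continuous[OF Ck1_first[OF curve_weight_Ck1]])

lemma continuous_vol_density: "continuous_on UNIV vol_density"
  by (rule Ck1_continuous[OF vol_density_Ck1])

text \<open>\<open>xi\<close> is homogeneous of degree 2 in the fibre, while the box and
  \<open>curve_weight\<close> involve only the curve parameter. Dilating the fibre by
  \<open>n\<close> therefore absorbs the division by \<open>n^2\<close>.\<close>

lemma scaled_integral:
  assumes k [measurable]: "k \<in> borel_measurable borel" and n: "n > 0"
  shows "(\<integral>x. indicator (param_box L) x * (curve_weight (x$1) * k (xi x / n^2)) \<partial>lborel)
     = n^2 * (\<integral>x. indicator (param_box L) x * (curve_weight (x$1) * k (xi x)) \<partial>lborel)"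
proof -
  have [measurable]: "(\<lambda>x::real^3. curve_weight (x$1)) \<in> borel_measurable borel"
    by (rule borel_measurable_continuous_onI[OF continuous_curve_weight])
  have "xi (vector [x$1, n * x$2, n * x$3]) / n^2 = xi x" for x :: "real^3"
    using n by (simp add: xi_def power_mult_distrib field_simps)
  moreover have "indicator (param_box L) (vector [x$1, n * x$2, n * x$3] :: real^3) = (indicator (param_box L) x :: real)" for x :: "real^3"
    by (simp add: indicator_def param_box_def)
  ultimately show ?thesis
    by (subst lborel_scale3[OF _ n]) simp_all
qed

abbreviation "cutoff_laplacian n \<equiv> radial_laplacian (cutoff' n) (cutoff'' n)"

lemma cutoff_laplacian_measurable: "cutoff_laplacian n \<in> borel_measurable borel"
proof -
  have [measurable]: "cutoff' n \<in> borel_measurable borel" "cutoff'' n \<in> borel_measurable borel"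
    using cutoff_continuous by (auto intro: borel_measurable_continuous_onI)
  show ?thesis unfolding radial_laplacian_def[abs_def] by measurable
qed

lemma cutoff_laplacian_zero:
  assumes "n > 0" "\<not> (n^2 < z \<and> z < 4 * n^2)"
  shows "cutoff_laplacian n z = 0"
  using cutoff_zero[OF assms] by (simp add: radial_laplacian_def)

text \<open>The condition n >= t^2 absorbs t^4 into n^2, so the radicand lies between n^2 and 5 n^2
  <= (3n)^2.\<close>

lemma sig_range:
  assumes n: "n \<ge> 1" "n \<ge> t^2" and z: "n^2 \<le> z" "z \<le> 4 * n^2"
  shows "n \<le> sqrt (z + t^4)" "sqrt (z + t^4) \<le> 3 * n"
proof -
  have "t^4 \<le> n^2" using power_mono[OF n(2), of 2] by simp
  moreover have "0 \<le> n^2" by simp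
  ultimately have "z + t^4 \<le> (3*n)^2" using z by (simp add: power_mult_distrib)
  then show "sqrt (z + t^4) \<le> 3 * n" using n by (intro real_le_lsqrt) auto
  show "n \<le> sqrt (z + t^4)" using z by (intro real_le_rsqrt) (simp add: add_increasing2)
qed

text \<open>On the shell z is of order n^2 and the square root of order n, while each derivative of
  the cut-off costs n^(-2), so every term is O(1/n). With the bounds 3n, 4 n^2, 81 and 216 the
  constants are 8 * 3 * 81 = 1944, 2 * 4 * 81 = 648 and 8 * 4 * 3 * 216 = 20736, with sum
  23328.\<close>

lemma cutoff_laplacian_bound:
  assumes n: "n \<ge> 1" "n \<ge> t^2"
  shows "\<bar>cutoff_laplacian n z\<bar> \<le> 23328 / n"
proof (cases "n^2 < z \<and> z < 4 * n^2")
  case True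
  define s where "s = sqrt (z + t^4)"
  have s: "n \<le> s" "s \<le> 3 * n" using sig_range[OF n] True by (auto simp: s_def)
  have n0: "n > 0" using n by simp
  define a b where "a = cut' (z / n^2)" and "b = cut'' (z / n^2)"
  have ab: "\<bar>a\<bar> \<le> 81" "\<bar>b\<bar> \<le> 216" by (simp_all add: a_def b_def cut_bounds)
  have z: "0 \<le> z" "z \<le> 4 * n^2" using True zero_le_power2[of n] by linarith+
  have 1: "\<bar>8 * s * (a / n^2)\<bar> \<le> 1944 / n"
  proof -
    have "s * \<bar>a\<bar> \<le> (3 * n) * 81" using s ab n0 by (intro mult_mono) auto
    then show ?thesis using n0 s by (simp add: abs_mult field_simps power2_eq_square)
  qed
  have 2: "\<bar>2 * z * (a / n^2) / s\<bar> \<le> 648 / n"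
  proof -
    have "z * \<bar>a\<bar> \<le> (4 * n^2) * 81" using z ab by (intro mult_mono) auto
    then have "2 * z * \<bar>a\<bar> / n^2 \<le> 648" using n0 by (simp add: field_simps)
    then have "2 * z * \<bar>a\<bar> / n^2 / s \<le> 648 / n" using s n0 z by (intro frac_le) auto
    then show ?thesis using z s n0 by (simp add: abs_mult)
  qed
  have 3: "\<bar>8 * z * s * (b / n^2 / n^2)\<bar> \<le> 20736 / n"
  proof -
    have "z * s \<le> (4 * n^2) * (3 * n)" using z s n0 by (intro mult_mono) auto
    then have "(z * s) * \<bar>b\<bar> \<le> ((4 * n^2) * (3 * n)) * 216" using ab s n0 z by (intro mult_mono) auto
    then have "8 * (z * s * \<bar>b\<bar>) / (n^2 * n^2) \<le> 8 * ((4 * n^2) * (3 * n) * 216) / (n^2 * n^2)"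
      by (intro divide_right_mono mult_left_mono) auto
    also have "\<dots> = 20736 / n" using n0 by (simp add: field_simps power2_eq_square)
    finally show ?thesis using z s n0 by (simp add: abs_mult mult.assoc)
  qed
  have "\<bar>cutoff_laplacian n z\<bar> \<le> \<bar>8 * s * (a / n^2)\<bar> + \<bar>2 * z * (a / n^2) / s\<bar> + \<bar>8 * z * s * (b / n^2 / n^2)\<bar>"
  proof -
    have "\<bar>- (u + v + w)\<bar> \<le> \<bar>u\<bar> + \<bar>v\<bar> + \<bar>w\<bar>" for u v w :: real by linarith
    then show ?thesis unfolding radial_laplacian_def cutoff'_def cutoff''_def a_def b_def s_def by blast
  qed
  also have "\<dots> \<le> 1944 / n + 648 / n + 20736 / n" using 1 2 3 by linarith
  also have "\<dots> = 23328 / n" by (simp add: add_divide_distrib[symmetric])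
  finally show ?thesis .
qed (use n cutoff_laplacian_zero in auto)

text \<open>The volume density is comparable to \<open>curve_weight / \<surd>n\<close> on the shell \<open>n \<le> u\<^sub>1 \<le> 2n\<close>, so rescaling the
  fibre by \<open>n\<close> bounds all norms in terms of the following two constants.\<close>

definition cut_mass where "cut_mass = (\<integral>x. indicator (param_box L) x * (curve_weight (x$1) * (cut (xi x))^2) \<partial>lborel)"
definition shell_mass where "shell_mass = (\<integral>x. indicator (param_box L) x * (curve_weight (x$1) * indicator {1..4} (xi x)) \<partial>lborel)"

lemma cut2_measurable: "(\<lambda>z. (cut z)^2) \<in> borel_measurable borel"
  using continuous_cut(1) by (intro borel_measurable_continuous_onI continuous_intros)

lemma cut2_bound: "\<bar>(cut z)^2\<bar> \<le> 27^2"
proof -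
  have "\<bar>cut z\<bar>^2 \<le> 27^2" using cut_bounds(1)[of z] by (intro power_mono) auto
  then show ?thesis by simp
qed

text \<open>The integrand is nonnegative and is positive on the open set \<open>U\<close>. A
  vanishing integral would make \<open>U\<close> negligible, which is impossible for a nonempty open
  set.\<close>

lemma cut_mass_pos: "cut_mass > 0"
proof -
  let ?g = "\<lambda>x. indicator (param_box L) x * (curve_weight (x$1) * (cut (xi x))^2)"
  have i: "integrable lborel ?g"
    by (rule integrable_weighted[OF continuous_curve_weight cut2_measurable cut2_bound, where M=4]) (use cut_zero in auto)
  have nn: "0 \<le> ?g x" for x using curve_weight_pos[of "x$1"] by simp
  have "cut_mass \<noteq> 0"
  proof
    assume "cut_mass = 0"
    then have ae: "AE x in lborel. ?g x = 0"
      unfolding cut_mass_def by (subst (asm) integral_nonneg_eq_0_iff_AE[OF i]) (use nn in auto)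
    define U where "U = {x::real^3. 0 < x$1 \<and> x$1 < L \<and> 1 < xi x \<and> xi x < 4}"
    have oU: "open U"
      unfolding U_def by (intro open_Collect_conj open_Collect_less continuous_intros Ck1_continuous[OF xi_Ck1])
    have "AE x in lebesgue. ?g x = 0" using ae by (rule AE_completion)
    then have "AE x in lebesgue. x \<notin> U"
    proof eventually_elim
      case (elim x)
      show ?case
      proof
        assume "x \<in> U"
        then have "x \<in> param_box L" "cut (xi x) \<noteq> 0" using bump_bounds(3)[of "xi x"] by (auto simp: U_def param_box_def cut_def)
        then show False using elim curve_weight_pos[of "x$1"] by simp
      qed
    qed
    then have "negligible U"
      by (simp add: negligible_iff_null_sets completion.null_sets_iff_AE)
    \<comment> \<open>The fibre coordinate is chosen so that u_1 = 3/2, the middle of the shell,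
      hence \<open>xi\<close> takes the value 9/4.\<close>
    moreover have "vector [L/2, 3 / (2 * rho (L/2)), 0] \<in> U"
      using L_pos rho_pos[of "L/2"] by (simp add: U_def xi_def power_divide power_mult_distrib)
    ultimately show False using open_not_negligible[OF oU] by blast
  qed
  moreover have "cut_mass \<ge> 0" unfolding cut_mass_def using nn by (intro integral_nonneg_AE) auto
  ultimately show ?thesis by simp
qed

lemma shell_mass_nonneg: "shell_mass \<ge> 0"
  unfolding shell_mass_def using curve_weight_pos by (intro integral_nonneg_AE AE_I2) (simp add: less_imp_le)

lemma vol_density_range:
  assumes n: "n \<ge> 1" "n \<ge> t^2" and z: "n^2 \<le> xi x" "xi x \<le> 4 * n^2"
  shows "curve_weight (x$1) / sqrt (3 * n) \<le> vol_density x" "vol_density x \<le> curve_weight (x$1) / sqrt n"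
proof -
  have r: "sqrt n \<le> sqrt_sig (xi x)" "sqrt_sig (xi x) \<le> sqrt (3 * n)" "sqrt n > 0"
    using sig_range[OF n z] n by (auto simp: sqrt_sig_def)
  have "curve_weight (x$1) > 0" by (rule curve_weight_pos)
  then show "curve_weight (x$1) / sqrt (3 * n) \<le> vol_density x" "vol_density x \<le> curve_weight (x$1) / sqrt n"
    using r sqrt_sig_pos[OF xi_nonneg, of x] unfolding vol_density_def divide_inverse[symmetric] by (auto intro!: divide_left_mono)
qed

lemma radial_square_integrable:
  assumes [measurable]: "k \<in> borel_measurable borel" and b: "\<And>z. \<bar>k z\<bar> \<le> C" and supp: "\<And>z. z > M \<Longrightarrow> k z = 0"
  shows "integrable N (\<lambda>q. (radial k q)^2)"
    and "(\<integral>q. (radial k q)^2 \<partial>N) = (\<integral>x. indicator (param_box L) x * (vol_density x * (k (xi x))^2) \<partial>lborel)"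
    and "integrable lborel (\<lambda>x. indicator (param_box L) x * (vol_density x * (k (xi x))^2))"
proof -
  have b2: "\<bar>(k z)^2\<bar> \<le> C^2" for z
  proof -
    have "\<bar>k z\<bar>^2 \<le> C^2" using b[of z] by (intro power_mono) auto
    then show ?thesis by simp
  qed
  show i: "integrable lborel (\<lambda>x. indicator (param_box L) x * (vol_density x * (k (xi x))^2))"
    by (rule integrable_weighted[OF continuous_vol_density _ b2, where M=M]) (use supp in auto)
  have m: "(\<lambda>q. (radial k q)^2) \<in> borel_measurable N" using radial_measurable[OF assms(1)] by measurable
  show "integrable N (\<lambda>q. (radial k q)^2)" using i by (simp add: N_integral(2)[OF m] radial_param)
  show "(\<integral>q. (radial k q)^2 \<partial>N) = (\<integral>x. indicator (param_box L) x * (vol_density x * (k (xi x))^2) \<partial>lborel)"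
    by (simp add: N_integral(1)[OF m] radial_param)
qed

lemma cutoff_measurable: "cutoff n \<in> borel_measurable borel"
  by (rule borel_measurable_continuous_onI[OF cutoff_continuous(1)])

text \<open>The squared norm grows at least like n^(3/2): the fibre dilation contributes n^2 and the
  density n^(-1/2).\<close>

lemma cutoff_norm_ge:
  assumes n: "n \<ge> 1" "n \<ge> t^2"
  shows "n^2 / sqrt (3 * n) * cut_mass \<le> (\<integral>q. (radial (cutoff n) q)^2 \<partial>N)" and "integrable N (\<lambda>q. (radial (cutoff n) q)^2)"
proof -
  have n0: "n > 0" using n by simp
  have b: "\<bar>cutoff n z\<bar> \<le> 27" for z by (simp add: cutoff_def cut_bounds)
  have supp: "cutoff n z = 0" if "z > 4 * n^2" for z using cutoff_zero[OF n0, of z] that by simp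
  note R = radial_square_integrable[OF cutoff_measurable b supp]
  show "integrable N (\<lambda>q. (radial (cutoff n) q)^2)" by (rule R(1))
  have X2: "(cutoff n z)^2 = (cut (z / n^2))^2" for z by (simp add: cutoff_def)
  have i: "integrable lborel (\<lambda>x. indicator (param_box L) x * (curve_weight (x$1) * (cutoff n (xi x))^2))"
  proof (rule integrable_weighted[OF continuous_curve_weight, where C="27^2" and M="4*n^2"])
    show "(\<lambda>z. (cutoff n z)^2) \<in> borel_measurable borel" using cutoff_measurable by measurable
  qed (use supp cut2_bound X2 in auto)
  have "n^2 / sqrt (3 * n) * cut_mass = (\<integral>x. indicator (param_box L) x * (curve_weight (x$1) * (cutoff n (xi x))^2) \<partial>lborel) / sqrt (3 * n)"
    unfolding X2 scaled_integral[OF cut2_measurable n0] cut_mass_def by simp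
  also have "\<dots> = (\<integral>x. indicator (param_box L) x * (curve_weight (x$1) * (cutoff n (xi x))^2) / sqrt (3 * n) \<partial>lborel)" by simp
  also have "\<dots> \<le> (\<integral>x. indicator (param_box L) x * (vol_density x * (cutoff n (xi x))^2) \<partial>lborel)"
  proof (rule integral_mono)
    fix x :: "real^3"
    show "indicator (param_box L) x * (curve_weight (x$1) * (cutoff n (xi x))^2) / sqrt (3 * n) \<le> indicator (param_box L) x * (vol_density x * (cutoff n (xi x))^2)"
    proof (cases "cutoff n (xi x) = 0")
      case False
      then have "n^2 < xi x \<and> xi x < 4 * n^2" using cutoff_zero[OF n0, of "xi x"] by blast
      then have "n^2 \<le> xi x" "xi x \<le> 4 * n^2" by linarith+
      then have "curve_weight (x$1) / sqrt (3 * n) * (indicator (param_box L) x * (cutoff n (xi x))^2) \<le> vol_density x * (indicator (param_box L) x * (cutoff n (xi x))^2)"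
        by (intro mult_right_mono vol_density_range[OF n]) auto
      then show ?thesis by (simp add: algebra_simps)
    qed simp
  qed (use i R(3) in auto)
  also have "\<dots> = (\<integral>q. (radial (cutoff n) q)^2 \<partial>N)" by (rule R(2)[symmetric])
  finally show "n^2 / sqrt (3 * n) * cut_mass \<le> (\<integral>q. (radial (cutoff n) q)^2 \<partial>N)" .
qed

text \<open>Pointwise size n^(-2) of the square, fibre volume n^2 and density n^(-1/2) multiply to
  n^(-1/2). Divided by the squared norm of the cut-off this is O(n^(-2)).\<close>

lemma cutoff_laplacian_norm_le:
  assumes n: "n \<ge> 1" "n \<ge> t^2"
  shows "(\<integral>q. (radial (cutoff_laplacian n) q)^2 \<partial>N) \<le> 23328^2 / sqrt n * shell_mass" and "integrable N (\<lambda>q. (radial (cutoff_laplacian n) q)^2)"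
proof -
  have n0: "n > 0" using n by simp
  have supp: "cutoff_laplacian n z = 0" if "z > 4 * n^2" for z using cutoff_laplacian_zero[OF n0, of z] that by simp
  note R = radial_square_integrable[of "cutoff_laplacian n" "23328 / n" "4 * n^2", OF cutoff_laplacian_measurable cutoff_laplacian_bound[OF n] supp]
  show "integrable N (\<lambda>q. (radial (cutoff_laplacian n) q)^2)" by (rule R(1))
  have im: "(indicator {1..4} :: real \<Rightarrow> real) \<in> borel_measurable borel" by simp
  have i: "integrable lborel (\<lambda>x. indicator (param_box L) x * (curve_weight (x$1) * indicator {1..4} (xi x / n^2)))"
    by (rule integrable_weighted[OF continuous_curve_weight, where C=1 and M="4*n^2" and k="\<lambda>z. indicator {1..4} (z / n^2)"])
      (use n0 in \<open>auto simp: indicator_def field_simps\<close>)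
  have "(\<integral>q. (radial (cutoff_laplacian n) q)^2 \<partial>N) = (\<integral>x. indicator (param_box L) x * (vol_density x * (cutoff_laplacian n (xi x))^2) \<partial>lborel)"
    by (rule R(2))
  also have "\<dots> \<le> (\<integral>x. (23328 / n)^2 / sqrt n * (indicator (param_box L) x * (curve_weight (x$1) * indicator {1..4} (xi x / n^2))) \<partial>lborel)"
  proof (rule integral_mono)
    fix x :: "real^3"
    show "indicator (param_box L) x * (vol_density x * (cutoff_laplacian n (xi x))^2) \<le> (23328 / n)^2 / sqrt n * (indicator (param_box L) x * (curve_weight (x$1) * indicator {1..4} (xi x / n^2)))"
    proof (cases "n^2 < xi x \<and> xi x < 4 * n^2")
      case True
      then have "indicator {1..4} (xi x / n^2) = (1::real)" using n0 by (simp add: indicator_def field_simps)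
      moreover have "vol_density x * (cutoff_laplacian n (xi x))^2 \<le> curve_weight (x$1) / sqrt n * (23328 / n)^2"
      proof (rule mult_mono)
        show "vol_density x \<le> curve_weight (x$1) / sqrt n" using vol_density_range(2)[OF n] True by simp
        have "\<bar>cutoff_laplacian n (xi x)\<bar>^2 \<le> (23328 / n)^2" using cutoff_laplacian_bound[OF n] by (intro power_mono) auto
        then show "(cutoff_laplacian n (xi x))^2 \<le> (23328 / n)^2" by simp
        show "0 \<le> curve_weight (x$1) / sqrt n" using curve_weight_pos[of "x$1"] n0 by simp
      qed simp
      ultimately show ?thesis by (cases "x \<in> param_box L") (simp_all add: algebra_simps)
    next
      case False
      have "0 \<le> (23328 / n)^2 / sqrt n * (indicator (param_box L) x * (curve_weight (x$1) * indicator {1..4} (xi x / n^2)))"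
        using n0 curve_weight_pos[of "x$1"] by simp
      then show ?thesis using cutoff_laplacian_zero[OF n0 False] by simp
    qed
  qed (use i R(3) in auto)
  also have "\<dots> = (23328 / n)^2 / sqrt n * (n^2 * shell_mass)"
    using scaled_integral[OF im n0] by (simp add: shell_mass_def)
  also have "\<dots> = 23328^2 / sqrt n * shell_mass" using n0 by (simp add: power_divide)
  finally show "(\<integral>q. (radial (cutoff_laplacian n) q)^2 \<partial>N) \<le> 23328^2 / sqrt n * shell_mass" .
qed

section \<open>Infinite codimension of the range\<close>

lemma test_pairing:
  assumes n: "n > 0" and T: "(\<phi>, g) \<in> closed_laplacian t A c L"
    and i: "integrable N (\<lambda>q. (radial (cutoff n) q)\<^sup>2)" "integrable N (\<lambda>q. (radial (cutoff_laplacian n) q)\<^sup>2)"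
  shows "(\<integral>q. g q * of_real (radial (cutoff n) q) \<partial>N) = (\<integral>q. \<phi> q * of_real (radial (cutoff_laplacian n) q) \<partial>N)"
proof (rule op_closure_pairing[OF radial_measurable[OF cutoff_measurable] i(1) radial_measurable[OF cutoff_laplacian_measurable] i(2) _ T[unfolded closed_laplacian_def]])
  fix \<psi> h assume "(\<psi>, h) \<in> {(\<phi>, laplacian t A c L \<phi>) |\<phi>. \<phi> \<in> test_functions A c}" and L2: "\<psi> \<in> L2 N" "h \<in> L2 N"
  then have h: "h = laplacian t A c L \<psi>" and \<psi>: "\<psi> \<in> test_functions A c" by auto
  show "(\<integral>q. h q * of_real (radial (cutoff n) q) \<partial>N) = (\<integral>q. \<psi> q * of_real (radial (cutoff_laplacian n) q) \<partial>N)"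
    unfolding h
    by (rule laplacian_pairing[OF cutoff_deriv[OF n] cutoff_continuous(3), where M="4 * n^2"])
      (use cutoff_zero[OF n] \<psi> L2 in \<open>auto simp: L2_def h\<close>)
qed

lemma laplacian_infinite_codim:
  "\<not> finite_dim_modulo N (L2 N) (op_range (closed_laplacian t A c L))"
proof -
  \<comment> \<open>Starting from this radius keeps all dyadic radii within the range n >= 1, n >=
    t^2 of the estimates.\<close>
  define m where "m = max 1 (t^2)"
  define r where "r k = m * 2 ^ k" for k :: nat
  have m1: "m \<ge> 1" "m \<ge> t^2" by (auto simp: m_def)
  have rm: "m \<le> r k" for k
    unfolding r_def using mult_left_mono[of 1 "2 ^ k" m] m1 by simp
  have r: "r k \<ge> 1" "r k \<ge> t^2" "r k > 0" for k using rm[of k] m1 by linarith+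
  have r2: "2 ^ k \<le> r k" for k
    unfolding r_def using mult_right_mono[of 1 m "2 ^ k"] m1 by simp
  define v where "v k = (\<integral>q. (radial (cutoff (r k)) q)\<^sup>2 \<partial>N)" for k
  have vge: "(r k)^2 / sqrt (3 * r k) * cut_mass \<le> v k" for k
    unfolding v_def by (rule cutoff_norm_ge(1)[OF r(1,2)])
  have lpos: "0 < (r k)^2 / sqrt (3 * r k) * cut_mass" for k using r(3)[of k] cut_mass_pos by simp
  have v: "v k > 0" for k using vge[of k] lpos[of k] by linarith
  note iX = cutoff_norm_ge(2)[OF r(1,2)] and iH = cutoff_laplacian_norm_le(2)[OF r(1,2)]
  \<comment> \<open>Dividing both functions by the norm of the cut-off keeps the pairing identity
    and turns the norm of \<open>e k\<close> into the quotient that has to tend to 0.\<close>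
  define p where "p k q = radial (cutoff (r k)) q / sqrt (v k)" for k q
  define e where "e k q = radial (cutoff_laplacian (r k)) q / sqrt (v k)" for k q
  have p2: "(\<lambda>q. (p k q)\<^sup>2) = (\<lambda>q. (radial (cutoff (r k)) q)\<^sup>2 / v k)" 
    and e2: "(\<lambda>q. (e k q)\<^sup>2) = (\<lambda>q. (radial (cutoff_laplacian (r k)) q)\<^sup>2 / v k)" for k
    using v[of k] by (auto simp: p_def e_def power_divide)
  show ?thesis
  proof (rule infinite_codim_range)
    show "p k \<in> borel_measurable N" for k
      unfolding p_def[abs_def] using radial_measurable[OF cutoff_measurable] by measurable
    show "e k \<in> borel_measurable N" for k
      unfolding e_def[abs_def] using radial_measurable[OF cutoff_laplacian_measurable] by measurable
    show "integrable N (\<lambda>q. (p k q)\<^sup>2)" "integrable N (\<lambda>q. (e k q)\<^sup>2)" for k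
      unfolding p2 e2 using iX iH by simp_all
    show "(\<integral>q. (p k q)\<^sup>2 \<partial>N) = 1" for k
      unfolding p2 using v[of k] by (simp add: v_def)
    show "p k q * p l q = 0" if "q \<in> space N" "k \<noteq> l" for k l q
    proof -
      have *: "radial (cutoff (r k)) q * radial (cutoff (r l)) q = 0" if "k < l" for k l
      proof -
        \<comment> \<open>The cut-offs vanish at both ends of their shells, so doubling the radius
          is enough for disjoint supports.\<close>
        have "2 * r k \<le> r l"
        proof -
          have "(2::real) ^ Suc k \<le> 2 ^ l" using that by (intro power_increasing) auto
          then have "m * 2 ^ Suc k \<le> m * 2 ^ l" using m1 by (intro mult_left_mono) auto
          then show ?thesis by (simp add: r_def mult.left_commute)
        qed
        then have "(2 * r k)^2 \<le> (r l)^2" using r(3)[of k] by (intro power_mono) auto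
        then have "\<not> ((r k)^2 < z \<and> z < 4 * (r k)^2) \<or> \<not> ((r l)^2 < z \<and> z < 4 * (r l)^2)" for z
          by (auto simp: power_mult_distrib)
        then have "cutoff (r k) z = 0 \<or> cutoff (r l) z = 0" for z
          using cutoff_zero[OF r(3)] by blast
        then show ?thesis by (simp add: radial_def)
      qed
      have "radial (cutoff (r k)) q * radial (cutoff (r l)) q = 0"
        using *[of k l] *[of l k] that(2) by (cases k l rule: linorder_cases) auto
      then show ?thesis by (auto simp: p_def)
    qed
    have le: "(\<integral>q. (e k q)\<^sup>2 \<partial>N) \<le> 23328^2 * sqrt 3 * shell_mass / cut_mass * (1/2)^k" for k
    proof -
      have "(\<integral>q. (e k q)\<^sup>2 \<partial>N) = (\<integral>q. (radial (cutoff_laplacian (r k)) q)\<^sup>2 \<partial>N) / v k" unfolding e2 by simp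
      also have "\<dots> \<le> (23328^2 / sqrt (r k) * shell_mass) / ((r k)^2 / sqrt (3 * r k) * cut_mass)"
        using cutoff_laplacian_norm_le(1)[OF r(1,2)] vge[of k] lpos[of k] shell_mass_nonneg r(3)[of k] by (intro frac_le) auto
      also have "\<dots> = 23328^2 * sqrt 3 * shell_mass / cut_mass * (1 / (r k)^2)"
        using r(3)[of k] cut_mass_pos by (simp add: real_sqrt_mult field_simps)
      also have "\<dots> \<le> 23328^2 * sqrt 3 * shell_mass / cut_mass * (1/2)^k"
      proof (rule mult_left_mono)
        have "2 ^ k \<le> (r k)^2" using r2[of k] self_le_power[OF r(1)[of k], of 2] by simp
        then show "1 / (r k)^2 \<le> (1/2)^k" using r(3)[of k] by (simp add: power_divide frac_le)
        show "0 \<le> 23328^2 * sqrt 3 * shell_mass / cut_mass" using cut_mass_pos shell_mass_nonneg by simp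
      qed
      finally show ?thesis .
    qed
    have lim: "(\<lambda>k. 23328^2 * sqrt 3 * shell_mass / cut_mass * (1/2)^k) \<longlonglongrightarrow> 0"
      by (intro tendsto_mult_right_zero LIMSEQ_realpow_zero) auto
    have ge: "0 \<le> (\<integral>q. (e k q)\<^sup>2 \<partial>N)" for k by (intro integral_nonneg_AE) simp
    show "(\<lambda>k. \<integral>q. (e k q)\<^sup>2 \<partial>N) \<longlonglongrightarrow> 0"
      by (rule tendsto_sandwich[OF always_eventually[OF allI[OF ge]] always_eventually[OF allI[OF le]] tendsto_const lim])
    show "\<phi> \<in> L2 N \<and> g \<in> L2 N \<and> (\<integral>q. g q * of_real (p k q) \<partial>N) = (\<integral>q. \<phi> q * of_real (e k q) \<partial>N)"
      if T: "(\<phi>, g) \<in> closed_laplacian t A c L" for \<phi> g k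
    proof (intro conjI)
      show "\<phi> \<in> L2 N" "g \<in> L2 N" using T unfolding closed_laplacian_def op_closure_def by blast+
      show "(\<integral>q. g q * of_real (p k q) \<partial>N) = (\<integral>q. \<phi> q * of_real (e k q) \<partial>N)"
        unfolding p_def e_def of_real_divide times_divide_eq_right integral_divide_zero
        by (simp only: test_pairing[OF r(3) T iX iH])
    qed
  qed
qed

lemma zero_in_essential_spectrum: "0 \<in> essential_spectrum N (closed_laplacian t A c L)"
proof -
  have "op_range (op_shift T 0) = op_range T" for T :: "EH oper"
    by (auto simp: op_range_def op_shift_def)
  then show ?thesis
    using laplacian_infinite_codim by (simp add: essential_spectrum_def fredholm_def)
qed

end

theorem theorem9:
  fixes t L \<delta> :: real and c :: "real \<Rightarrow> complex" and A :: "complex^2^2"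
  assumes "t > 0"
    and "smooth_closed_curve c L"
    and "unitary2 A"
    and "\<delta> > 0"
  shows "Inf {ereal r | r. complex_of_real r \<in>
           essential_spectrum (volume_measure t A c L) (closed_laplacian t A c L)} < ereal \<delta>"
proof -
  interpret eh_curve t L c A by unfold_locales (use assms in auto)
  \<comment> \<open>A single member bounds the infimum from above, and 0 serves every
    \<open>\<delta>\<close>.\<close>
  have "ereal 0 \<in> {ereal r | r. complex_of_real r \<in> essential_spectrum N (closed_laplacian t A c L)}"
    using zero_in_essential_spectrum by (intro CollectI exI[of _ 0]) simp
  then have "Inf {ereal r | r. complex_of_real r \<in> essential_spectrum N (closed_laplacian t A c L)} \<le> ereal 0"
    by (rule Inf_lower)
  also have "\<dots> < ereal \<delta>" using assms(4) by simp
  finally show ?thesis .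
qed

end
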